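(* ($\mathsf{ZF}$) A $\mathrm{CCC}_3$ notion of forcing cannot change cofinalities or collapse any cardinal $\kappa>\omega_1$; and if $\omega_1$ is regular, then a $\mathrm{CCC}_3$ notion of forcing does not change cofinalities or collapse cardinals at all.
   Context: A notion of forcing is a preordered set $\mathbb P$ with a maximum. Conditions are compatible if they have a common extension. $D\subseteq\mathbb P$ is predense if every $p\in\mathbb P$ is compatible with some member of $D$. $\mathbb P$ is $\mathrm{CCC}_3$ if every predense subset of $\mathbb P$ contains a countable predense subset. Here cardinals $\kappa$ are $\aleph$ numbers (well-ordered cardinals). A forcing collapses $\kappa$ if $\kappa$ is a cardinal in the ground model but not in the generic extension, and changes cofinalities if some limit ordinal has a different cofinality in the generic extension than in the ground model. *)

theory Defs
  imports Main
begin

text \<open>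
  A theorem of ZF is a statement true in every model of ZF.  Since the ambient logic HOL has
  choice, nothing set-theoretic is rendered by HOL sets: everything below is evaluated inside an
  arbitrary first-order structure \<open>S\<close> for the language of set theory, all quantifiers ranging over
  its universe.  \<open>S\<close> need not be countable or well-founded.
\<close>

record 'a set_structure =
  Univ :: "'a set"
  Mem :: "'a \<Rightarrow> 'a \<Rightarrow> bool"

abbreviation memb :: "'a \<Rightarrow> 'a set_structure \<Rightarrow> 'a \<Rightarrow> bool"  ("_ \<epsilon>\<^bsub>_\<^esub> _" [51, 0, 51] 50)
  where "x \<epsilon>\<^bsub>S\<^esub> y \<equiv> Mem S x y"


section \<open>Models of ZF\<close>

text \<open>First-order formulas, needed for the two axiom schemes; variables are de Bruijn indices.\<close>

datatype fm = FMem nat nat | FEq nat nat | FNeg fm | FAnd fm fm | FAll fm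

primrec sat :: "'a set_structure \<Rightarrow> fm \<Rightarrow> (nat \<Rightarrow> 'a) \<Rightarrow> bool" where
  "sat S (FMem i j) e \<longleftrightarrow> e i \<epsilon>\<^bsub>S\<^esub> e j"
| "sat S (FEq i j) e \<longleftrightarrow> e i = e j"
| "sat S (FNeg A) e \<longleftrightarrow> \<not> sat S A e"
| "sat S (FAnd A B) e \<longleftrightarrow> sat S A e \<and> sat S B e"
| "sat S (FAll A) e \<longleftrightarrow> (\<forall>x\<in>Univ S. sat S A (case_nat x e))"

definition is_subset :: "'a set_structure \<Rightarrow> 'a \<Rightarrow> 'a \<Rightarrow> bool" where
  "is_subset S x y \<longleftrightarrow> (\<forall>z\<in>Univ S. z \<epsilon>\<^bsub>S\<^esub> x \<longrightarrow> z \<epsilon>\<^bsub>S\<^esub> y)"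

definition extensionality :: "'a set_structure \<Rightarrow> bool" where
  "extensionality S \<longleftrightarrow> (\<forall>x\<in>Univ S. \<forall>y\<in>Univ S.
     (\<forall>z\<in>Univ S. z \<epsilon>\<^bsub>S\<^esub> x \<longleftrightarrow> z \<epsilon>\<^bsub>S\<^esub> y) \<longrightarrow> x = y)"

definition foundation :: "'a set_structure \<Rightarrow> bool" where
  "foundation S \<longleftrightarrow> (\<forall>x\<in>Univ S. (\<exists>y\<in>Univ S. y \<epsilon>\<^bsub>S\<^esub> x) \<longrightarrow>
     (\<exists>y\<in>Univ S. y \<epsilon>\<^bsub>S\<^esub> x \<and> \<not> (\<exists>z\<in>Univ S. z \<epsilon>\<^bsub>S\<^esub> x \<and> z \<epsilon>\<^bsub>S\<^esub> y)))"

definition pairing :: "'a set_structure \<Rightarrow> bool" where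
  "pairing S \<longleftrightarrow> (\<forall>x\<in>Univ S. \<forall>y\<in>Univ S. \<exists>z\<in>Univ S. x \<epsilon>\<^bsub>S\<^esub> z \<and> y \<epsilon>\<^bsub>S\<^esub> z)"

definition union_ax :: "'a set_structure \<Rightarrow> bool" where
  "union_ax S \<longleftrightarrow> (\<forall>x\<in>Univ S. \<exists>u\<in>Univ S. \<forall>y\<in>Univ S. \<forall>z\<in>Univ S.
     z \<epsilon>\<^bsub>S\<^esub> y \<and> y \<epsilon>\<^bsub>S\<^esub> x \<longrightarrow> z \<epsilon>\<^bsub>S\<^esub> u)"

definition powerset_ax :: "'a set_structure \<Rightarrow> bool" where
  "powerset_ax S \<longleftrightarrow> (\<forall>x\<in>Univ S. \<exists>p\<in>Univ S. \<forall>y\<in>Univ S. is_subset S y x \<longrightarrow> y \<epsilon>\<^bsub>S\<^esub> p)"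

definition infinity_ax :: "'a set_structure \<Rightarrow> bool" where
  "infinity_ax S \<longleftrightarrow> (\<exists>w\<in>Univ S.
     (\<exists>e\<in>Univ S. e \<epsilon>\<^bsub>S\<^esub> w \<and> (\<forall>z\<in>Univ S. \<not> z \<epsilon>\<^bsub>S\<^esub> e)) \<and>
     (\<forall>x\<in>Univ S. x \<epsilon>\<^bsub>S\<^esub> w \<longrightarrow>
        (\<exists>y\<in>Univ S. y \<epsilon>\<^bsub>S\<^esub> w \<and> (\<forall>z\<in>Univ S. z \<epsilon>\<^bsub>S\<^esub> y \<longleftrightarrow> z \<epsilon>\<^bsub>S\<^esub> x \<or> z = x))))"

definition separation :: "'a set_structure \<Rightarrow> bool" where
  "separation S \<longleftrightarrow> (\<forall>A e. (\<forall>i. e i \<in> Univ S) \<longrightarrow>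
     (\<forall>a\<in>Univ S. \<exists>b\<in>Univ S. \<forall>x\<in>Univ S.
        x \<epsilon>\<^bsub>S\<^esub> b \<longleftrightarrow> x \<epsilon>\<^bsub>S\<^esub> a \<and> sat S A (case_nat x e)))"

definition replacement :: "'a set_structure \<Rightarrow> bool" where
  "replacement S \<longleftrightarrow> (\<forall>A e. (\<forall>i. e i \<in> Univ S) \<longrightarrow>
     (\<forall>a\<in>Univ S.
        (\<forall>x\<in>Univ S. x \<epsilon>\<^bsub>S\<^esub> a \<longrightarrow> (\<exists>!y. y \<in> Univ S \<and> sat S A (case_nat x (case_nat y e)))) \<longrightarrow>
        (\<exists>b\<in>Univ S. \<forall>x\<in>Univ S. x \<epsilon>\<^bsub>S\<^esub> a \<longrightarrow>
           (\<exists>y\<in>Univ S. y \<epsilon>\<^bsub>S\<^esub> b \<and> sat S A (case_nat x (case_nat y e))))))"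

definition ZF_model :: "'a set_structure \<Rightarrow> bool" where
  "ZF_model S \<longleftrightarrow> extensionality S \<and> foundation S \<and> pairing S \<and> union_ax S \<and> powerset_ax S \<and>
     infinity_ax S \<and> separation S \<and> replacement S"


section \<open>Pairs, functions, ordinals and cardinals inside a structure\<close>

definition is_upair :: "'a set_structure \<Rightarrow> 'a \<Rightarrow> 'a \<Rightarrow> 'a \<Rightarrow> bool" where
  "is_upair S x y z \<longleftrightarrow> (\<forall>w\<in>Univ S. w \<epsilon>\<^bsub>S\<^esub> z \<longleftrightarrow> w = x \<or> w = y)"

definition is_pair :: "'a set_structure \<Rightarrow> 'a \<Rightarrow> 'a \<Rightarrow> 'a \<Rightarrow> bool" where
  "is_pair S x y z \<longleftrightarrow> (\<exists>u\<in>Univ S. \<exists>v\<in>Univ S. is_upair S x x u \<and> is_upair S x y v \<and> is_upair S u v z)"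

text \<open>\<open>related S r x y\<close> says that the pair of \<open>x\<close> and \<open>y\<close> belongs to \<open>r\<close>.\<close>

definition related :: "'a set_structure \<Rightarrow> 'a \<Rightarrow> 'a \<Rightarrow> 'a \<Rightarrow> bool" where
  "related S r x y \<longleftrightarrow> (\<exists>z\<in>Univ S. is_pair S x y z \<and> z \<epsilon>\<^bsub>S\<^esub> r)"

definition is_function :: "'a set_structure \<Rightarrow> 'a \<Rightarrow> 'a \<Rightarrow> 'a \<Rightarrow> bool" where
  "is_function S f a b \<longleftrightarrow>
     (\<forall>z\<in>Univ S. z \<epsilon>\<^bsub>S\<^esub> f \<longrightarrow>
        (\<exists>x\<in>Univ S. \<exists>y\<in>Univ S. x \<epsilon>\<^bsub>S\<^esub> a \<and> y \<epsilon>\<^bsub>S\<^esub> b \<and> is_pair S x y z)) \<and>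
     (\<forall>x\<in>Univ S. x \<epsilon>\<^bsub>S\<^esub> a \<longrightarrow> (\<exists>!y. y \<in> Univ S \<and> related S f x y))"

definition is_injection :: "'a set_structure \<Rightarrow> 'a \<Rightarrow> 'a \<Rightarrow> 'a \<Rightarrow> bool" where
  "is_injection S f a b \<longleftrightarrow> is_function S f a b \<and>
     (\<forall>x\<in>Univ S. \<forall>x'\<in>Univ S. \<forall>y\<in>Univ S. related S f x y \<and> related S f x' y \<longrightarrow> x = x')"

definition is_bijection :: "'a set_structure \<Rightarrow> 'a \<Rightarrow> 'a \<Rightarrow> 'a \<Rightarrow> bool" where
  "is_bijection S f a b \<longleftrightarrow> is_injection S f a b \<and>
     (\<forall>y\<in>Univ S. y \<epsilon>\<^bsub>S\<^esub> b \<longrightarrow> (\<exists>x\<in>Univ S. related S f x y))"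

definition is_transitive :: "'a set_structure \<Rightarrow> 'a \<Rightarrow> bool" where
  "is_transitive S x \<longleftrightarrow> (\<forall>y\<in>Univ S. y \<epsilon>\<^bsub>S\<^esub> x \<longrightarrow> is_subset S y x)"

text \<open>By foundation, a transitive set linearly ordered by membership is well-ordered by it.\<close>

definition is_ordinal :: "'a set_structure \<Rightarrow> 'a \<Rightarrow> bool" where
  "is_ordinal S x \<longleftrightarrow> is_transitive S x \<and>
     (\<forall>y\<in>Univ S. \<forall>z\<in>Univ S. y \<epsilon>\<^bsub>S\<^esub> x \<and> z \<epsilon>\<^bsub>S\<^esub> x \<longrightarrow> y \<epsilon>\<^bsub>S\<^esub> z \<or> y = z \<or> z \<epsilon>\<^bsub>S\<^esub> y)"

definition is_limit :: "'a set_structure \<Rightarrow> 'a \<Rightarrow> bool" where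
  "is_limit S x \<longleftrightarrow> is_ordinal S x \<and> (\<exists>y\<in>Univ S. y \<epsilon>\<^bsub>S\<^esub> x) \<and>
     (\<forall>y\<in>Univ S. y \<epsilon>\<^bsub>S\<^esub> x \<longrightarrow> (\<exists>z\<in>Univ S. z \<epsilon>\<^bsub>S\<^esub> x \<and> y \<epsilon>\<^bsub>S\<^esub> z))"

definition is_omega :: "'a set_structure \<Rightarrow> 'a \<Rightarrow> bool" where
  "is_omega S w \<longleftrightarrow> is_limit S w \<and> (\<forall>x\<in>Univ S. x \<epsilon>\<^bsub>S\<^esub> w \<longrightarrow> \<not> is_limit S x)"

text \<open>Cardinals are alephs: infinite initial ordinals.\<close>

definition is_aleph :: "'a set_structure \<Rightarrow> 'a \<Rightarrow> bool" where
  "is_aleph S k \<longleftrightarrow> is_ordinal S k \<and>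
     (\<exists>w\<in>Univ S. is_omega S w \<and> (w = k \<or> w \<epsilon>\<^bsub>S\<^esub> k)) \<and>
     \<not> (\<exists>a\<in>Univ S. \<exists>f\<in>Univ S. a \<epsilon>\<^bsub>S\<^esub> k \<and> is_bijection S f a k)"

definition is_omega1 :: "'a set_structure \<Rightarrow> 'a \<Rightarrow> bool" where
  "is_omega1 S k \<longleftrightarrow> is_aleph S k \<and> (\<exists>w\<in>Univ S. is_omega S w \<and> w \<epsilon>\<^bsub>S\<^esub> k \<and>
     (\<forall>a\<in>Univ S. a \<epsilon>\<^bsub>S\<^esub> k \<and> is_aleph S a \<longrightarrow> a = w))"

definition is_countable :: "'a set_structure \<Rightarrow> 'a \<Rightarrow> bool" where
  "is_countable S x \<longleftrightarrow> (\<exists>w\<in>Univ S. \<exists>f\<in>Univ S. is_omega S w \<and> is_injection S f x w)"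

definition is_cofinal_map :: "'a set_structure \<Rightarrow> 'a \<Rightarrow> 'a \<Rightarrow> 'a \<Rightarrow> bool" where
  "is_cofinal_map S f l d \<longleftrightarrow> is_function S f l d \<and>
     (\<forall>y\<in>Univ S. y \<epsilon>\<^bsub>S\<^esub> d \<longrightarrow>
        (\<exists>x\<in>Univ S. \<exists>z\<in>Univ S. related S f x z \<and> (y \<epsilon>\<^bsub>S\<^esub> z \<or> y = z)))"

definition is_cofinality :: "'a set_structure \<Rightarrow> 'a \<Rightarrow> 'a \<Rightarrow> bool" where
  "is_cofinality S d l \<longleftrightarrow> is_ordinal S l \<and> (\<exists>f\<in>Univ S. is_cofinal_map S f l d) \<and>
     \<not> (\<exists>m\<in>Univ S. \<exists>f\<in>Univ S. m \<epsilon>\<^bsub>S\<^esub> l \<and> is_cofinal_map S f m d)"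

definition is_regular :: "'a set_structure \<Rightarrow> 'a \<Rightarrow> bool" where
  "is_regular S k \<longleftrightarrow> is_aleph S k \<and> is_cofinality S k k"


section \<open>Notions of forcing inside a structure\<close>

record 'a forcing =
  Cond :: 'a
  Leq :: 'a
  Top :: 'a

definition conds :: "'a set_structure \<Rightarrow> 'a forcing \<Rightarrow> 'a set" where
  "conds S F = {p \<in> Univ S. p \<epsilon>\<^bsub>S\<^esub> Cond F}"

abbreviation extends :: "'a set_structure \<Rightarrow> 'a forcing \<Rightarrow> 'a \<Rightarrow> 'a \<Rightarrow> bool" where
  "extends S F p q \<equiv> related S (Leq F) p q"

definition notion_of_forcing :: "'a set_structure \<Rightarrow> 'a forcing \<Rightarrow> bool" where
  "notion_of_forcing S F \<longleftrightarrow>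
     Cond F \<in> Univ S \<and> Leq F \<in> Univ S \<and> Top F \<in> conds S F \<and>
     (\<forall>p\<in>conds S F. extends S F p p) \<and>
     (\<forall>p\<in>conds S F. \<forall>q\<in>conds S F. \<forall>r\<in>conds S F. extends S F p q \<and> extends S F q r \<longrightarrow> extends S F p r) \<and>
     (\<forall>p\<in>conds S F. extends S F p (Top F))"

definition compatible :: "'a set_structure \<Rightarrow> 'a forcing \<Rightarrow> 'a \<Rightarrow> 'a \<Rightarrow> bool" where
  "compatible S F p q \<longleftrightarrow> (\<exists>r\<in>conds S F. extends S F r p \<and> extends S F r q)"

definition predense :: "'a set_structure \<Rightarrow> 'a forcing \<Rightarrow> 'a \<Rightarrow> bool" where
  "predense S F D \<longleftrightarrow> is_subset S D (Cond F) \<and>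
     (\<forall>p\<in>conds S F. \<exists>d\<in>Univ S. d \<epsilon>\<^bsub>S\<^esub> D \<and> compatible S F p d)"

definition CCC3 :: "'a set_structure \<Rightarrow> 'a forcing \<Rightarrow> bool" where
  "CCC3 S F \<longleftrightarrow> (\<forall>D\<in>Univ S. predense S F D \<longrightarrow>
     (\<exists>C\<in>Univ S. is_subset S C D \<and> is_countable S C \<and> predense S F C))"

definition dense :: "'a set_structure \<Rightarrow> 'a forcing \<Rightarrow> 'a \<Rightarrow> bool" where
  "dense S F D \<longleftrightarrow> is_subset S D (Cond F) \<and>
     (\<forall>p\<in>conds S F. \<exists>d\<in>Univ S. d \<epsilon>\<^bsub>S\<^esub> D \<and> extends S F d p)"

definition generic :: "'a set_structure \<Rightarrow> 'a forcing \<Rightarrow> 'a set \<Rightarrow> bool" where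
  "generic S F G \<longleftrightarrow> G \<subseteq> conds S F \<and> Top F \<in> G \<and>
     (\<forall>p\<in>G. \<forall>q\<in>conds S F. extends S F p q \<longrightarrow> q \<in> G) \<and>
     (\<forall>p\<in>G. \<forall>q\<in>G. \<exists>r\<in>G. extends S F r p \<and> extends S F r q) \<and>
     (\<forall>D\<in>Univ S. dense S F D \<longrightarrow> (\<exists>p\<in>G. p \<epsilon>\<^bsub>S\<^esub> D))"


section \<open>Generic extensions\<close>

text \<open>
  Every element of \<open>S\<close> serves as a name: only its members that are pairs of a name and a condition
  matter, and \<open>t\<close> names the set of the values of those \<open>s\<close> whose pair with some \<open>p \<in> G\<close> is in \<open>t\<close>.
  As \<open>S\<close> may be ill-founded, values cannot be computed by an outer recursion on names.  Instead,
  the extension consists of the names modulo equality forced by a member of \<open>G\<close>, which for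
  well-founded \<open>S\<close> is isomorphic to the usual transitive model of values.

  The relation ``\<open>p\<close> forces \<open>s = t\<close>'' is obtained by recursion inside \<open>S\<close>.  An approximation to it
  on a transitive set \<open>T\<close> of names is a set \<open>R\<close> of triples; \<open>forces_sub_step\<close> is the recursion clause
  for ``\<open>p\<close> forces \<open>s \<subseteq> t\<close>''.
\<close>

definition related3 :: "'a set_structure \<Rightarrow> 'a \<Rightarrow> 'a \<Rightarrow> 'a \<Rightarrow> 'a \<Rightarrow> bool" where
  "related3 S R p s t \<longleftrightarrow> (\<exists>u\<in>Univ S. is_pair S s t u \<and> related S R p u)"

definition forces_sub_step :: "'a set_structure \<Rightarrow> 'a forcing \<Rightarrow> 'a \<Rightarrow> 'a \<Rightarrow> 'a \<Rightarrow> 'a \<Rightarrow> bool" where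
  "forces_sub_step S F R p s t \<longleftrightarrow>
     (\<forall>x\<in>Univ S. \<forall>a\<in>conds S F. related S s x a \<longrightarrow>
        (\<forall>q\<in>conds S F. extends S F q p \<and> extends S F q a \<longrightarrow>
           (\<exists>r\<in>conds S F. extends S F r q \<and>
              (\<exists>y\<in>Univ S. \<exists>b\<in>conds S F. related S t y b \<and> extends S F r b \<and> related3 S R r x y))))"

definition forces_eq_approx :: "'a set_structure \<Rightarrow> 'a forcing \<Rightarrow> 'a \<Rightarrow> 'a \<Rightarrow> bool" where
  "forces_eq_approx S F T R \<longleftrightarrow> is_transitive S T \<and>
     (\<forall>p\<in>conds S F. \<forall>s\<in>Univ S. \<forall>t\<in>Univ S. s \<epsilon>\<^bsub>S\<^esub> T \<and> t \<epsilon>\<^bsub>S\<^esub> T \<longrightarrow>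
        (related3 S R p s t \<longleftrightarrow> forces_sub_step S F R p s t \<and> forces_sub_step S F R p t s))"

definition forces_eq :: "'a set_structure \<Rightarrow> 'a forcing \<Rightarrow> 'a \<Rightarrow> 'a \<Rightarrow> 'a \<Rightarrow> bool" where
  "forces_eq S F p s t \<longleftrightarrow> (\<exists>T\<in>Univ S. \<exists>R\<in>Univ S.
     s \<epsilon>\<^bsub>S\<^esub> T \<and> t \<epsilon>\<^bsub>S\<^esub> T \<and> forces_eq_approx S F T R \<and> related3 S R p s t)"

definition forces_mem :: "'a set_structure \<Rightarrow> 'a forcing \<Rightarrow> 'a \<Rightarrow> 'a \<Rightarrow> 'a \<Rightarrow> bool" where
  "forces_mem S F p s t \<longleftrightarrow>
     (\<forall>q\<in>conds S F. extends S F q p \<longrightarrow>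
        (\<exists>r\<in>conds S F. extends S F r q \<and>
           (\<exists>y\<in>Univ S. \<exists>b\<in>conds S F. related S t y b \<and> extends S F r b \<and> forces_eq S F r s y)))"

definition name_value :: "'a set_structure \<Rightarrow> 'a forcing \<Rightarrow> 'a set \<Rightarrow> 'a \<Rightarrow> 'a set" where
  "name_value S F G t = {s \<in> Univ S. \<exists>p\<in>G. forces_eq S F p s t}"

definition generic_extension :: "'a set_structure \<Rightarrow> 'a forcing \<Rightarrow> 'a set \<Rightarrow> 'a set set_structure" where
  "generic_extension S F G =
     \<lparr>Univ = name_value S F G ` Univ S,
      Mem = (\<lambda>X Y. \<exists>s\<in>X. \<exists>t\<in>Y. \<exists>p\<in>G. forces_mem S F p s t)\<rparr>"

text \<open>
  The canonical name of \<open>x\<close> consists of the pairs of the canonical name of \<open>y\<close> with the maximal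
  condition, for \<open>y\<close> in \<open>x\<close>; again a recursion carried out inside \<open>S\<close>.
\<close>

definition is_check_name :: "'a set_structure \<Rightarrow> 'a forcing \<Rightarrow> 'a \<Rightarrow> 'a \<Rightarrow> bool" where
  "is_check_name S F x c \<longleftrightarrow> (\<exists>T\<in>Univ S. \<exists>f\<in>Univ S.
     is_transitive S T \<and> x \<epsilon>\<^bsub>S\<^esub> T \<and>
     (\<forall>y\<in>Univ S. y \<epsilon>\<^bsub>S\<^esub> T \<longrightarrow> (\<exists>!z. z \<in> Univ S \<and> related S f y z)) \<and>
     (\<forall>y\<in>Univ S. \<forall>z\<in>Univ S. y \<epsilon>\<^bsub>S\<^esub> T \<and> related S f y z \<longrightarrow>
        (\<forall>w\<in>Univ S. w \<epsilon>\<^bsub>S\<^esub> z \<longleftrightarrow>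
           (\<exists>u\<in>Univ S. \<exists>v\<in>Univ S. u \<epsilon>\<^bsub>S\<^esub> y \<and> related S f u v \<and> is_pair S v (Top F) w))) \<and>
     related S f x c)"

definition ground_embedding :: "'a set_structure \<Rightarrow> 'a forcing \<Rightarrow> 'a set \<Rightarrow> 'a \<Rightarrow> 'a set" where
  "ground_embedding S F G x = name_value S F G (THE c. c \<in> Univ S \<and> is_check_name S F x c)"

text \<open>
  Both notions quantify over all generic filters in HOL.  An uncountable \<open>S\<close> may have none, but every
  countable \<open>S\<close> has one through each condition, so excluding either notion for all models of ZF
  amounts to ZF proving that no condition forces it.
\<close>

definition collapses :: "'a set_structure \<Rightarrow> 'a forcing \<Rightarrow> 'a \<Rightarrow> bool" where
  "collapses S F k \<longleftrightarrow> (\<exists>G. generic S F G \<and> is_aleph S k \<and>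
     \<not> is_aleph (generic_extension S F G) (ground_embedding S F G k))"

definition changes_cofinalities :: "'a set_structure \<Rightarrow> 'a forcing \<Rightarrow> bool" where
  "changes_cofinalities S F \<longleftrightarrow> (\<exists>G. generic S F G \<and>
     (\<exists>d\<in>Univ S. \<exists>l\<in>Univ S. is_limit S d \<and> is_cofinality S d l \<and>
        \<not> is_cofinality (generic_extension S F G)
             (ground_embedding S F G d) (ground_embedding S F G l)))"

end

(*
  Let f be a function in the extension from a ground model ordinal m to a ground model ordinal k.
  For x in m let X(x) be the set of all y such that some condition (below a fixed member of the
  filter that forces f to be single valued) forces f(x) = y.  The conditions that decide f(x),
  together with those below which f(x) is never decided, are predense; a countable predense
  subset of them already decides every member of X(x), so X(x) is countable, and x |-> X(x) is in
  the ground model.  No choice is used because the whole of X(x) is covered, not a selection from it.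

  Cofinalities: if the cofinality of d exceeds omega, every X(x) is bounded in d, so a cofinal map
  m -> d in the extension yields the ground model cofinal map x |-> least bound of X(x).  For finite m
  countability is of no help and a density argument is used.  Cardinals: if f maps onto k and
  k > omega_1, then the pairs (least x with y in X(x), order type of the part of X(x) below y) embed
  k into m x omega_1, which contradicts Hessenberg's theorem.

  As the model may be ill-founded, all recursions take place inside it.  Every use of separation and
  replacement rests on a calculus of HOL predicates that are first-order definable with parameters.
*)
theory Submission
  imports Defs
begin

section \<open>Definability with parameters\<close>

text \<open>The ground model sees a function \<open>f\<close> of the extension through one relation
  only: that \<open>f\<close> relates two canonical names. \<open>related_forcing\<close> supplies a
  definable witness for it, and the combinatorial arguments about \<open>f\<close> are carried out
  with that witness. The line between omega_1 and larger cardinals is drawn by the target m x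
  omega_1 of the embedding. Hessenberg's theorem yields a contradiction only if both factors lie
  below k, which fails for k = omega_1. This is a genuine obstacle in ZF, where a union of countably
  many countable sets may be uncountable and omega_1 may have cofinality omega. If omega_1 is
  regular, a bijection from a smaller ordinal would be a new cofinal map, so preservation of
  cofinalities protects it; omega is protected by the bound for functions on finite domains.
  Wherever a selection threatens to require choice, a least ordinal or an order type takes its
  place.\<close>

primrec rename :: "(nat \<Rightarrow> nat) \<Rightarrow> fm \<Rightarrow> fm" where
  "rename r (FMem i j) = FMem (r i) (r j)"
| "rename r (FEq i j) = FEq (r i) (r j)"
| "rename r (FNeg A) = FNeg (rename r A)"
| "rename r (FAnd A B) = FAnd (rename r A) (rename r B)"
| "rename r (FAll A) = FAll (rename (case_nat 0 (\<lambda>n. Suc (r n))) A)"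

lemma sat_rename: "sat S (rename r A) e \<longleftrightarrow> sat S A (\<lambda>n. e (r n))"
proof (induction A arbitrary: r e)
  case (FAll A)
  have "(\<lambda>n. case_nat x e (case_nat 0 (\<lambda>n. Suc (r n)) n)) = case_nat x (\<lambda>n. e (r n))" for x
    by (auto simp: fun_eq_iff split: nat.splits)
  with FAll show ?case by simp
qed auto

definition inst :: "(nat \<Rightarrow> nat + 'a) \<Rightarrow> (nat \<Rightarrow> 'a) \<Rightarrow> nat \<Rightarrow> 'a" where
  "inst t e = (\<lambda>n. case t n of Inl i \<Rightarrow> e i | Inr c \<Rightarrow> c)"

definition params_in :: "'a set_structure \<Rightarrow> (nat \<Rightarrow> nat + 'a) \<Rightarrow> bool" where
  "params_in S t \<longleftrightarrow> (\<forall>n c. t n = Inr c \<longrightarrow> c \<in> Univ S)"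

definition envs :: "'a set_structure \<Rightarrow> (nat \<Rightarrow> 'a) set" where
  "envs S = {e. \<forall>i. e i \<in> Univ S}"

text \<open>The formula is hidden behind an existential quantifier, so that closure properties can
  be used without ever writing it down. Agreement is demanded on environments over the universe
  only, because the quantifiers of formulas range there.\<close>

definition definable :: "'a set_structure \<Rightarrow> ((nat \<Rightarrow> 'a) \<Rightarrow> bool) \<Rightarrow> bool" where
  "definable S P \<longleftrightarrow> (\<exists>A t. params_in S t \<and> (\<forall>e\<in>envs S. P e \<longleftrightarrow> sat S A (inst t e)))"

text \<open>
  Variables are accessed through the head \<open>vh\<close> and the tail \<open>vt\<close> of an environment only.  Then the
  closure rules below are higher-order patterns, and definability is proved by resolution alone.
\<close>

definition vh :: "(nat \<Rightarrow> 'a) \<Rightarrow> 'a" where "vh e = e 0"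
definition vt :: "(nat \<Rightarrow> 'a) \<Rightarrow> nat \<Rightarrow> 'a" where "vt e = (\<lambda>n. e (Suc n))"

lemma vh_case_nat [simp]: "vh (case_nat x e) = x"
  and vt_case_nat [simp]: "vt (case_nat x e) = e"
  by (auto simp: vh_def vt_def)

lemma case_nat_in_envs [simp]: "case_nat x e \<in> envs S \<longleftrightarrow> x \<in> Univ S \<and> e \<in> envs S"
  by (auto simp: envs_def split: nat.splits)

lemma vt_in_envs [simp]: "e \<in> envs S \<Longrightarrow> vt e \<in> envs S"
  and vh_in_Univ [simp]: "e \<in> envs S \<Longrightarrow> vh e \<in> Univ S"
  by (auto simp: envs_def vt_def vh_def)

lemma inst_in_envs: "params_in S t \<Longrightarrow> e \<in> envs S \<Longrightarrow> inst t e \<in> envs S"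
  by (auto simp: params_in_def envs_def inst_def split: sum.splits)

lemma definable_cong:
  assumes "definable S P" "\<And>e. e \<in> envs S \<Longrightarrow> P e = Q e"
  shows "definable S Q"
  using assms unfolding definable_def by (metis (no_types, lifting))

text \<open>Two instantiations compose to one. Permuting, skipping or duplicating variables and
  freezing some of them as parameters are all special cases.\<close>

lemma definable_inst:
  assumes "definable S P" "params_in S s"
  shows "definable S (\<lambda>e. P (inst s e))"
proof -
  obtain A t where t: "params_in S t" and A: "\<And>e. e \<in> envs S \<Longrightarrow> P e \<longleftrightarrow> sat S A (inst t e)"
    using assms(1) unfolding definable_def by blast
  define t' where "t' = (\<lambda>n. case t n of Inl i \<Rightarrow> s i | Inr c \<Rightarrow> Inr c)"
  have "inst t (inst s e) = inst t' e" for e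
    by (auto simp: inst_def t'_def fun_eq_iff split: sum.splits)
  moreover have "params_in S t'"
    using t assms(2) by (auto simp: params_in_def t'_def split: sum.splits)
  ultimately show ?thesis
    unfolding definable_def using A inst_in_envs[OF assms(2)] by metis
qed

lemma definable_not: "definable S P \<Longrightarrow> definable S (\<lambda>e. \<not> P e)"
  unfolding definable_def by (metis sat.simps(3))

lemma definable_conj:
  assumes "definable S P" "definable S Q"
  shows "definable S (\<lambda>e. P e \<and> Q e)"
proof -
  obtain A s where s: "params_in S s" and A: "\<And>e. e \<in> envs S \<Longrightarrow> P e \<longleftrightarrow> sat S A (inst s e)"
    using assms(1) unfolding definable_def by blast
  obtain B t where t: "params_in S t" and B: "\<And>e. e \<in> envs S \<Longrightarrow> Q e \<longleftrightarrow> sat S B (inst t e)"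
    using assms(2) unfolding definable_def by blast
  \<comment> \<open>The witnesses for the two conjuncts may disagree about a variable, so they are
    kept apart: even variables serve the first formula, odd ones the second.\<close>
  define u where "u = (\<lambda>n. if even n then s (n div 2) else t (n div 2))"
  have "params_in S u" using s t by (auto simp: params_in_def u_def split: if_splits)
  moreover have "P e \<and> Q e \<longleftrightarrow>
      sat S (FAnd (rename (\<lambda>n. 2 * n) A) (rename (\<lambda>n. Suc (2 * n)) B)) (inst u e)"
    if "e \<in> envs S" for e
    using A[OF that] B[OF that] by (simp add: sat_rename inst_def u_def)
  ultimately show ?thesis unfolding definable_def by blast
qed

text \<open>Binding concerns position 0 of the environment, while any number of formula variables
  may be mapped there by \<open>t\<close>. All of these are renamed to the bound variable 0; the
  rest move up by one, and \<open>shift_inst\<close> lowers the positions they refer to. The value 0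
  - 1 = 0 that it produces at \<open>Inl 0\<close> is never read.\<close>

definition bump :: "(nat \<Rightarrow> nat + 'a) \<Rightarrow> nat \<Rightarrow> nat" where
  "bump t n = (if t n = Inl 0 then 0 else Suc n)"

definition shift_inst :: "(nat \<Rightarrow> nat + 'a) \<Rightarrow> nat \<Rightarrow> nat + 'a" where
  "shift_inst t n = (case t n of Inl i \<Rightarrow> Inl (i - 1) | Inr c \<Rightarrow> Inr c)"

lemma params_in_shift: "params_in S t \<Longrightarrow> params_in S (shift_inst t)"
  by (auto simp: params_in_def shift_inst_def split: sum.splits)

lemma sat_bump:
  "sat S (rename (bump t) A) (case_nat x (inst (shift_inst t) e)) \<longleftrightarrow> sat S A (inst t (case_nat x e))"
proof -
  have "(\<lambda>n. case_nat x (inst (shift_inst t) e) (bump t n)) = inst t (case_nat x e)"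
    by (auto simp: inst_def bump_def shift_inst_def fun_eq_iff split: sum.splits nat.splits)
  then show ?thesis by (simp add: sat_rename)
qed

lemma definable_all_nat:
  assumes "definable S P"
  shows "definable S (\<lambda>e. \<forall>x\<in>Univ S. P (case_nat x e))"
proof -
  obtain A t where t: "params_in S t" and A: "\<And>e. e \<in> envs S \<Longrightarrow> P e \<longleftrightarrow> sat S A (inst t e)"
    using assms unfolding definable_def by blast
  show ?thesis unfolding definable_def
    by (rule exI[of _ "FAll (rename (bump t) A)"], rule exI[of _ "shift_inst t"])
      (auto simp: sat_bump A params_in_shift[OF t])
qed

lemma definable_all:
  assumes "definable S (\<lambda>e. Q (vt e) (vh e))"
  shows "definable S (\<lambda>e. \<forall>x\<in>Univ S. Q e x)"
  using definable_all_nat[OF assms] by simp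

lemma definable_disj:
  assumes "definable S P" "definable S Q"
  shows "definable S (\<lambda>e. P e \<or> Q e)"
  using definable_not[OF definable_conj[OF assms[THEN definable_not]]] by simp

lemma definable_imp:
  assumes "definable S P" "definable S Q"
  shows "definable S (\<lambda>e. P e \<longrightarrow> Q e)"
  by (rule definable_cong[OF definable_disj[OF definable_not[OF assms(1)] assms(2)]]) blast

lemma definable_iff:
  assumes "definable S P" "definable S Q"
  shows "definable S (\<lambda>e. P e \<longleftrightarrow> Q e)"
  by (rule definable_cong[OF definable_conj[OF definable_imp[OF assms] definable_imp[OF assms(2,1)]]]) blast

lemma definable_ex:
  "definable S (\<lambda>e. Q (vt e) (vh e)) \<Longrightarrow> definable S (\<lambda>e. \<exists>x\<in>Univ S. Q e x)"
  using definable_not[OF definable_all[OF definable_not, of S Q]] by simp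

lemma definable_const: "definable S (\<lambda>e. b)"
proof -
  have "definable S (\<lambda>e. e 0 = e 0)"
    unfolding definable_def
    by (rule exI[of _ "FEq 0 0"], rule exI[of _ Inl]) (auto simp: inst_def params_in_def)
  then show ?thesis
    using definable_not[of S "\<lambda>e. e 0 = e 0"] by (cases b) simp_all
qed

text \<open>These are the iterates of \<open>vt\<close>. The predicate lets nested accesses be
  recognised by resolution instead of counting.\<close>

definition tail_map :: "((nat \<Rightarrow> 'a) \<Rightarrow> nat \<Rightarrow> 'a) \<Rightarrow> bool" where
  "tail_map g \<longleftrightarrow> (\<exists>n. g = (\<lambda>e i. e (n + i)))"

lemma tail_map_id: "tail_map (\<lambda>e. e)"
  unfolding tail_map_def by (rule exI[of _ 0]) auto

lemma tail_map_vt: "tail_map g \<Longrightarrow> tail_map (\<lambda>e. vt (g e))"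
  unfolding tail_map_def vt_def by (metis add_Suc_shift)

lemma definable_tail:
  assumes "definable S P" "tail_map g"
  shows "definable S (\<lambda>e. P (g e))"
proof -
  obtain n where g: "g = (\<lambda>e i. e (n + i))" using assms(2) by (auto simp: tail_map_def)
  have "definable S (\<lambda>e. P (inst (\<lambda>i. Inl (n + i)) e))"
    by (rule definable_inst[OF assms(1)]) (auto simp: params_in_def)
  then show ?thesis by (simp add: inst_def g)
qed

text \<open>The language has no function symbols, so a term is an HOL function with a definable
  graph; its value has to stay in the universe for quantifiers to reach it.\<close>

definition dterm :: "'a set_structure \<Rightarrow> ((nat \<Rightarrow> 'a) \<Rightarrow> 'a) \<Rightarrow> bool" where
  "dterm S t \<longleftrightarrow> (\<forall>e\<in>envs S. t e \<in> Univ S) \<and> definable S (\<lambda>e. vh e = t (vt e))"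

lemma dterm_in_Univ: "dterm S t \<Longrightarrow> e \<in> envs S \<Longrightarrow> t e \<in> Univ S"
  by (auto simp: dterm_def)

lemma dterm_var:
  assumes "tail_map g"
  shows "dterm S (\<lambda>e. vh (g e))"
proof -
  obtain n where g: "g = (\<lambda>e i. e (n + i))" using assms by (auto simp: tail_map_def)
  have "definable S (\<lambda>e. e 0 = e (Suc n))" unfolding definable_def
    by (rule exI[of _ "FEq 0 (Suc n)"], rule exI[of _ Inl]) (auto simp: inst_def params_in_def)
  then show ?thesis by (auto simp: dterm_def g vh_def vt_def envs_def)
qed

lemma dterm_const:
  assumes "c \<in> Univ S"
  shows "dterm S (\<lambda>e. c)"
proof -
  have "definable S (\<lambda>e. e 0 = c)" unfolding definable_def
    by (rule exI[of _ "FEq 0 1"], rule exI[of _ "\<lambda>n. if n = 0 then Inl 0 else Inr c"])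
      (use assms in \<open>auto simp: inst_def params_in_def\<close>)
  then show ?thesis using assms by (auto simp: dterm_def vh_def)
qed

lemma dterm_tail: "dterm S t \<Longrightarrow> tail_map g \<Longrightarrow> dterm S (\<lambda>e. t (g e))"
proof -
  assume t: "dterm S t" and "tail_map g"
  then obtain n where g: "g = (\<lambda>e i. e (n + i))" by (auto simp: tail_map_def)
  have *: "definable S (\<lambda>e. vh e = t (vt e))" using t by (simp add: dterm_def)
  have "definable S (\<lambda>e. (\<lambda>e. vh e = t (vt e)) (inst (\<lambda>i. if i = 0 then Inl 0 else Inl (n + i)) e))"
    by (rule definable_inst[OF *]) (auto simp: params_in_def)
  then have "definable S (\<lambda>e. vh e = t (g (vt e)))"
    by (simp add: inst_def g vh_def vt_def)
  moreover have "t (g e) \<in> Univ S" if "e \<in> envs S" for e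
    using that t by (auto simp: dterm_def g envs_def)
  ultimately show ?thesis by (simp add: dterm_def)
qed

text \<open>A term is eliminated in favour of its graph: some x equals \<open>t e\<close> and
  satisfies \<open>Q x e\<close>.\<close>

lemma definable_subst:
  assumes "definable S (\<lambda>e. Q (vh e) (vt e))" "dterm S t"
  shows "definable S (\<lambda>e. Q (t e) e)"
proof -
  have "definable S (\<lambda>e. \<exists>x\<in>Univ S. x = t e \<and> Q x e)"
    by (rule definable_ex, rule definable_conj) (use assms in \<open>auto simp: dterm_def\<close>)
  then show ?thesis by (rule definable_cong) (use assms(2) in \<open>auto simp: dterm_def\<close>)
qed

text \<open>Fixed arities allow a notion to be shown definable once, on variables, and then to be
  used on arbitrary terms through the rules ending in \<open>D\<close>.\<close>

definition dpred1 :: "'a set_structure \<Rightarrow> ('a \<Rightarrow> bool) \<Rightarrow> bool" where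
  "dpred1 S P \<longleftrightarrow> definable S (\<lambda>e. P (vh e))"
definition dpred2 :: "'a set_structure \<Rightarrow> ('a \<Rightarrow> 'a \<Rightarrow> bool) \<Rightarrow> bool" where
  "dpred2 S P \<longleftrightarrow> definable S (\<lambda>e. P (vh e) (vh (vt e)))"
definition dpred3 :: "'a set_structure \<Rightarrow> ('a \<Rightarrow> 'a \<Rightarrow> 'a \<Rightarrow> bool) \<Rightarrow> bool" where
  "dpred3 S P \<longleftrightarrow> definable S (\<lambda>e. P (vh e) (vh (vt e)) (vh (vt (vt e))))"
definition dpred4 :: "'a set_structure \<Rightarrow> ('a \<Rightarrow> 'a \<Rightarrow> 'a \<Rightarrow> 'a \<Rightarrow> bool) \<Rightarrow> bool" where
  "dpred4 S P \<longleftrightarrow> definable S (\<lambda>e. P (vh e) (vh (vt e)) (vh (vt (vt e))) (vh (vt (vt (vt e)))))"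
definition dfun1 :: "'a set_structure \<Rightarrow> ('a \<Rightarrow> 'a) \<Rightarrow> bool" where
  "dfun1 S h \<longleftrightarrow> dterm S (\<lambda>e. h (vh e))"
definition dfun2 :: "'a set_structure \<Rightarrow> ('a \<Rightarrow> 'a \<Rightarrow> 'a) \<Rightarrow> bool" where
  "dfun2 S h \<longleftrightarrow> dterm S (\<lambda>e. h (vh e) (vh (vt e)))"

lemma dpred1D:
  assumes "dpred1 S P" "dterm S a"
  shows "definable S (\<lambda>e. P (a e))"
  by (rule definable_subst[where Q = "\<lambda>x e. P x", OF _ assms(2)])
    (use assms(1) in \<open>simp add: dpred1_def\<close>)

lemmas vtI = tail_map_id tail_map_vt

lemma dpred4D:
  assumes P: "dpred4 S P" and a: "dterm S a" and b: "dterm S b" and c: "dterm S c" and d: "dterm S d"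
  shows "definable S (\<lambda>e. P (a e) (b e) (c e) (d e))"
proof -
  \<comment> \<open>Reversing the arguments places the last one at the head, where
    \<open>definable_subst\<close> acts; substituting from the last to the first keeps bringing the
    next argument to the head.\<close>
  have 1: "definable S (\<lambda>e. P (vh (vt (vt (vt e)))) (vh (vt (vt e))) (vh (vt e)) (vh e))"
    using definable_inst[OF P[unfolded dpred4_def],
        of "\<lambda>n. if n = 0 then Inl 3 else if n = 1 then Inl 2 else if n = 2 then Inl 1 else Inl 0"]
    by (simp add: inst_def params_in_def vh_def vt_def numeral_2_eq_2 numeral_3_eq_3)
  have 2: "definable S (\<lambda>e. P (vh (vt (vt e))) (vh (vt e)) (vh e) (d (vt (vt (vt e)))))"
    by (rule definable_subst[where Q = "\<lambda>z e. P (vh (vt (vt e))) (vh (vt e)) (vh e) z"])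
      (use 1 in \<open>auto intro!: dterm_tail[OF d] vtI\<close>)
  have 3: "definable S (\<lambda>e. P (vh (vt e)) (vh e) (c (vt (vt e))) (d (vt (vt e))))"
    by (rule definable_subst[where Q = "\<lambda>z e. P (vh (vt e)) (vh e) z (d (vt (vt e)))"])
      (use 2 in \<open>auto intro!: dterm_tail[OF c] vtI\<close>)
  have 4: "definable S (\<lambda>e. P (vh e) (b (vt e)) (c (vt e)) (d (vt e)))"
    by (rule definable_subst[where Q = "\<lambda>y e. P (vh e) y (c (vt e)) (d (vt e))"])
      (use 3 in \<open>auto intro!: dterm_tail[OF b] vtI\<close>)
  show ?thesis
    by (rule definable_subst[where Q = "\<lambda>x e. P x (b e) (c e) (d e)"]) (use 4 a in auto)
qed

lemma dpred3D:
  "dpred3 S P \<Longrightarrow> dterm S a \<Longrightarrow> dterm S b \<Longrightarrow> dterm S c \<Longrightarrow> definable S (\<lambda>e. P (a e) (b e) (c e))"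
  using dpred4D[of S "\<lambda>x y z w. P x y z" a b c c] by (simp add: dpred3_def dpred4_def)

lemma dpred2D:
  "dpred2 S P \<Longrightarrow> dterm S a \<Longrightarrow> dterm S b \<Longrightarrow> definable S (\<lambda>e. P (a e) (b e))"
  using dpred3D[of S "\<lambda>x y z. P x y" a b b] by (simp add: dpred2_def dpred3_def)

lemma dfun1D:
  assumes h: "dfun1 S h" and a: "dterm S a"
  shows "dterm S (\<lambda>e. h (a e))"
proof -
  have "dpred2 S (\<lambda>y x. y = h x)"
    using h by (simp add: dfun1_def dterm_def dpred2_def)
  from dpred2D[OF this dterm_var[OF tail_map_id] dterm_tail[OF a tail_map_vt[OF tail_map_id]]]
  have "definable S (\<lambda>e. vh e = h (a (vt e)))" .
  moreover have "h (a e) \<in> Univ S" if "e \<in> envs S" for e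
  proof -
    have "case_nat (a e) e \<in> envs S" using that a by (auto simp: dterm_def)
    then show ?thesis using dterm_in_Univ[OF h[unfolded dfun1_def], of "case_nat (a e) e"] by simp
  qed
  ultimately show ?thesis by (simp add: dterm_def)
qed

lemma dfun2D:
  assumes h: "dfun2 S h" and a: "dterm S a" and b: "dterm S b"
  shows "dterm S (\<lambda>e. h (a e) (b e))"
proof -
  have "dpred3 S (\<lambda>y x z. y = h x z)"
    using h by (simp add: dfun2_def dterm_def dpred3_def)
  from dpred3D[OF this dterm_var[OF tail_map_id] dterm_tail[OF a tail_map_vt[OF tail_map_id]]
      dterm_tail[OF b tail_map_vt[OF tail_map_id]]]
  have "definable S (\<lambda>e. vh e = h (a (vt e)) (b (vt e)))" .
  moreover have "h (a e) (b e) \<in> Univ S" if "e \<in> envs S" for e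
  proof -
    have "case_nat (a e) (case_nat (b e) e) \<in> envs S" using that a b by (auto simp: dterm_def)
    then show ?thesis
      using dterm_in_Univ[OF h[unfolded dfun2_def], of "case_nat (a e) (case_nat (b e) e)"] by simp
  qed
  ultimately show ?thesis by (simp add: dterm_def)
qed

lemma dfun1_in_Univ:
  assumes "dfun1 S h" "x \<in> Univ S"
  shows "h x \<in> Univ S"
  using dterm_in_Univ[OF dfun1D[OF assms(1) dterm_const[OF assms(2)]], of "\<lambda>_. x"] assms(2)
  by (simp add: envs_def)

lemma definable_mem:
  assumes "dterm S a" "dterm S b"
  shows "definable S (\<lambda>e. a e \<epsilon>\<^bsub>S\<^esub> b e)"
proof (rule dpred2D[OF _ assms])
  have "definable S (\<lambda>e. e 0 \<epsilon>\<^bsub>S\<^esub> e 1)" unfolding definable_def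
    by (rule exI[of _ "FMem 0 1"], rule exI[of _ Inl]) (auto simp: inst_def params_in_def)
  then show "dpred2 S (\<lambda>x y. x \<epsilon>\<^bsub>S\<^esub> y)" by (simp add: dpred2_def vh_def vt_def)
qed

lemma definable_eq:
  assumes "dterm S a" "dterm S b"
  shows "definable S (\<lambda>e. a e = b e)"
proof (rule dpred2D[OF _ assms])
  have "definable S (\<lambda>e. e 0 = e 1)" unfolding definable_def
    by (rule exI[of _ "FEq 0 1"], rule exI[of _ Inl]) (auto simp: inst_def params_in_def)
  then show "dpred2 S (\<lambda>x y. x = y)" by (simp add: dpred2_def vh_def vt_def)
qed

definition elts :: "'a set_structure \<Rightarrow> 'a \<Rightarrow> 'a set" where
  "elts S x = {z \<in> Univ S. z \<epsilon>\<^bsub>S\<^esub> x}"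

lemma definable_in_elts: "dterm S s \<Longrightarrow> dterm S t \<Longrightarrow> definable S (\<lambda>e. s e \<in> elts S (t e))"
  by (rule definable_cong[OF definable_mem]) (auto simp: elts_def dterm_in_Univ)

lemma definable_ball_elts:
  assumes "dterm S t" "definable S (\<lambda>e. Q (vt e) (vh e))"
  shows "definable S (\<lambda>e. \<forall>x\<in>elts S (t e). Q e x)"
proof -
  have "dterm S (\<lambda>e. t (vt e))" by (rule dterm_tail[OF assms(1)]) (intro vtI)
  then have "definable S (\<lambda>e. \<forall>x\<in>Univ S. x \<in> elts S (t e) \<longrightarrow> Q e x)"
    by (intro definable_all definable_imp definable_in_elts dterm_var vtI assms(2))
  then show ?thesis by (rule definable_cong) (auto simp: elts_def)
qed

lemma definable_bex_elts:
  assumes "dterm S t" "definable S (\<lambda>e. Q (vt e) (vh e))"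
  shows "definable S (\<lambda>e. \<exists>x\<in>elts S (t e). Q e x)"
  using definable_not[OF definable_ball_elts[OF assms(1) definable_not[OF assms(2)]]] by simp

lemma definable_subset_elts:
  assumes "dterm S s" "dterm S t"
  shows "definable S (\<lambda>e. elts S (s e) \<subseteq> elts S (t e))"
proof -
  have "definable S (\<lambda>e. \<forall>x\<in>elts S (s e). x \<in> elts S (t e))"
    by (intro definable_ball_elts assms definable_in_elts dterm_var vtI dterm_tail[OF assms(2)])
  then show ?thesis by (simp add: subset_iff Ball_def)
qed

lemma definable_ex1: "definable S (\<lambda>e. Q (vt e) (vh e)) \<Longrightarrow> definable S (\<lambda>e. \<exists>!x. x \<in> Univ S \<and> Q e x)"
proof -
  assume Q: "definable S (\<lambda>e. Q (vt e) (vh e))"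
  have "dterm S (\<lambda>e. vh (vt e))" by (intro dterm_var vtI)
  moreover have "definable S (\<lambda>e. Q (vt (vt e)) (vh e))"
    using definable_inst[OF Q, of "\<lambda>n. if n = 0 then Inl 0 else Inl (Suc n)"]
    by (simp add: inst_def params_in_def vh_def vt_def)
  ultimately have "definable S (\<lambda>e. \<exists>x\<in>Univ S. Q e x \<and> (\<forall>y\<in>Univ S. Q e y \<longrightarrow> y = x))"
    by (intro definable_ex definable_conj definable_all definable_imp definable_eq dterm_var vtI Q)
  then show ?thesis by (rule definable_cong) blast
qed

text \<open>Unlike \<open>THE\<close>, the description has a value in a nonempty universe even when
  it fails. The default is one fixed element, which can serve as a parameter, so the operator stays
  definable.\<close>

definition the_in :: "'a set_structure \<Rightarrow> ('a \<Rightarrow> bool) \<Rightarrow> 'a" where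
  "the_in S P = (if \<exists>!y. y \<in> Univ S \<and> P y then THE y. y \<in> Univ S \<and> P y else SOME y. y \<in> Univ S)"

lemma the_in_eq:
  assumes "x \<in> Univ S" "P x" "\<And>y. y \<in> Univ S \<Longrightarrow> P y \<Longrightarrow> y = x"
  shows "the_in S P = x"
proof -
  have "\<exists>!y. y \<in> Univ S \<and> P y" "(THE y. y \<in> Univ S \<and> P y) = x"
    using assms by blast+
  then show ?thesis unfolding the_in_def by simp
qed

lemma dterm_if:
  assumes "definable S P" "dterm S a" "dterm S b"
  shows "dterm S (\<lambda>e. if P e then a e else b e)"
proof -
  note t = tail_map_vt[OF tail_map_id]
  have "definable S (\<lambda>e. (P (vt e) \<longrightarrow> vh e = a (vt e)) \<and> (\<not> P (vt e) \<longrightarrow> vh e = b (vt e)))"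
    by (intro definable_conj definable_imp definable_not definable_eq
      definable_tail[OF assms(1) t] dterm_tail[OF assms(2) t] dterm_tail[OF assms(3) t] dterm_var vtI)
  then have "definable S (\<lambda>e. vh e = (if P (vt e) then a (vt e) else b (vt e)))"
    by (rule definable_cong) auto
  then show ?thesis using assms by (auto simp: dterm_def)
qed

lemma dterm_the_in:
  assumes "definable S (\<lambda>e. Q (vt e) (vh e))"
  shows "dterm S (\<lambda>e. the_in S (Q e))"
proof -
  define c where "c = (SOME y. y \<in> Univ S)"
  have Q': "definable S (\<lambda>e. Q (vt (vt e)) (vh e))"
    using definable_inst[OF assms, of "\<lambda>n. if n = 0 then Inl 0 else Inl (Suc n)"]
    by (simp add: inst_def params_in_def vh_def vt_def)
  have c: "c \<in> Univ S" if "e \<in> envs S" for e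
    unfolding c_def using that by (auto intro: someI simp: envs_def)
  have *: "definable S (\<lambda>e. vh e = c)"
  proof (cases "c \<in> Univ S")
    case False
    \<comment> \<open>If the default lies outside the universe, the universe is empty; there is no
      environment and definability holds vacuously.\<close>
    then have "envs S = {}" using c by auto
    then show ?thesis by (simp add: definable_def) (auto simp: params_in_def intro!: exI[of _ Inl])
  qed (auto intro!: definable_eq dterm_const dterm_var vtI)
  have "definable S (\<lambda>e. ((\<exists>!x. x \<in> Univ S \<and> Q (vt e) x) \<and> Q (vt e) (vh e)) \<or>
      (\<not> (\<exists>!x. x \<in> Univ S \<and> Q (vt e) x)) \<and> vh e = c)"
    by (intro definable_disj definable_conj definable_ex1 definable_not assms Q' *)
  then have "definable S (\<lambda>e. vh e = the_in S (Q (vt e)))"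
  proof (rule definable_cong)
    fix e assume e: "e \<in> envs S"
    show "((\<exists>!x. x \<in> Univ S \<and> Q (vt e) x) \<and> Q (vt e) (vh e) \<or>
        (\<not> (\<exists>!x. x \<in> Univ S \<and> Q (vt e) x)) \<and> vh e = c) = (vh e = the_in S (Q (vt e)))"
    proof (cases "\<exists>!x. x \<in> Univ S \<and> Q (vt e) x")
      case True
      then have "the_in S (Q (vt e)) = (THE y. y \<in> Univ S \<and> Q (vt e) y)" by (simp add: the_in_def)
      with theI'[OF True] True vh_in_Univ[OF e] show ?thesis by auto
    next
      case False
      then have "the_in S (Q (vt e)) = c" by (simp only: the_in_def c_def if_False)
      with False show ?thesis by simp
    qed
  qed
  moreover have "the_in S (Q e) \<in> Univ S" if "e \<in> envs S" for e
  proof (cases "\<exists>!x. x \<in> Univ S \<and> Q e x")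
    case True
    from theI'[OF True] True show ?thesis unfolding the_in_def by auto
  next
    case False
    then show ?thesis using c[OF that] by (simp only: the_in_def c_def if_False)
  qed
  ultimately show ?thesis by (simp add: dterm_def)
qed

text \<open>Constructions below are written as \<open>mk_set\<close> of a comprehension over the
  universe: in this form \<open>dterm_mk_set\<close> makes them definable before the set is known to
  exist.\<close>

definition mk_set :: "'a set_structure \<Rightarrow> 'a set \<Rightarrow> 'a" where
  "mk_set S A = the_in S (\<lambda>a. elts S a = A)"

lemma dterm_mk_set:
  assumes "definable S (\<lambda>e. P (vt e) (vh e))"
  shows "dterm S (\<lambda>e. mk_set S {x \<in> Univ S. P e x})"
proof -
  have Q: "definable S (\<lambda>e. P (vt (vt e)) (vh e))"
    using definable_inst[OF assms, of "\<lambda>n. if n = 0 then Inl 0 else Inl (Suc n)"]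
    by (simp add: inst_def params_in_def vh_def vt_def)
  have "definable S (\<lambda>e. \<forall>x\<in>Univ S. x \<in> elts S (vh e) \<longleftrightarrow> P (vt e) x)"
    by (intro definable_all definable_iff definable_in_elts dterm_var vtI Q)
  then have "definable S (\<lambda>e. elts S (vh e) = {x \<in> Univ S. P (vt e) x})"
    by (rule definable_cong) (auto simp: elts_def)
  then show ?thesis unfolding mk_set_def by (rule dterm_the_in)
qed

lemmas dfI = definable_ball_elts definable_bex_elts definable_in_elts definable_subset_elts
  definable_all definable_ex definable_ex1 definable_conj definable_disj definable_imp definable_iff
  definable_not definable_mem definable_eq definable_const
  dterm_var dterm_const tail_map_id tail_map_vt dterm_if dterm_mk_set dterm_the_in

section \<open>Sets inside a model\<close>

named_theorems df
declare dfI [df]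

locale zf =
  fixes S :: "'a set_structure"
  assumes ZF: "ZF_model S"
begin

abbreviation "U \<equiv> Univ S"
abbreviation "E \<equiv> elts S"
abbreviation "mk \<equiv> mk_set S"

text \<open>Bridges the two levels: HOL sets are manipulated freely, and this predicate records
  which of them the model actually contains.\<close>

definition isset :: "'a set \<Rightarrow> bool" where
  "isset A \<longleftrightarrow> (\<exists>a\<in>U. E a = A)"

lemma E_subset: "E x \<subseteq> U" by (auto simp: elts_def)

lemma E_in_U [simp]: "y \<in> E x \<Longrightarrow> y \<in> U" using E_subset by auto

lemma isset_subset_U: "isset A \<Longrightarrow> A \<subseteq> U" by (auto simp: isset_def)

lemma isset_E [simp]: "x \<in> U \<Longrightarrow> isset (E x)" by (auto simp: isset_def)

lemma elts_ext: "x \<in> U \<Longrightarrow> y \<in> U \<Longrightarrow> E x = E y \<Longrightarrow> x = y"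
  using ZF unfolding ZF_model_def extensionality_def elts_def by blast

lemma ex_in_U: "\<exists>x. x \<in> U"
  using ZF unfolding ZF_model_def infinity_ax_def by blast

lemma the_in_U [simp]: "the_in S P \<in> U"
proof (cases "\<exists>!y. y \<in> U \<and> P y")
  case True
  from theI'[OF True] True show ?thesis unfolding the_in_def by auto
next
  case False
  then show ?thesis unfolding the_in_def using ex_in_U by (metis someI_ex)
qed

lemma mk_in_U [simp]: "mk A \<in> U" by (simp add: mk_set_def)

lemma mk_eqI: "x \<in> U \<Longrightarrow> E x = A \<Longrightarrow> mk A = x"
  unfolding mk_set_def by (rule the_in_eq) (auto intro: elts_ext)

lemma E_mk:
  assumes "isset A"
  shows "E (mk A) = A"
proof -
  obtain a where "a \<in> U" "E a = A" using assms by (auto simp: isset_def)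
  then show ?thesis using mk_eqI[of a A] by simp
qed

lemma mk_E [simp]: "x \<in> U \<Longrightarrow> mk (E x) = x" by (rule mk_eqI) auto

lemma isset_sep:
  assumes "isset A" "dpred1 S P"
  shows "isset {x \<in> A. P x}"
proof -
  obtain a where a: "a \<in> U" "A = E a" using assms(1) by (auto simp: isset_def)
  obtain F t where t: "params_in S t"
    and F: "\<And>e. e \<in> envs S \<Longrightarrow> P (vh e) \<longleftrightarrow> sat S F (inst t e)"
    using assms(2) unfolding dpred1_def definable_def by blast
  obtain u where u: "u \<in> U" using ex_in_U by blast
  \<comment> \<open>The parameters of \<open>F\<close> are moved into the environment that the
    separation scheme supplies; \<open>u\<close> only fills positions that stand for no
    parameter.\<close>
  let ?e = "inst (shift_inst t) (\<lambda>_. u)"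
  have e: "(\<lambda>_. u) \<in> envs S" using u by (simp add: envs_def)
  have "?e \<in> envs S" by (rule inst_in_envs[OF params_in_shift[OF t] e])
  then have "\<forall>i. ?e i \<in> U" by (simp add: envs_def)
  moreover have "separation S" using ZF by (simp add: ZF_model_def)
  ultimately have "\<exists>b\<in>U. \<forall>x\<in>U. x \<epsilon>\<^bsub>S\<^esub> b \<longleftrightarrow> x \<epsilon>\<^bsub>S\<^esub> a \<and> sat S (rename (bump t) F) (case_nat x ?e)"
    unfolding separation_def using a(1) by simp
  then obtain b where b: "b \<in> U"
    "\<And>x. x \<in> U \<Longrightarrow> x \<epsilon>\<^bsub>S\<^esub> b \<longleftrightarrow> x \<epsilon>\<^bsub>S\<^esub> a \<and> sat S (rename (bump t) F) (case_nat x ?e)"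
    by auto
  have "P x \<longleftrightarrow> sat S (rename (bump t) F) (case_nat x ?e)" if "x \<in> U" for x
    using F[of "case_nat x (\<lambda>_. u)"] that e by (simp add: sat_bump)
  then have "E b = {x \<in> A. P x}" using b a by (auto simp: elts_def simp del: E_in_U)
  then show ?thesis using b(1) by (auto simp: isset_def)
qed

lemma isset_subset:
  assumes "isset A" "dpred1 S P" "{x \<in> U. P x} \<subseteq> A"
  shows "isset {x \<in> U. P x}"
proof -
  have "{x \<in> U. P x} = {x \<in> A. P x}" using assms(3) isset_subset_U[OF assms(1)] by auto
  then show ?thesis using isset_sep[OF assms(1,2)] by simp
qed

lemma isset_pair: "x \<in> U \<Longrightarrow> y \<in> U \<Longrightarrow> isset {x, y}"
proof -
  assume xy: "x \<in> U" "y \<in> U"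
  then obtain z where z: "z \<in> U" "x \<in> E z" "y \<in> E z"
    using ZF unfolding ZF_model_def pairing_def elts_def by blast
  have "dpred1 S (\<lambda>w. w = x \<or> w = y)"
    unfolding dpred1_def by (intro df; simp add: xy)
  from isset_sep[OF isset_E[OF z(1)] this] have "isset {w \<in> E z. w = x \<or> w = y}" .
  moreover have "{w \<in> E z. w = x \<or> w = y} = {x, y}" using z by auto
  ultimately show ?thesis by simp
qed

lemma isset_Union:
  assumes "isset A"
  shows "isset (\<Union>x\<in>A. E x)"
proof -
  obtain a where a: "a \<in> U" "A = E a" using assms by (auto simp: isset_def)
  then obtain u where u: "u \<in> U" "\<And>y z. y \<in> U \<Longrightarrow> z \<in> U \<Longrightarrow> z \<epsilon>\<^bsub>S\<^esub> y \<Longrightarrow> y \<epsilon>\<^bsub>S\<^esub> a \<Longrightarrow> z \<epsilon>\<^bsub>S\<^esub> u"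
    using ZF unfolding ZF_model_def union_ax_def by meson
  have "dpred1 S (\<lambda>z. \<exists>y\<in>E a. z \<in> E y)"
    unfolding dpred1_def by (intro df; simp add: a)
  from isset_sep[OF isset_E[OF u(1)] this] have "isset {z \<in> E u. \<exists>y\<in>E a. z \<in> E y}" .
  moreover have "{z \<in> E u. \<exists>y\<in>E a. z \<in> E y} = (\<Union>x\<in>A. E x)"
  proof -
    have "z \<in> E u" if "z \<in> E y" "y \<in> E a" for y z
      using u(2)[of y z] that by (simp add: elts_def del: E_in_U)
    then show ?thesis using a(2) by blast
  qed
  ultimately show ?thesis by simp
qed

lemma isset_Un:
  assumes "isset A" "isset B"
  shows "isset (A \<union> B)"
proof -
  obtain a b where ab: "a \<in> U" "A = E a" "b \<in> U" "B = E b" using assms by (auto simp: isset_def)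
  have "isset (\<Union>x\<in>{a, b}. E x)" by (intro isset_Union isset_pair ab)
  then show ?thesis using ab by simp
qed

lemma isset_insert: "x \<in> U \<Longrightarrow> isset A \<Longrightarrow> isset (insert x A)"
  using isset_Un[OF isset_pair[of x x], of A] by simp

lemma isset_empty [simp]: "isset {}"
proof -
  obtain u where u: "u \<in> U" using ex_in_U by blast
  have "dpred1 S (\<lambda>w. False)" unfolding dpred1_def by (intro df)
  from isset_sep[OF isset_E[OF u] this] show ?thesis by simp
qed

lemma isset_image:
  assumes "isset A" "dfun1 S h"
  shows "isset (h ` A)"
proof -
  obtain a where a: "a \<in> U" "A = E a" using assms(1) by (auto simp: isset_def)
  have "definable S (\<lambda>e. vh (vt e) = h (vh e))"
    by (intro df dfun1D[OF assms(2)])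
  then obtain F t where t: "params_in S t"
    and F: "\<And>e. e \<in> envs S \<Longrightarrow> vh (vt e) = h (vh e) \<longleftrightarrow> sat S F (inst t e)"
    unfolding definable_def by blast
  obtain u where u: "u \<in> U" using ex_in_U by blast
  have e: "(\<lambda>_. u) \<in> envs S" using u by (simp add: envs_def)
  \<comment> \<open>Replacement reads x at position 0 and y at position 1, so the device of
    \<open>bump\<close> is applied twice, the second time underneath the first variable.\<close>
  define t1 where "t1 = shift_inst t"
  define F' where "F' = rename (case_nat 0 (\<lambda>n. Suc (bump t1 n))) (rename (bump t) F)"
  define e' where "e' = inst (shift_inst t1) (\<lambda>_. u)"
  have eq: "(\<lambda>n. case_nat x (case_nat y e') (case_nat 0 (\<lambda>n. Suc (bump t1 n)) n))
      = case_nat x (inst t1 (case_nat y (\<lambda>_. u)))" for x y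
    by (auto simp: fun_eq_iff e'_def inst_def bump_def shift_inst_def split: nat.splits sum.splits)
  have *: "y = h x \<longleftrightarrow> sat S F' (case_nat x (case_nat y e'))" if "x \<in> U" "y \<in> U" for x y
  proof -
    have "sat S F' (case_nat x (case_nat y e')) = sat S F (inst t (case_nat x (case_nat y (\<lambda>_. u))))"
      unfolding F'_def sat_rename[of S _ "rename (bump t) F"] eq unfolding t1_def sat_bump ..
    then show ?thesis using F[of "case_nat x (case_nat y (\<lambda>_. u))"] that e by simp
  qed
  have "e' \<in> envs S" unfolding e'_def t1_def
    by (intro inst_in_envs params_in_shift t e)
  then have e': "\<forall>i. e' i \<in> U" by (simp add: envs_def)
  have hU: "h x \<in> U" if "x \<in> U" for x using dfun1_in_Univ[OF assms(2) that] .
  have "\<exists>!y. y \<in> U \<and> sat S F' (case_nat x (case_nat y e'))" if "x \<in> U" for x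
    using *[OF that] hU[OF that] by blast
  moreover have "replacement S" using ZF by (simp add: ZF_model_def)
  ultimately have "\<exists>b\<in>U. \<forall>x\<in>U. x \<epsilon>\<^bsub>S\<^esub> a \<longrightarrow>
      (\<exists>y\<in>U. y \<epsilon>\<^bsub>S\<^esub> b \<and> sat S F' (case_nat x (case_nat y e')))"
    unfolding replacement_def using a(1) e' by simp
  then obtain b where b: "b \<in> U"
    "\<And>x. x \<in> U \<Longrightarrow> x \<epsilon>\<^bsub>S\<^esub> a \<Longrightarrow> \<exists>y\<in>U. y \<epsilon>\<^bsub>S\<^esub> b \<and> sat S F' (case_nat x (case_nat y e'))"
    by auto
  have "h x \<in> E b" if "x \<in> E a" for x
    using b(2)[of x] that * by (auto simp: elts_def simp del: E_in_U)
  moreover have "dpred1 S (\<lambda>y. \<exists>x\<in>E a. y = h x)"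
    unfolding dpred1_def by (intro df dfun1D[OF assms(2)] a)
  ultimately have "isset {y \<in> U. \<exists>x\<in>E a. y = h x}"
    by (intro isset_subset[OF isset_E[OF b(1)]]) auto
  moreover have "{y \<in> U. \<exists>x\<in>E a. y = h x} = h ` A" using a hU by auto
  ultimately show ?thesis by simp
qed

lemma isset_UN:
  assumes "isset A" "dfun1 S h"
  shows "isset (\<Union>x\<in>A. E (h x))"
  using isset_Union[OF isset_image[OF assms]] by simp

lemma foundation_set:
  assumes "isset A" "A \<noteq> {}"
  shows "\<exists>y\<in>A. A \<inter> E y = {}"
proof -
  obtain a where a: "a \<in> U" "A = E a" using assms(1) by (auto simp: isset_def)
  moreover have "\<exists>y\<in>U. y \<epsilon>\<^bsub>S\<^esub> a" using assms(2) a by (auto simp: elts_def simp del: E_in_U)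
  ultimately obtain y where "y \<in> U" "y \<epsilon>\<^bsub>S\<^esub> a" "\<not> (\<exists>z\<in>U. z \<epsilon>\<^bsub>S\<^esub> a \<and> z \<epsilon>\<^bsub>S\<^esub> y)"
    using ZF unfolding ZF_model_def foundation_def by meson
  then have "y \<in> A" "A \<inter> E y = {}" using a by (auto simp: elts_def simp del: E_in_U)
  then show ?thesis by blast
qed

lemma mem_irrefl: "x \<notin> E x"
proof
  assume x: "x \<in> E x"
  then have "isset {x, x}" by (intro isset_pair) auto
  from foundation_set[OF this] show False using x by auto
qed

lemma mem_asym: "x \<in> E y \<Longrightarrow> y \<notin> E x"
proof
  assume xy: "x \<in> E y" "y \<in> E x"
  then have "isset {x, y}" by (intro isset_pair) auto
  from foundation_set[OF this] show False using xy by auto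
qed

section \<open>Ordered pairs, products and functions as sets\<close>

definition pr :: "'a \<Rightarrow> 'a \<Rightarrow> 'a" where
  "pr x y = mk {w \<in> U. w = mk {v \<in> U. v = x} \<or> w = mk {v \<in> U. v = x \<or> v = y}}"

lemma dterm_pr [df]: "dterm S a \<Longrightarrow> dterm S b \<Longrightarrow> dterm S (\<lambda>e. pr (a e) (b e))"
  by (rule dfun2D) (unfold dfun2_def pr_def, intro df)

lemma pr_in_U [simp]: "pr x y \<in> U" by (simp add: pr_def)

lemma Collect_pair: "x \<in> U \<Longrightarrow> y \<in> U \<Longrightarrow> {v \<in> U. v = x \<or> v = y} = {x, y}"
  "x \<in> U \<Longrightarrow> {v \<in> U. v = x} = {x}"
  by auto

lemma E_mk_pair [simp]: "x \<in> U \<Longrightarrow> y \<in> U \<Longrightarrow> E (mk {x, y}) = {x, y}"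
  by (intro E_mk isset_pair)

lemma E_mk_single [simp]: "x \<in> U \<Longrightarrow> E (mk {x}) = {x}"
  using E_mk_pair[of x x] by simp

lemma E_pr: "x \<in> U \<Longrightarrow> y \<in> U \<Longrightarrow> E (pr x y) = {mk {x}, mk {x, y}}"
  unfolding pr_def by (simp add: Collect_pair)

lemma is_upair_iff: "x \<in> U \<Longrightarrow> y \<in> U \<Longrightarrow> z \<in> U \<Longrightarrow> is_upair S x y z \<longleftrightarrow> E z = {x, y}"
  unfolding is_upair_def elts_def by auto

lemma is_pair_iff:
  assumes "x \<in> U" "y \<in> U" "z \<in> U"
  shows "is_pair S x y z \<longleftrightarrow> z = pr x y"
proof
  assume "is_pair S x y z"
  then obtain u v where uv: "u \<in> U" "v \<in> U" "E u = {x}" "E v = {x, y}" "E z = {u, v}"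
    unfolding is_pair_def using assms by (auto simp: is_upair_iff)
  then have "u = mk {x}" "v = mk {x, y}" by (metis mk_E)+
  then show "z = pr x y" using uv assms by (intro elts_ext) (auto simp: E_pr)
next
  assume z: "z = pr x y"
  then show "is_pair S x y z"
    unfolding is_pair_def using assms
    by (intro bexI[of _ "mk {x}"] bexI[of _ "mk {x, y}"]) (auto simp: is_upair_iff E_pr)
qed

lemma pr_inject [simp]:
  assumes "x \<in> U" "y \<in> U" "x' \<in> U" "y' \<in> U"
  shows "pr x y = pr x' y' \<longleftrightarrow> x = x' \<and> y = y'"
proof
  assume "pr x y = pr x' y'"
  then have "{mk {x}, mk {x, y}} = {mk {x'}, mk {x', y'}}" using assms by (metis E_pr)
  then have "E ` {mk {x}, mk {x, y}} = E ` {mk {x'}, mk {x', y'}}" by simp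
  then have "{{x}, {x, y}} = {{x'}, {x', y'}}" using assms by simp
  then show "x = x' \<and> y = y'" by (auto simp: doubleton_eq_iff)
qed auto

lemma related_iff: "x \<in> U \<Longrightarrow> y \<in> U \<Longrightarrow> related S r x y \<longleftrightarrow> pr x y \<in> E r"
  unfolding related_def by (auto simp: is_pair_iff elts_def simp del: E_in_U)

lemma definable_related [df]:
  "dterm S r \<Longrightarrow> dterm S a \<Longrightarrow> dterm S b \<Longrightarrow> definable S (\<lambda>e. related S (r e) (a e) (b e))"
  by (rule definable_cong[of S "\<lambda>e. pr (a e) (b e) \<in> E (r e)"], intro df)
    (auto simp: related_iff dterm_in_Univ)

definition cart :: "'a \<Rightarrow> 'a \<Rightarrow> 'a" where
  "cart a b = mk {z \<in> U. \<exists>x\<in>E a. \<exists>y\<in>E b. z = pr x y}"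

lemma dterm_cart [df]: "dterm S a \<Longrightarrow> dterm S b \<Longrightarrow> dterm S (\<lambda>e. cart (a e) (b e))"
  by (rule dfun2D) (unfold dfun2_def cart_def, intro df)

lemma cart_in_U [simp]: "cart a b \<in> U" by (simp add: cart_def)

text \<open>Each row is an image of \<open>E b\<close>, and the product is the union of the rows
  over \<open>E a\<close>, so its existence comes from replacement and union.\<close>

lemma E_cart:
  assumes "a \<in> U" "b \<in> U"
  shows "E (cart a b) = {z. \<exists>x\<in>E a. \<exists>y\<in>E b. z = pr x y}"
proof -
  have 1: "E (mk {z \<in> U. \<exists>y\<in>E b. z = pr x y}) = pr x ` E b" if "x \<in> U" for x
  proof -
    have "dfun1 S (pr x)" unfolding dfun1_def by (intro df that)
    then have "isset (pr x ` E b)" by (intro isset_image isset_E assms)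
    then show ?thesis by (subst E_mk[symmetric]) (auto intro!: arg_cong[of _ _ "\<lambda>x. E (mk x)"])
  qed
  have "dfun1 S (\<lambda>x. mk {z \<in> U. \<exists>y\<in>E b. z = pr x y})"
    unfolding dfun1_def by (intro df assms)
  from isset_UN[OF isset_E[OF assms(1)] this]
  have "isset (\<Union>x\<in>E a. pr x ` E b)" using 1 by simp
  moreover have "(\<Union>x\<in>E a. pr x ` E b) = {z \<in> U. \<exists>x\<in>E a. \<exists>y\<in>E b. z = pr x y}" by auto
  ultimately show ?thesis unfolding cart_def by (subst E_mk) auto
qed

lemma pr_in_cart [simp]:
  "a \<in> U \<Longrightarrow> b \<in> U \<Longrightarrow> x \<in> U \<Longrightarrow> y \<in> U \<Longrightarrow> pr x y \<in> E (cart a b) \<longleftrightarrow> x \<in> E a \<and> y \<in> E b"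
  by (auto simp: E_cart)

definition app :: "'a \<Rightarrow> 'a \<Rightarrow> 'a" where
  "app f x = the_in S (\<lambda>y. pr x y \<in> E f)"

lemma dterm_app [df]: "dterm S a \<Longrightarrow> dterm S b \<Longrightarrow> dterm S (\<lambda>e. app (a e) (b e))"
  by (rule dfun2D) (unfold dfun2_def app_def, intro df)

lemma app_in_U [simp]: "app f x \<in> U" by (simp add: app_def)

lemma app_eq: "y \<in> U \<Longrightarrow> pr x y \<in> E f \<Longrightarrow> (\<And>z. z \<in> U \<Longrightarrow> pr x z \<in> E f \<Longrightarrow> z = y) \<Longrightarrow> app f x = y"
  unfolding app_def by (rule the_in_eq)

definition graph :: "'a \<Rightarrow> ('a \<Rightarrow> 'a) \<Rightarrow> 'a" where
  "graph a h = mk {z \<in> U. \<exists>u\<in>E a. z = pr u (h u)}"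

lemma graph_in_U [simp]: "graph a h \<in> U" by (simp add: graph_def)

lemma E_graph:
  assumes "a \<in> U" "dfun1 S h"
  shows "E (graph a h) = (\<lambda>u. pr u (h u)) ` E a"
proof -
  have "dfun1 S (\<lambda>u. pr u (h u))" unfolding dfun1_def by (intro df dfun1D[OF assms(2)])
  from isset_image[OF isset_E[OF assms(1)] this] have "isset ((\<lambda>u. pr u (h u)) ` E a)" .
  moreover have "{z \<in> U. \<exists>u\<in>E a. z = pr u (h u)} = (\<lambda>u. pr u (h u)) ` E a" by auto
  ultimately show ?thesis unfolding graph_def by (simp add: E_mk)
qed

lemma pr_in_graph:
  assumes "a \<in> U" "dfun1 S h" "x \<in> U" "y \<in> U"
  shows "pr x y \<in> E (graph a h) \<longleftrightarrow> x \<in> E a \<and> y = h x"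
  using assms by (auto simp: E_graph image_iff dfun1_in_Univ)

lemma app_graph: "a \<in> U \<Longrightarrow> dfun1 S h \<Longrightarrow> x \<in> E a \<Longrightarrow> app (graph a h) x = h x"
  by (rule app_eq) (auto simp: pr_in_graph dfun1_in_Univ)

lemma is_function_iff:
  assumes "f \<in> U" "a \<in> U" "b \<in> U"
  shows "is_function S f a b \<longleftrightarrow> (\<forall>z\<in>E f. \<exists>x\<in>E a. \<exists>y\<in>E b. z = pr x y) \<and>
    (\<forall>x\<in>E a. \<exists>!y. y \<in> U \<and> pr x y \<in> E f)"
  unfolding is_function_def using assms
  by (auto simp: related_iff is_pair_iff elts_def simp del: E_in_U cong: conj_cong)

lemma is_function_app:
  assumes "f \<in> U" "a \<in> U" "b \<in> U" "is_function S f a b" "x \<in> U" "y \<in> U"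
  shows "related S f x y \<longleftrightarrow> x \<in> E a \<and> y = app f x" "x \<in> E a \<Longrightarrow> app f x \<in> E b"
proof -
  have 1: "\<And>z. z \<in> E f \<Longrightarrow> \<exists>x\<in>E a. \<exists>y\<in>E b. z = pr x y"
    and 2: "\<And>x. x \<in> E a \<Longrightarrow> \<exists>!y. y \<in> U \<and> pr x y \<in> E f"
    using assms(4) is_function_iff[OF assms(1-3)] by blast+
  have 3: "x \<in> E a \<and> y \<in> E b \<and> y = app f x" if "pr x y \<in> E f" "x \<in> U" "y \<in> U" for x y
  proof -
    have *: "x \<in> E a \<and> y \<in> E b" using 1[OF that(1)] that(2,3) by auto
    have "app f x = y" using 2[of x] * that by (intro app_eq) auto
    then show ?thesis using * by simp
  qed
  have 4: "pr x (app f x) \<in> E f" if "x \<in> E a"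
    using 2[OF that] that 3 by (metis E_in_U)
  show "related S f x y \<longleftrightarrow> x \<in> E a \<and> y = app f x"
    using 3 4 assms(5,6) by (auto simp: related_iff)
  show "x \<in> E a \<Longrightarrow> app f x \<in> E b" using 3[OF 4] assms(5) by auto
qed

lemma is_function_graph:
  assumes "a \<in> U" "b \<in> U" "dfun1 S h" "h ` E a \<subseteq> E b"
  shows "is_function S (graph a h) a b"
proof -
  have "\<exists>!y. y \<in> U \<and> pr x y \<in> E (graph a h)" if "x \<in> E a" for x
    by (rule ex1I[of _ "h x"]) (use that assms in \<open>auto simp: pr_in_graph dfun1_in_Univ\<close>)
  moreover have "\<exists>x\<in>E a. \<exists>y\<in>E b. z = pr x y" if "z \<in> E (graph a h)" for z
    using that assms by (auto simp: E_graph)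
  ultimately show ?thesis using assms by (simp add: is_function_iff)
qed

text \<open>Minimal elements are demanded only for nonempty subsets that are sets of the model; seen
  from outside, the relation may have infinite descending chains.\<close>

definition wf_on :: "'a set \<Rightarrow> ('a \<Rightarrow> 'a \<Rightarrow> bool) \<Rightarrow> bool" where
  "wf_on A L \<longleftrightarrow> (\<forall>B. isset B \<and> B \<subseteq> A \<and> B \<noteq> {} \<longrightarrow> (\<exists>y\<in>B. \<forall>u\<in>B. \<not> L u y))"

lemma wf_on_least:
  assumes "wf_on (E a) L" "a \<in> U" "dpred1 S P" "x \<in> E a" "P x"
  shows "\<exists>y\<in>E a. P y \<and> (\<forall>u\<in>E a. L u y \<longrightarrow> \<not> P u)"
proof -
  let ?B = "{x \<in> E a. P x}"
  have "isset ?B \<and> ?B \<subseteq> E a \<and> ?B \<noteq> {}" using assms by (auto intro: isset_sep)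
  then obtain y where "y \<in> ?B" "\<forall>u\<in>?B. \<not> L u y" using assms(1) unfolding wf_on_def by meson
  then show ?thesis by auto
qed

text \<open>
  The recursion is over a set, so its partial solutions are sets and their union is definable.
\<close>

theorem wf_recursion:
  assumes a: "a \<in> U" and L: "dpred2 S L" and wf: "wf_on (E a) L" and H: "dfun1 S H"
  obtains h where "dfun1 S h" "\<And>y. y \<in> E a \<Longrightarrow> h y = H (mk {v \<in> U. \<exists>u\<in>E a. L u y \<and> v = h u})"
proof -
  note [df] = dpred2D[OF L] dfun1D[OF H]
  define approx where "approx f D \<longleftrightarrow> E D \<subseteq> E a \<and> (\<forall>y\<in>E D. \<forall>u\<in>E a. L u y \<longrightarrow> u \<in> E D) \<and>
    (\<forall>y\<in>E D. app f y = H (mk {v \<in> U. \<exists>u\<in>E a. L u y \<and> v = app f u}))" for f D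
  have "dpred2 S approx" unfolding dpred2_def approx_def by (intro df a)
  note [df] = dpred2D[OF this]
  \<comment> \<open>Two partial solutions that disagree would do so at an \<open>L\<close>-minimal
    argument, yet there the recursion clause gives both the same value.\<close>
  have agree: "app f y = app f' y"
    if "approx f D" "approx f' D'" "y \<in> E D" "y \<in> E D'" "f \<in> U" "f' \<in> U" "D \<in> U" "D' \<in> U" for f f' D D' y
  proof (rule ccontr)
    assume neq: "app f y \<noteq> app f' y"
    have "dpred1 S (\<lambda>y. y \<in> E D \<and> y \<in> E D' \<and> app f y \<noteq> app f' y)"
      unfolding dpred1_def by (intro df that)
    moreover have "y \<in> E a" using that by (auto simp: approx_def)
    moreover have "y \<in> E D \<and> y \<in> E D' \<and> app f y \<noteq> app f' y" using that neq by simp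
    ultimately have "\<exists>z\<in>E a. (z \<in> E D \<and> z \<in> E D' \<and> app f z \<noteq> app f' z) \<and>
      (\<forall>u\<in>E a. L u z \<longrightarrow> \<not> (u \<in> E D \<and> u \<in> E D' \<and> app f u \<noteq> app f' u))"
      by (rule wf_on_least[OF wf a])
    then obtain z where z: "z \<in> E a" "z \<in> E D \<and> z \<in> E D' \<and> app f z \<noteq> app f' z"
      "\<And>u. u \<in> E a \<Longrightarrow> L u z \<Longrightarrow> \<not> (u \<in> E D \<and> u \<in> E D' \<and> app f u \<noteq> app f' u)"
      by blast
    have "app f u = app f' u" if "u \<in> E a" "L u z" for u
      using z(3)[OF that] z(2) that \<open>approx f D\<close> \<open>approx f' D'\<close> by (auto simp: approx_def)
    then have "{v \<in> U. \<exists>u\<in>E a. L u z \<and> v = app f u} = {v \<in> U. \<exists>u\<in>E a. L u z \<and> v = app f' u}"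
      by auto
    then show False using z(2) that by (auto simp: approx_def)
  qed
  define F where "F y = the_in S (\<lambda>v. \<exists>f\<in>U. \<exists>D\<in>U. approx f D \<and> y \<in> E D \<and> v = app f y)" for y
  have dF: "dfun1 S F" unfolding dfun1_def F_def by (intro df)
  have F: "F y = app f y" if "approx f D" "y \<in> E D" "f \<in> U" "D \<in> U" for f D y
    unfolding F_def
  proof (rule the_in_eq)
    show "\<exists>f'\<in>U. \<exists>D'\<in>U. approx f' D' \<and> y \<in> E D' \<and> app f y = app f' y" using that by blast
  next
    fix v assume "\<exists>f'\<in>U. \<exists>D'\<in>U. approx f' D' \<and> y \<in> E D' \<and> v = app f' y"
    then obtain f' D' where "f' \<in> U" "D' \<in> U" "approx f' D'" "y \<in> E D'" "v = app f' y" by blast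
    then show "v = app f y" using agree[of f' D' f D y] that by simp
  qed simp
  define B where "B = {y \<in> E a. \<exists>f\<in>U. \<exists>D\<in>U. approx f D \<and> y \<in> E D}"
  have B: "isset B" unfolding B_def
    by (rule isset_sep[OF isset_E[OF a]]) (unfold dpred1_def, intro df)
  have B_down: "u \<in> B" if "y \<in> B" "u \<in> E a" "L u y" for u y
  proof -
    obtain f D where "f \<in> U" "D \<in> U" "approx f D" "y \<in> E D" using \<open>y \<in> B\<close> by (auto simp: B_def)
    moreover from this that have "u \<in> E D" unfolding approx_def by blast
    ultimately show ?thesis using that unfolding B_def by blast
  qed
  have FB: "F y = H (mk {v \<in> U. \<exists>u\<in>E a. L u y \<and> v = F u})" if y: "y \<in> B" for y
  proof -
    obtain f D where fD: "f \<in> U" "D \<in> U" "approx f D" "y \<in> E D" using y by (auto simp: B_def)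
    have "F u = app f u" if "u \<in> E a" "L u y" for u
      using fD that by (intro F[OF fD(3)]) (auto simp: approx_def)
    then have "{v \<in> U. \<exists>u\<in>E a. L u y \<and> v = F u} = {v \<in> U. \<exists>u\<in>E a. L u y \<and> v = app f u}" by auto
    then show ?thesis using F[OF fD(3,4,1,2)] fD by (auto simp: approx_def)
  qed
  have "E a \<subseteq> B"
  proof (rule ccontr)
    assume "\<not> E a \<subseteq> B"
    then obtain y0 where y0: "y0 \<in> E a" "\<not> y0 \<in> E (mk B)" using E_mk[OF B] by blast
    have "dpred1 S (\<lambda>y. \<not> y \<in> E (mk B))" unfolding dpred1_def by (intro df) simp
    from wf_on_least[OF wf a this y0] obtain y where y: "y \<in> E a" "y \<notin> B"
      "\<And>u. u \<in> E a \<Longrightarrow> L u y \<Longrightarrow> u \<in> B" by (auto simp: E_mk[OF B])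
    define D where "D = mk (insert y B)"
    have D: "E D = insert y B" "D \<in> U" unfolding D_def by (auto intro!: E_mk isset_insert B y(1) E_in_U)
    \<comment> \<open>At a minimal argument y not reached by any partial solution, the union
      \<open>F\<close>, extended by the value that the clause prescribes at y, is again a partial
      solution.\<close>
    define h where "h u = (if u = y then H (mk {v \<in> U. \<exists>u\<in>E a. L u y \<and> v = F u}) else F u)" for u
    have dh: "dfun1 S h" unfolding dfun1_def h_def
      by (intro df a dfun1D[OF dF] E_in_U[OF y(1)])
    define f where "f = graph D h"
    have f: "app f u = h u" if "u \<in> insert y B" for u
      unfolding f_def by (rule app_graph) (use that D dh in auto)
    have "approx f D" unfolding approx_def D
    proof (intro conjI ballI impI)
      show "insert y B \<subseteq> E a" using y by (auto simp: B_def)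
      show "u \<in> insert y B" if "z \<in> insert y B" "u \<in> E a" "L u z" for z u
        using that y B_down by auto
      show "app f z = H (mk {v \<in> U. \<exists>u\<in>E a. L u z \<and> v = app f u})" if "z \<in> insert y B" for z
      proof -
        have "app f u = F u" if "u \<in> E a" "L u z" for u
        proof -
          have "u \<in> B" using that \<open>z \<in> insert y B\<close> y B_down by auto
          then show ?thesis using f y by (auto simp: h_def)
        qed
        then have "{v \<in> U. \<exists>u\<in>E a. L u z \<and> v = app f u} = {v \<in> U. \<exists>u\<in>E a. L u z \<and> v = F u}" by auto
        moreover have "h z = H (mk {v \<in> U. \<exists>u\<in>E a. L u z \<and> v = F u})"
          using FB that by (auto simp: h_def)
        ultimately show ?thesis using f[OF that] by simp
      qed
    qed
    moreover have "f \<in> U" "y \<in> E D" using D by (auto simp: f_def)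
    ultimately have "y \<in> B" using y(1) D(2) unfolding B_def by blast
    with y show False by simp
  qed
  then show thesis using that[OF dF] FB by auto
qed

end

context zf
begin

section \<open>Ordinals and induction inside a model\<close>

lemma mem_cycle3: "x \<in> E y \<Longrightarrow> y \<in> E z \<Longrightarrow> z \<notin> E x"
proof
  assume xyz: "x \<in> E y" "y \<in> E z" "z \<in> E x"
  then have "isset {x, y, z}" by (intro isset_insert) auto
  from foundation_set[OF this] show False using xyz by auto
qed

definition Ord :: "'a \<Rightarrow> bool" where
  "Ord x \<longleftrightarrow> x \<in> U \<and> (\<forall>y\<in>E x. E y \<subseteq> E x) \<and> (\<forall>y\<in>E x. \<forall>z\<in>E x. y \<in> E z \<or> y = z \<or> z \<in> E y)"

lemma Ord_in_U [simp]: "Ord x \<Longrightarrow> x \<in> U" by (simp add: Ord_def)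

lemma dpred_Ord: "dpred1 S Ord" unfolding dpred1_def Ord_def
proof (intro df)
  show "definable S (\<lambda>e. vh e \<in> U)"
    by (rule definable_cong[of S "\<lambda>e. True"]) (auto intro: df)
qed

lemmas definable_Ord [df] = dpred1D[OF dpred_Ord]

lemma eps_iff: "x \<in> U \<Longrightarrow> x \<epsilon>\<^bsub>S\<^esub> y \<longleftrightarrow> x \<in> E y" by (simp add: elts_def del: E_in_U)

lemma ball_elts_iff: "(\<forall>x\<in>U. x \<epsilon>\<^bsub>S\<^esub> y \<longrightarrow> P x) \<longleftrightarrow> (\<forall>x\<in>E y. P x)"
  by (auto simp: elts_def simp del: E_in_U)

lemma is_subset_iff: "is_subset S x y \<longleftrightarrow> E x \<subseteq> E y"
  unfolding is_subset_def by (auto simp: elts_def simp del: E_in_U)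

lemma is_transitive_iff: "is_transitive S x \<longleftrightarrow> (\<forall>y\<in>E x. E y \<subseteq> E x)"
  unfolding is_transitive_def is_subset_iff by (auto simp: elts_def simp del: E_in_U)

lemma is_ordinal_iff: "x \<in> U \<Longrightarrow> is_ordinal S x \<longleftrightarrow> Ord x"
  unfolding is_ordinal_def Ord_def is_transitive_iff by (auto simp: elts_def simp del: E_in_U)

lemma Ord_elt:
  assumes "Ord x" "y \<in> E x"
  shows "Ord y"
proof -
  have tr: "\<And>y. y \<in> E x \<Longrightarrow> E y \<subseteq> E x"
    and lin: "\<And>y z. y \<in> E x \<Longrightarrow> z \<in> E x \<Longrightarrow> y \<in> E z \<or> y = z \<or> z \<in> E y"
    using assms(1) unfolding Ord_def by blast+
  have "w \<in> E y" if "z \<in> E y" "w \<in> E z" for z w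
  proof -
    have "w \<in> E x" using tr[OF assms(2)] tr[of z] that by auto
    from lin[OF this assms(2)] show ?thesis using that mem_asym mem_cycle3 by metis
  qed
  then show ?thesis unfolding Ord_def using tr[OF assms(2)] lin assms(2) by (auto simp: subset_iff)
qed

lemma Ord_trans: "Ord x \<Longrightarrow> y \<in> E x \<Longrightarrow> z \<in> E y \<Longrightarrow> z \<in> E x"
  unfolding Ord_def by blast

lemma isset_Collect_elts: "a \<in> U \<Longrightarrow> dpred1 S P \<Longrightarrow> isset {x \<in> E a. P x}"
  by (intro isset_sep isset_E)

text \<open>The least element m of a outside d has the same elements as d: what lies below m is in d
  by minimality, and an element of d not below m would put m into d by transitivity.\<close>

lemma transitive_psubset_Ord:
  assumes "Ord a" "d \<in> U" "\<And>y. y \<in> E d \<Longrightarrow> E y \<subseteq> E d" "E d \<subset> E a"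
  shows "d \<in> E a"
proof -
  have "isset {x \<in> E a. x \<notin> E d}"
    by (rule isset_Collect_elts) (use assms in \<open>auto simp: dpred1_def intro!: df\<close>)
  from foundation_set[OF this] assms(4) obtain m where m: "m \<in> E a" "m \<notin> E d"
    "\<And>x. x \<in> E a \<Longrightarrow> x \<notin> E d \<Longrightarrow> x \<notin> E m" by auto
  have "E m \<subseteq> E d" using m Ord_trans[OF assms(1) m(1)] by auto
  moreover have "z \<in> E m" if "z \<in> E d" for z
  proof -
    have "z \<in> E a" using that assms(4) by auto
    then have "z \<in> E m \<or> z = m \<or> m \<in> E z" using m(1) assms(1) unfolding Ord_def by blast
    then show ?thesis using that m(2) assms(3)[OF that] by auto
  qed
  ultimately have "E m = E d" by auto
  then have "m = d" using m(1) assms(2) by (intro elts_ext) auto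
  then show ?thesis using m by simp
qed

text \<open>The intersection of a and b is transitive, so it is a member of each of them in which it
  is proper. If it were proper in both, it would be a member of itself.\<close>

lemma Ord_linear:
  assumes "Ord a" "Ord b"
  shows "a \<in> E b \<or> a = b \<or> b \<in> E a"
proof -
  define g where "g = mk {x \<in> E a. x \<in> E b}"
  have "isset {x \<in> E a. x \<in> E b}"
    by (rule isset_Collect_elts) (use assms in \<open>auto simp: dpred1_def intro!: df\<close>)
  then have Eg: "E g = E a \<inter> E b" unfolding g_def by (auto simp: E_mk)
  have gU: "g \<in> U" by (simp add: g_def)
  have tr: "\<And>y. y \<in> E g \<Longrightarrow> E y \<subseteq> E g"
    using Ord_trans[OF assms(1)] Ord_trans[OF assms(2)] by (auto simp: Eg)
  have "g \<in> E a" if "E g \<noteq> E a" by (rule transitive_psubset_Ord[OF assms(1) gU tr]) (use Eg that in auto)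
  moreover have "g \<in> E b" if "E g \<noteq> E b"
    by (rule transitive_psubset_Ord[OF assms(2) gU tr]) (use Eg that in auto)
  moreover have "g = a" if "E g = E a" using elts_ext[OF gU _ that] assms by auto
  moreover have "g = b" if "E g = E b" using elts_ext[OF gU _ that] assms by auto
  moreover have "\<not> (g \<in> E a \<and> g \<in> E b)" using mem_irrefl[of g] by (simp add: Eg)
  ultimately show ?thesis by metis
qed

lemma Ord_subset_iff: "Ord a \<Longrightarrow> Ord b \<Longrightarrow> E a \<subseteq> E b \<longleftrightarrow> a = b \<or> a \<in> E b"
  using Ord_linear[of a b] Ord_trans[of b a] mem_irrefl[of b] by blast

lemma Ord_not_in_iff: "Ord a \<Longrightarrow> Ord b \<Longrightarrow> a \<notin> E b \<longleftrightarrow> E b \<subseteq> E a"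
  using Ord_linear[of a b] Ord_subset_iff[of b a] mem_irrefl[of b] mem_asym by auto

lemma Ord_least:
  assumes P: "dpred1 S P" and a: "Ord a" "P a"
  shows "\<exists>m. Ord m \<and> P m \<and> (\<forall>x\<in>E m. \<not> P x)"
proof (cases "{x \<in> E a. P x} = {}")
  case True
  then show ?thesis using a by blast
next
  case False
  have "isset {x \<in> E a. P x}" using a by (intro isset_Collect_elts P) simp
  from foundation_set[OF this False] obtain m where m: "m \<in> E a" "P m"
    "{x \<in> E a. P x} \<inter> E m = {}" by blast
  then have "\<forall>x\<in>E m. \<not> P x" using Ord_trans[OF a(1) m(1)] by blast
  then show ?thesis using m Ord_elt[OF a(1)] by blast
qed

lemma dpred1_not: "dpred1 S P \<Longrightarrow> dpred1 S (\<lambda>x. \<not> P x)"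
  unfolding dpred1_def by (rule definable_not)

text \<open>The least counterexample is found by separation and foundation inside the model, whence
  the restriction to definable predicates. It recurs in the inductions on numbers, sets and
  names.\<close>

lemma Ord_induct_dpred:
  assumes P: "dpred1 S P" and step: "\<And>a. Ord a \<Longrightarrow> (\<And>x. x \<in> E a \<Longrightarrow> P x) \<Longrightarrow> P a" and a: "Ord a"
  shows "P a"
proof (rule ccontr)
  assume "\<not> P a"
  from Ord_least[OF dpred1_not[OF P] a this] step show False by blast
qed

lemma wf_on_mem: "wf_on A (\<lambda>u y. u \<in> E y)"
  unfolding wf_on_def using foundation_set by blast

section \<open>Successors, limit ordinals and natural numbers\<close>

definition zero :: 'a where "zero = mk {}"
definition succ :: "'a \<Rightarrow> 'a" where "succ x = mk {y \<in> U. y \<in> E x \<or> y = x}"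

lemma zero_in_U [simp]: "zero \<in> U" and succ_in_U [simp]: "succ x \<in> U"
  by (simp_all add: zero_def succ_def)

lemma E_zero [simp]: "E zero = {}" by (simp add: zero_def E_mk)

lemma E_succ [simp]: "x \<in> U \<Longrightarrow> E (succ x) = insert x (E x)"
proof -
  assume x: "x \<in> U"
  then have "{y \<in> U. y \<in> E x \<or> y = x} = insert x (E x)" by auto
  then show ?thesis unfolding succ_def using x by (simp add: E_mk isset_insert)
qed

lemma dterm_succ [df]: "dterm S a \<Longrightarrow> dterm S (\<lambda>e. succ (a e))"
  by (rule dfun1D) (unfold dfun1_def succ_def, intro df)

lemma Ord_zero [simp]: "Ord zero" by (simp add: Ord_def)

lemma Ord_succ [simp]: "Ord a \<Longrightarrow> Ord (succ a)"
  unfolding Ord_def by auto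

definition Lim :: "'a \<Rightarrow> bool" where
  "Lim x \<longleftrightarrow> Ord x \<and> E x \<noteq> {} \<and> (\<forall>y\<in>E x. \<exists>z\<in>E x. y \<in> E z)"

lemma Lim_Ord [simp]: "Lim x \<Longrightarrow> Ord x" by (simp add: Lim_def)

lemma dpred_Lim: "dpred1 S Lim"
proof -
  have "definable S (\<lambda>e. Ord (vh e) \<and> \<not> (\<forall>y\<in>E (vh e). False) \<and> (\<forall>y\<in>E (vh e). \<exists>z\<in>E (vh e). y \<in> E z))"
    by (intro df)
  then show ?thesis unfolding dpred1_def Lim_def by (rule definable_cong) auto
qed

lemmas definable_Lim [df] = dpred1D[OF dpred_Lim]

lemma is_limit_iff: "x \<in> U \<Longrightarrow> is_limit S x \<longleftrightarrow> Lim x"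
  unfolding is_limit_def Lim_def by (simp add: is_ordinal_iff) (auto simp: elts_def simp del: E_in_U)

lemma Ord_cases:
  assumes "Ord a"
  shows "a = zero \<or> Lim a \<or> (\<exists>b\<in>E a. Ord b \<and> a = succ b)"
proof (cases "E a = {}")
  case True
  then have "a = zero" using assms by (intro elts_ext) auto
  then show ?thesis by simp
next
  case False
  show ?thesis
  proof (cases "Lim a")
    case F: False
    then obtain b where b: "b \<in> E a" "\<And>z. z \<in> E a \<Longrightarrow> b \<notin> E z"
      using False assms unfolding Lim_def by blast
    have "E a = insert b (E b)"
      using b assms Ord_trans[OF assms b(1)] unfolding Ord_def by blast
    moreover have "b \<in> U" using E_in_U[OF b(1)] .
    ultimately have "a = succ b" using assms by (intro elts_ext) auto
    then show ?thesis using b Ord_elt[OF assms] by blast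
  qed simp
qed

lemma not_Lim_succ: "a \<in> U \<Longrightarrow> \<not> Lim (succ a)"
  using mem_irrefl[of a] mem_asym[of a] by (auto simp: Lim_def simp del: Lim_Ord)

lemma Lim_succ: "Lim d \<Longrightarrow> a \<in> E d \<Longrightarrow> succ a \<in> E d"
proof -
  assume d: "Lim d" "a \<in> E d"
  have Oa: "Ord a" using Ord_elt d Lim_Ord by blast
  have "succ a \<in> E d \<or> succ a = d \<or> d \<in> E (succ a)" using d Oa by (intro Ord_linear) auto
  then show ?thesis using d not_Lim_succ[of a] mem_asym[of a d] mem_irrefl[of d] by auto
qed

text \<open>Finiteness is expressed by the absence of limits up to and including n, which makes
  sense before omega is known to exist.\<close>

definition Nat :: "'a \<Rightarrow> bool" where
  "Nat n \<longleftrightarrow> Ord n \<and> \<not> Lim n \<and> (\<forall>m\<in>E n. \<not> Lim m)"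

lemma dpred_Nat: "dpred1 S Nat" unfolding dpred1_def Nat_def by (intro df)

lemmas definable_Nat [df] = dpred1D[OF dpred_Nat]

lemma Nat_elt: "Nat n \<Longrightarrow> m \<in> E n \<Longrightarrow> Nat m"
  unfolding Nat_def using Ord_elt Ord_trans by blast

lemma Nat_cases:
  assumes "Nat a"
  shows "a = zero \<or> (\<exists>b\<in>E a. Nat b \<and> a = succ b)"
proof -
  have "Ord a" "\<not> Lim a" using assms by (auto simp: Nat_def)
  then show ?thesis using Ord_cases[of a] Nat_elt[OF assms] by blast
qed

text \<open>The set given by infinity contains zero and is closed under successor, hence contains
  every \<open>Nat\<close> by induction; separation removes everything else.\<close>

lemma isset_Nat: "isset {n \<in> U. Nat n}"
proof -
  obtain w e where w: "w \<in> U" and e: "e \<in> E w" "\<And>z. z \<in> U \<Longrightarrow> \<not> z \<epsilon>\<^bsub>S\<^esub> e"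
    and s: "\<And>x. x \<in> E w \<Longrightarrow> \<exists>y\<in>E w. \<forall>z\<in>U. z \<epsilon>\<^bsub>S\<^esub> y \<longleftrightarrow> z \<epsilon>\<^bsub>S\<^esub> x \<or> z = x"
  proof -
    have "infinity_ax S" using ZF by (simp add: ZF_model_def)
    then obtain w e where "w \<in> U" "e \<in> U" "e \<epsilon>\<^bsub>S\<^esub> w" "\<forall>z\<in>U. \<not> z \<epsilon>\<^bsub>S\<^esub> e"
      "\<forall>x\<in>U. x \<epsilon>\<^bsub>S\<^esub> w \<longrightarrow> (\<exists>y\<in>U. y \<epsilon>\<^bsub>S\<^esub> w \<and> (\<forall>z\<in>U. z \<epsilon>\<^bsub>S\<^esub> y \<longleftrightarrow> z \<epsilon>\<^bsub>S\<^esub> x \<or> z = x))"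
      unfolding infinity_ax_def by (elim bexE conjE)
    then show thesis by (intro that[of w e]) (auto simp: elts_def Bex_def simp del: E_in_U)
  qed
  have "E e = {}" using e(2) by (auto simp: elts_def simp del: E_in_U)
  then have "e = zero" using e by (intro elts_ext) auto
  then have zero: "zero \<in> E w" using e by simp
  have succ: "succ x \<in> E w" if x: "x \<in> E w" for x
  proof -
    obtain y where y: "y \<in> E w" "\<forall>z\<in>U. z \<epsilon>\<^bsub>S\<^esub> y \<longleftrightarrow> z \<epsilon>\<^bsub>S\<^esub> x \<or> z = x" using s[OF x] by blast
    then have "E y = insert x (E x)" using E_in_U[OF x] unfolding elts_def by blast
    then have "y = succ x" using x y by (intro elts_ext) auto
    then show ?thesis using y by simp
  qed
  have "n \<in> E w" if "Nat n" for n
  proof -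
    have "Ord n" using that by (simp add: Nat_def del: Lim_Ord)
    then have "Nat n \<longrightarrow> n \<in> E w"
    proof (rule Ord_induct_dpred[rotated 2])
      show "dpred1 S (\<lambda>n. Nat n \<longrightarrow> n \<in> E w)" unfolding dpred1_def by (intro df w)
      fix a assume a: "Ord a" and IH: "\<And>x. x \<in> E a \<Longrightarrow> Nat x \<longrightarrow> x \<in> E w"
      show "Nat a \<longrightarrow> a \<in> E w" using Nat_cases[of a] IH zero succ by blast
    qed
    then show ?thesis using that by simp
  qed
  then have "{n \<in> U. Nat n} \<subseteq> E w" by auto
  then show ?thesis by (rule isset_subset[OF isset_E[OF w] dpred_Nat])
qed

definition om :: 'a where "om = mk {n \<in> U. Nat n}"

lemma om_in_U [simp]: "om \<in> U" by (simp add: om_def)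

lemma E_om: "n \<in> E om \<longleftrightarrow> Nat n"
  unfolding om_def E_mk[OF isset_Nat] by (auto simp: Nat_def simp del: Lim_Ord)

lemma Nat_Ord [simp]: "Nat n \<Longrightarrow> Ord n" by (simp add: Nat_def)

lemma Nat_zero [simp]: "Nat zero" by (simp add: Nat_def Lim_def del: Nat_Ord Lim_Ord)

lemma Nat_succ: "Nat n \<Longrightarrow> Nat (succ n)"
  using not_Lim_succ[of n] by (auto simp: Nat_def simp del: Nat_Ord Lim_Ord)

lemma Ord_om [simp]: "Ord om"
  unfolding Ord_def using Nat_elt Ord_linear by (auto simp: E_om)

lemma Lim_om [simp]: "Lim om"
  unfolding Lim_def
proof (intro conjI ballI)
  show "E om \<noteq> {}" using Nat_zero E_om by blast
  show "\<exists>z\<in>E om. y \<in> E z" if "y \<in> E om" for y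
    using that Nat_succ by (intro bexI[of _ "succ y"]) (auto simp: E_om)
qed simp

lemma is_omega_iff: "w \<in> U \<Longrightarrow> is_omega S w \<longleftrightarrow> w = om"
proof
  assume w: "w \<in> U" "is_omega S w"
  then have L: "Lim w" "\<And>x. x \<in> E w \<Longrightarrow> \<not> Lim x"
    unfolding is_omega_def by (auto simp: is_limit_iff elts_def simp del: E_in_U)
  have "w \<notin> E om" using L(1) by (auto simp: E_om Nat_def simp del: Nat_Ord Lim_Ord)
  then show "w = om" using Ord_linear[of w om] L Lim_om Lim_Ord by blast
next
  assume "w \<in> U" "w = om"
  then show "is_omega S w" unfolding is_omega_def
    by (auto simp: is_limit_iff eps_iff E_om Nat_def simp del: Nat_Ord Lim_Ord)
qed

lemma Nat_induct_dpred:
  assumes P: "dpred1 S P" and "P zero" and "\<And>n. Nat n \<Longrightarrow> P n \<Longrightarrow> P (succ n)" and n: "Nat n"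
  shows "P n"
proof -
  have "dpred1 S (\<lambda>n. Nat n \<longrightarrow> P n)"
    using P unfolding dpred1_def by (intro df)
  then have "Nat n \<longrightarrow> P n"
  proof (rule Ord_induct_dpred)
    fix a assume a: "Ord a" and IH: "\<And>x. x \<in> E a \<Longrightarrow> Nat x \<longrightarrow> P x"
    show "Nat a \<longrightarrow> P a"
      using Nat_cases[of a] IH assms(2,3) by blast
  qed (use n in simp)
  then show ?thesis using n by simp
qed

section \<open>Transitive supersets, membership induction and collapse\<close>

lemma transitive_superset:
  assumes x: "x \<in> U"
  shows "\<exists>T\<in>U. E x \<subseteq> E T \<and> (\<forall>y\<in>E T. E y \<subseteq> E T)"
proof -
  \<comment> \<open>Stage n consists of the elements of x and the elements of elements of earlier
    stages, so the union of all stages is closed under taking elements.\<close>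
  define H where "H z = mk {y \<in> U. y \<in> E x \<or> (\<exists>v\<in>E z. \<exists>w\<in>E v. y \<in> E w)}" for z
  have dH: "dfun1 S H" unfolding dfun1_def H_def by (intro df x)
  have EH: "E (H z) = E x \<union> (\<Union>w\<in>(\<Union>v\<in>E z. E v). E w)" if "z \<in> U" for z
  proof -
    have "isset (E x \<union> (\<Union>w\<in>(\<Union>v\<in>E z. E v). E w))" by (intro isset_Un isset_Union isset_E x that)
    moreover have "{y \<in> U. y \<in> E x \<or> (\<exists>v\<in>E z. \<exists>w\<in>E v. y \<in> E w)} = E x \<union> (\<Union>w\<in>(\<Union>v\<in>E z. E v). E w)"
      by auto
    ultimately show ?thesis unfolding H_def by (simp add: E_mk)
  qed
  have "dpred2 S (\<lambda>u y. u \<in> E y)" unfolding dpred2_def by (intro df)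
  from wf_recursion[OF om_in_U this wf_on_mem dH] obtain h where dh: "dfun1 S h"
    and h: "\<And>y. y \<in> E om \<Longrightarrow> h y = H (mk {v \<in> U. \<exists>u\<in>E om. u \<in> E y \<and> v = h u})" by blast
  define T where "T = mk (\<Union>n\<in>E om. E (h n))"
  have ET: "E T = (\<Union>n\<in>E om. E (h n))"
    unfolding T_def by (intro E_mk isset_UN isset_E dh) simp
  have "E x \<subseteq> E (h zero)" by (subst h) (auto simp: EH E_om)
  then have "E x \<subseteq> E T" using ET E_om Nat_zero by blast
  moreover have "z \<in> E T" if yz: "y \<in> E T" "z \<in> E y" for y z
  proof -
    obtain n where n: "n \<in> E om" "y \<in> E (h n)" using yz(1) ET by blast
    have sn: "succ n \<in> E om" using n Nat_succ by (simp add: E_om)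
    have "isset (h ` {u \<in> E om. u \<in> E (succ n)})"
      by (intro isset_image dh isset_Collect_elts) (use n in \<open>auto simp: dpred1_def intro!: df\<close>)
    moreover have "{v \<in> U. \<exists>u\<in>E om. u \<in> E (succ n) \<and> v = h u} = h ` {u \<in> E om. u \<in> E (succ n)}"
      using dfun1_in_Univ[OF dh] by auto
    ultimately have "E (mk {v \<in> U. \<exists>u\<in>E om. u \<in> E (succ n) \<and> v = h u}) = h ` {u \<in> E om. u \<in> E (succ n)}"
      by (simp add: E_mk)
    moreover have "n \<in> E (succ n)" using E_in_U[OF n(1)] by simp
    ultimately have "h n \<in> E (mk {v \<in> U. \<exists>u\<in>E om. u \<in> E (succ n) \<and> v = h u})" using n(1) by blast
    then have "z \<in> E (H (mk {v \<in> U. \<exists>u\<in>E om. u \<in> E (succ n) \<and> v = h u}))"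
      using yz(2) n(2) by (subst EH) auto
    then have "z \<in> E (h (succ n))" using h[OF sn] by simp
    then show ?thesis using ET sn by blast
  qed
  ultimately show ?thesis by (intro bexI[of _ T]) (auto simp: T_def)
qed

text \<open>Foundation acts on sets only, so the minimal counterexample is sought inside a
  transitive set that contains x.\<close>

lemma eps_induct:
  assumes P: "dpred1 S P" and step: "\<And>x. x \<in> U \<Longrightarrow> (\<And>y. y \<in> E x \<Longrightarrow> P y) \<Longrightarrow> P x" and x: "x \<in> U"
  shows "P x"
proof (rule ccontr)
  assume nP: "\<not> P x"
  obtain T where T: "T \<in> U" "E (mk {x}) \<subseteq> E T" "\<forall>y\<in>E T. E y \<subseteq> E T"
    using transitive_superset[of "mk {x}"] by auto
  have "isset {y \<in> E T. \<not> P y}" by (intro isset_Collect_elts T dpred1_not P)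
  moreover have "x \<in> {y \<in> E T. \<not> P y}" using T x nP by simp
  ultimately obtain y where y: "y \<in> E T" "\<not> P y" "{y \<in> E T. \<not> P y} \<inter> E y = {}"
    using foundation_set[of "{y \<in> E T. \<not> P y}"] by auto
  then have "P z" if "z \<in> E y" for z using T(3) that by blast
  then show False using step[of y] y by auto
qed

lemma name_induct:
  assumes Q: "dpred1 S Q"
    and step: "\<And>s. s \<in> U \<Longrightarrow> (\<And>x a. x \<in> U \<Longrightarrow> a \<in> U \<Longrightarrow> pr x a \<in> E s \<Longrightarrow> Q x) \<Longrightarrow> Q s" and s: "s \<in> U"
  shows "Q s"
proof -
  \<comment> \<open>The name x sits three membership steps below s, through its singleton and the
    pair. Carrying \<open>Q\<close> along for elements and for elements of elements reduces this to
    one step of membership induction.\<close>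
  define P where "P u \<longleftrightarrow> Q u \<and> (\<forall>v\<in>E u. Q v \<and> (\<forall>w\<in>E v. Q w))" for u
  have "dpred1 S P" unfolding P_def dpred1_def by (intro df dpred1D[OF Q])
  then have "P s"
  proof (rule eps_induct)
    fix x assume x: "x \<in> U" and IH: "\<And>y. y \<in> E x \<Longrightarrow> P y"
    have "Q x"
    proof (rule step[OF x])
      fix y a assume ya: "y \<in> U" "a \<in> U" "pr y a \<in> E x"
      have "mk {y} \<in> E (pr y a)" "y \<in> E (mk {y})" using ya by (simp_all add: E_pr)
      then show "Q y" using IH[OF ya(3)] unfolding P_def by blast
    qed
    then show "P x" using IH unfolding P_def by blast
  qed (rule s)
  then show ?thesis by (simp add: P_def)
qed

lemma pr_in_transitive:
  assumes "\<forall>y\<in>E T. E y \<subseteq> E T" "s \<in> E T" "pr x a \<in> E s" "x \<in> U" "a \<in> U"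
  shows "x \<in> E T"
proof -
  have "mk {x} \<in> E (pr x a)" "x \<in> E (mk {x})" using assms by (simp_all add: E_pr)
  then show ?thesis using assms by blast
qed

text \<open>This is Mostowski's collapse. Because \<open>L\<close> is transitive, the values are
  ordinals, namely ranks; incomparable elements may share a value, and for a linear \<open>L\<close>
  the value is the order type of the segment below.\<close>

theorem collapse:
  assumes a: "a \<in> U" and L: "dpred2 S L" and wf: "wf_on (E a) L"
    and tr: "transp_on (E a) L"
  shows "\<exists>h. dfun1 S h \<and> (\<forall>y\<in>E a. Ord (h y) \<and> E (h y) = h ` {u \<in> E a. L u y})"
proof -
  have "dfun1 S (\<lambda>x. x)" unfolding dfun1_def by (intro df)
  from wf_recursion[OF a L wf this] obtain h where dh: "dfun1 S h"
    and h: "\<And>y. y \<in> E a \<Longrightarrow> h y = mk {v \<in> U. \<exists>u\<in>E a. L u y \<and> v = h u}" by blast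
  have Eh: "E (h y) = h ` {u \<in> E a. L u y}" if "y \<in> E a" for y
  proof -
    have "dpred1 S (\<lambda>u. L u y)" unfolding dpred1_def using that
      by (intro dpred2D[OF L] df) auto
    then have "isset (h ` {u \<in> E a. L u y})" by (intro isset_image dh isset_Collect_elts a)
    moreover have "{v \<in> U. \<exists>u\<in>E a. L u y \<and> v = h u} = h ` {u \<in> E a. L u y}"
      using dfun1_in_Univ[OF dh] by auto
    ultimately show ?thesis using h[OF that] by (simp add: E_mk)
  qed
  have "Ord (h y)" if y: "y \<in> E a" for y
  proof (rule ccontr)
    assume n: "\<not> Ord (h y)"
    have "dpred1 S (\<lambda>y. \<not> Ord (h y))" unfolding dpred1_def by (intro df dfun1D[OF dh])
    from wf_on_least[OF wf a this y n] obtain z where z: "z \<in> E a" "\<not> Ord (h z)"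
      "\<And>u. u \<in> E a \<Longrightarrow> L u z \<Longrightarrow> Ord (h u)" by blast
    have "E v \<subseteq> E (h z)" if v: "v \<in> E (h z)" for v
    proof -
      obtain u where u: "v = h u" "u \<in> E a" "L u z" using v Eh[OF z(1)] by blast
      show ?thesis unfolding u(1) Eh[OF u(2)] Eh[OF z(1)] using transp_onD[OF tr, of _ u z] u z(1) by blast
    qed
    moreover have "v \<in> E w \<or> v = w \<or> w \<in> E v" if "v \<in> E (h z)" "w \<in> E (h z)" for v w
      using that z(3) Ord_linear unfolding Eh[OF z(1)] by blast
    ultimately have "Ord (h z)" unfolding Ord_def using dfun1_in_Univ[OF dh E_in_U[OF z(1)]] by blast
    with z show False by simp
  qed
  then show ?thesis using dh Eh by blast
qed

end

section \<open>Forced equality and the generic extension\<close>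

locale forcing_zf = zf +
  fixes F :: "'a forcing"
  assumes F: "notion_of_forcing S F"
begin

abbreviation "PP \<equiv> E (Cond F)"

definition le :: "'a \<Rightarrow> 'a \<Rightarrow> bool" where "le q p \<longleftrightarrow> related S (Leq F) q p"

lemma conds_eq: "conds S F = PP" by (simp add: conds_def elts_def del: E_in_U)

lemma Cond_in_U [simp]: "Cond F \<in> U" and Leq_in_U [simp]: "Leq F \<in> U"
  and Top_in_PP [simp]: "Top F \<in> PP"
  using F unfolding notion_of_forcing_def conds_eq by blast+

lemma le_refl [simp]: "p \<in> PP \<Longrightarrow> le p p"
  and le_Top [simp]: "p \<in> PP \<Longrightarrow> le p (Top F)"
  using F unfolding notion_of_forcing_def conds_eq le_def by blast+

lemma le_trans: "le p q \<Longrightarrow> le q r \<Longrightarrow> p \<in> PP \<Longrightarrow> q \<in> PP \<Longrightarrow> r \<in> PP \<Longrightarrow> le p r"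
  using F unfolding notion_of_forcing_def conds_eq le_def by blast

lemma definable_le [df]: "dterm S a \<Longrightarrow> dterm S b \<Longrightarrow> definable S (\<lambda>e. le (a e) (b e))"
  unfolding le_def by (intro df) auto

abbreviation triples :: "'a \<Rightarrow> 'a \<Rightarrow> 'a \<Rightarrow> 'a \<Rightarrow> bool" where
  "triples R \<equiv> \<lambda>r x y. pr r (pr x y) \<in> E R"

text \<open>The relation \<open>Q\<close> on lower names is left open: it is an approximating set at
  first and \<open>FE\<close> in the end.\<close>

definition step :: "('a \<Rightarrow> 'a \<Rightarrow> 'a \<Rightarrow> bool) \<Rightarrow> 'a \<Rightarrow> 'a \<Rightarrow> 'a \<Rightarrow> bool" where
  "step Q p s t \<longleftrightarrow> (\<forall>x\<in>U. \<forall>a\<in>PP. pr x a \<in> E s \<longrightarrow> (\<forall>q\<in>PP. le q p \<and> le q a \<longrightarrow>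
     (\<exists>r\<in>PP. le r q \<and> (\<exists>y\<in>U. \<exists>b\<in>PP. pr y b \<in> E t \<and> le r b \<and> Q r x y))))"

lemma stepI:
  assumes "\<And>x a q. x \<in> U \<Longrightarrow> a \<in> PP \<Longrightarrow> pr x a \<in> E s \<Longrightarrow> q \<in> PP \<Longrightarrow> le q p \<Longrightarrow> le q a \<Longrightarrow>
    \<exists>r\<in>PP. le r q \<and> (\<exists>y\<in>U. \<exists>b\<in>PP. pr y b \<in> E t \<and> le r b \<and> Q r x y)"
  shows "step Q p s t"
  using assms unfolding step_def by blast

lemma stepD:
  assumes "step Q p s t" "x \<in> U" "a \<in> PP" "pr x a \<in> E s" "q \<in> PP" "le q p" "le q a"
  shows "\<exists>r\<in>PP. le r q \<and> (\<exists>y\<in>U. \<exists>b\<in>PP. pr y b \<in> E t \<and> le r b \<and> Q r x y)"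
  using assms unfolding step_def by blast

text \<open>\<open>Q\<close> occurs positively, and only at names from the domains of s and t. This
  serves both as monotonicity for the fixed point and for exchanging relations that agree on lower
  names.\<close>

lemma step_mono:
  assumes "step Q p s t"
    and "\<And>r x y a b. r \<in> PP \<Longrightarrow> x \<in> U \<Longrightarrow> y \<in> U \<Longrightarrow> a \<in> PP \<Longrightarrow> b \<in> PP \<Longrightarrow> pr x a \<in> E s \<Longrightarrow> pr y b \<in> E t \<Longrightarrow>
      Q r x y \<Longrightarrow> Q' r x y"
  shows "step Q' p s t"
proof (rule stepI)
  fix x a q
  assume *: "x \<in> U" "a \<in> PP" "pr x a \<in> E s" "q \<in> PP" "le q p" "le q a"
  from stepD[OF assms(1) *] obtain r y b where
    r: "r \<in> PP" "le r q" "y \<in> U" "b \<in> PP" "pr y b \<in> E t" "le r b" "Q r x y" by blast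
  have "Q' r x y" by (rule assms(2)[of r x y a b]) (use r * in auto)
  then show "\<exists>r\<in>PP. le r q \<and> (\<exists>y\<in>U. \<exists>b\<in>PP. pr y b \<in> E t \<and> le r b \<and> Q' r x y)" using r by blast
qed

lemma step_le: "step Q p s t \<Longrightarrow> le q p \<Longrightarrow> q \<in> PP \<Longrightarrow> p \<in> PP \<Longrightarrow> step Q q s t"
  unfolding step_def using le_trans by blast

lemma related3_iff: "p \<in> U \<Longrightarrow> s \<in> U \<Longrightarrow> t \<in> U \<Longrightarrow> related3 S R p s t \<longleftrightarrow> pr p (pr s t) \<in> E R"
  unfolding related3_def by (auto simp: is_pair_iff related_iff)

lemma definable_step:
  assumes R: "dterm S R" and p: "dterm S p" and s: "dterm S s" and t: "dterm S t"
  shows "definable S (\<lambda>e. step (triples (R e)) (p e) (s e) (t e))"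
proof -
  have "dpred4 S (\<lambda>R p s t. step (triples R) p s t)"
    unfolding dpred4_def step_def by (intro df) auto
  from dpred4D[OF this assms] show ?thesis .
qed

lemma forces_sub_step_iff:
  assumes "p \<in> U" "s \<in> U" "t \<in> U"
  shows "forces_sub_step S F R p s t \<longleftrightarrow> step (triples R) p s t"
proof -
  have 1: "related S s x a \<longleftrightarrow> pr x a \<in> E s" if "x \<in> U" "a \<in> PP" for x a s
    using that by (simp add: related_iff)
  have 2: "related3 S R r x y \<longleftrightarrow> pr r (pr x y) \<in> E R" if "r \<in> PP" "x \<in> U" "y \<in> U" for r x y
    using that by (simp add: related3_iff)
  show ?thesis unfolding forces_sub_step_def step_def conds_eq le_def[symmetric]
    by (simp add: 1 2 cong: ball_cong bex_cong)
qed

definition transitive_set :: "'a \<Rightarrow> bool" where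
  "transitive_set T \<longleftrightarrow> T \<in> U \<and> (\<forall>y\<in>E T. E y \<subseteq> E T)"

lemma forces_eq_approx_iff:
  assumes "T \<in> U" "R \<in> U"
  shows "forces_eq_approx S F T R \<longleftrightarrow> transitive_set T \<and>
    (\<forall>p\<in>PP. \<forall>s\<in>E T. \<forall>t\<in>E T. pr p (pr s t) \<in> E R \<longleftrightarrow>
      step (triples R) p s t \<and> step (triples R) p t s)"
proof -
  have 1: "(related3 S R p s t \<longleftrightarrow> forces_sub_step S F R p s t \<and> forces_sub_step S F R p t s) \<longleftrightarrow>
    (pr p (pr s t) \<in> E R \<longleftrightarrow> step (triples R) p s t \<and> step (triples R) p t s)"
    if "p \<in> PP" "s \<in> U" "t \<in> U" for p s t
    using that by (simp add: forces_sub_step_iff related3_iff)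
  show ?thesis
    unfolding forces_eq_approx_def is_transitive_iff transitive_set_def conds_eq
    using assms by (simp add: 1 eps_iff cong: ball_cong) (meson E_in_U)
qed

lemma definable_transitive_set [df]: "dterm S a \<Longrightarrow> definable S (\<lambda>e. transitive_set (a e))"
proof (rule dpred1D)
  have "definable S (\<lambda>e. \<forall>y\<in>E (vh e). E y \<subseteq> E (vh e))" by (intro df)
  then show "dpred1 S transitive_set" unfolding dpred1_def transitive_set_def
    by (rule definable_cong) auto
qed

definition approx :: "'a \<Rightarrow> 'a \<Rightarrow> bool" where
  "approx T R \<longleftrightarrow> transitive_set T \<and>
    (\<forall>p\<in>PP. \<forall>s\<in>E T. \<forall>t\<in>E T. pr p (pr s t) \<in> E R \<longleftrightarrow>
      step (triples R) p s t \<and> step (triples R) p t s)"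

text \<open>
  The recursion clause is monotone in the approximation, so the union of all sets that are contained
  in their own image under it is an approximation (Knaster--Tarski), and no recursion is needed.
\<close>

lemma approx_exists:
  assumes T: "transitive_set T"
  shows "\<exists>R\<in>U. approx T R"
proof -
  have TU: "T \<in> U" using T by (simp add: transitive_set_def)
  define post where "post R \<longleftrightarrow> (\<forall>p\<in>PP. \<forall>s\<in>E T. \<forall>t\<in>E T. pr p (pr s t) \<in> E R \<longrightarrow>
      step (triples R) p s t \<and> step (triples R) p t s)" for R
  have dpost: "dpred1 S post" unfolding dpred1_def post_def
    by (intro df definable_step) (auto simp: TU)
  let ?Z = "cart (Cond F) (cart T T)"
  let ?R = "{z \<in> E ?Z. \<exists>R'\<in>U. z \<in> E R' \<and> post R'}"
  define R where "R = mk ?R"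
  have "isset ?R" by (rule isset_Collect_elts) (auto simp: dpred1_def intro!: df dpred1D[OF dpost])
  then have ER: "E R = ?R" unfolding R_def by (rule E_mk)
  have dom: "x \<in> E T" if "s \<in> E T" "pr x a \<in> E s" "x \<in> U" "a \<in> PP" for s x a
    using pr_in_transitive[of T s x a] T that by (auto simp: transitive_set_def)
  have Z: "pr r (pr x y) \<in> E ?Z \<longleftrightarrow> r \<in> PP \<and> x \<in> E T \<and> y \<in> E T" if "r \<in> U" "x \<in> U" "y \<in> U" for r x y
    using that TU by simp
  have up: "step (triples R) p s t"
    if "step (triples R') p s t" "post R'" "R' \<in> U" "s \<in> E T" "t \<in> E T" for R' p s t
  proof (rule step_mono[OF that(1)])
    fix r x y a b
    assume *: "r \<in> PP" "x \<in> U" "y \<in> U" "a \<in> PP" "b \<in> PP" "pr x a \<in> E s" "pr y b \<in> E t" "pr r (pr x y) \<in> E R'"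
    then have "x \<in> E T" "y \<in> E T" using dom that by blast+
    then show "pr r (pr x y) \<in> E R" using * Z[of r x y] that unfolding ER by auto
  qed
  have postR: "post R" unfolding post_def
  proof (intro ballI impI)
    fix p s t assume *: "p \<in> PP" "s \<in> E T" "t \<in> E T" "pr p (pr s t) \<in> E R"
    then obtain R' where "R' \<in> U" "pr p (pr s t) \<in> E R'" "post R'" by (auto simp: ER)
    then show "step (triples R) p s t \<and> step (triples R) p t s"
      using up * unfolding post_def by blast
  qed
  \<comment> \<open>\<open>R2\<close> is the image of \<open>R\<close> under the clause. As
    \<open>R\<close> is contained in its image, monotonicity makes \<open>R2\<close> contained in
    its own image too, hence in the union \<open>R\<close>; so \<open>R\<close> is a fixed
    point.\<close>
  let ?R2 = "{z \<in> E ?Z. \<exists>p\<in>PP. \<exists>s\<in>E T. \<exists>t\<in>E T. z = pr p (pr s t) \<and>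
    step (triples R) p s t \<and> step (triples R) p t s}"
  define R2 where "R2 = mk ?R2"
  have "isset ?R2"
    by (rule isset_Collect_elts) (auto simp: dpred1_def R_def TU intro!: df definable_step)
  then have ER2: "E R2 = ?R2" unfolding R2_def by (rule E_mk)
  have R2: "pr p (pr s t) \<in> E R2 \<longleftrightarrow>
    step (triples R) p s t \<and> step (triples R) p t s"
    if "p \<in> PP" "s \<in> E T" "t \<in> E T" for p s t
    using that E_in_U[OF that(1)] E_in_U[OF that(2)] E_in_U[OF that(3)] Z[of p s t] unfolding ER2
    by auto
  have sub: "step (triples R2) p s t"
    if "step (triples R) p s t" "s \<in> E T" "t \<in> E T" for p s t
  proof (rule step_mono[OF that(1)])
    fix r x y a b
    assume *: "r \<in> PP" "x \<in> U" "y \<in> U" "a \<in> PP" "b \<in> PP" "pr x a \<in> E s" "pr y b \<in> E t" "pr r (pr x y) \<in> E R"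
    then have "x \<in> E T" "y \<in> E T" using dom that by blast+
    then show "pr r (pr x y) \<in> E R2" using R2 postR * unfolding post_def by blast
  qed
  have "post R2" unfolding post_def using R2 sub by blast
  then have "pr p (pr s t) \<in> E R" if "pr p (pr s t) \<in> E R2" "p \<in> PP" "s \<in> E T" "t \<in> E T" for p s t
    using that Z[of p s t] E_in_U[OF that(2)] E_in_U[OF that(3)] E_in_U[OF that(4)] unfolding ER
    by (auto simp: R2_def intro!: bexI[of _ R2])
  then have "approx T R" unfolding approx_def using T R2 postR unfolding post_def by blast
  then show ?thesis unfolding R_def by auto
qed

lemma approx_agree:
  assumes "approx T R" "approx T' R'" "R \<in> U" "R' \<in> U"
    and st: "s \<in> E T" "s \<in> E T'" "t \<in> E T" "t \<in> E T'" and p: "p \<in> PP"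
  shows "pr p (pr s t) \<in> E R \<longleftrightarrow> pr p (pr s t) \<in> E R'"
proof -
  \<comment> \<open>Both orders of the two names are compared at once, because the clause for the
    equality of s and t consults lower pairs in either order.\<close>
  define Q where "Q s \<longleftrightarrow> s \<in> E T \<and> s \<in> E T' \<longrightarrow> (\<forall>t\<in>E T. t \<in> E T' \<longrightarrow> (\<forall>p\<in>PP.
    (pr p (pr s t) \<in> E R \<longleftrightarrow> pr p (pr s t) \<in> E R') \<and> (pr p (pr t s) \<in> E R \<longleftrightarrow> pr p (pr t s) \<in> E R')))" for s
  have T: "transitive_set T" "transitive_set T'" using assms by (auto simp: approx_def)
  then have TU: "T \<in> U" "T' \<in> U" by (auto simp: transitive_set_def)
  have dom: "x \<in> E T \<and> x \<in> E T'" if "s \<in> E T" "s \<in> E T'" "pr x a \<in> E s" "x \<in> U" "a \<in> PP" for s x a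
    using pr_in_transitive[of T s x a] pr_in_transitive[of T' s x a] T that by (auto simp: transitive_set_def)
  have "dpred1 S Q" unfolding dpred1_def Q_def by (intro df) (auto simp: TU assms)
  then have "Q s"
  proof (rule name_induct)
    fix s assume s: "s \<in> U" and IH: "\<And>x a. x \<in> U \<Longrightarrow> a \<in> U \<Longrightarrow> pr x a \<in> E s \<Longrightarrow> Q x"
    show "Q s" unfolding Q_def
    proof (intro impI ballI)
      fix t p assume a: "s \<in> E T \<and> s \<in> E T'" "t \<in> E T" "t \<in> E T'" "p \<in> PP"
      have eq: "pr r (pr x y) \<in> E R \<longleftrightarrow> pr r (pr x y) \<in> E R'" "pr r (pr y x) \<in> E R \<longleftrightarrow> pr r (pr y x) \<in> E R'"
        if "r \<in> PP" "x \<in> U" "y \<in> U" "a \<in> PP" "b \<in> PP" "pr x a \<in> E s" "pr y b \<in> E t" for r x y a b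
      proof -
        have "Q x" by (rule IH[of x a]) (use that in auto)
        moreover have "x \<in> E T \<and> x \<in> E T'" "y \<in> E T \<and> y \<in> E T'" using dom that a by blast+
        ultimately show "pr r (pr x y) \<in> E R \<longleftrightarrow> pr r (pr x y) \<in> E R'" "pr r (pr y x) \<in> E R \<longleftrightarrow> pr r (pr y x) \<in> E R'"
          using that(1) unfolding Q_def by blast+
      qed
      have 1: "step (triples R) p s t \<longleftrightarrow> step (triples R') p s t"
        by (rule iffI; erule step_mono) (use eq(1) in blast)+
      have 2: "step (triples R) p t s \<longleftrightarrow> step (triples R') p t s"
        by (rule iffI; erule step_mono) (use eq(2) in blast)+
      show "(pr p (pr s t) \<in> E R \<longleftrightarrow> pr p (pr s t) \<in> E R') \<and> (pr p (pr t s) \<in> E R \<longleftrightarrow> pr p (pr t s) \<in> E R')"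
        using assms(1,2) a 1 2 unfolding approx_def by blast
    qed
  qed (use st in auto)
  then show ?thesis using st p unfolding Q_def by blast
qed

definition FE :: "'a \<Rightarrow> 'a \<Rightarrow> 'a \<Rightarrow> bool" where
  "FE p s t \<longleftrightarrow> (\<exists>T\<in>U. \<exists>R\<in>U. s \<in> E T \<and> t \<in> E T \<and> approx T R \<and> pr p (pr s t) \<in> E R)"

lemma forces_eq_iff:
  assumes "p \<in> U" "s \<in> U" "t \<in> U"
  shows "forces_eq S F p s t \<longleftrightarrow> FE p s t"
  unfolding forces_eq_def FE_def using assms
  by (simp add: forces_eq_approx_iff approx_def related3_iff eps_iff cong: bex_cong)

lemma definable_FE [df]:
  "dterm S a \<Longrightarrow> dterm S b \<Longrightarrow> dterm S c \<Longrightarrow> definable S (\<lambda>e. FE (a e) (b e) (c e))"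
proof (rule dpred3D)
  show "dpred3 S FE" unfolding dpred3_def FE_def approx_def by (intro df definable_step) auto
qed

text \<open>Over a transitive set containing s and t a single approximation computes
  \<open>FE\<close>, since all approximations agree. This frees the recursion clause from the
  approximating sets, and it is how forced equality is analysed from now on.\<close>

lemma FE_step:
  assumes p: "p \<in> PP" and st: "s \<in> U" "t \<in> U"
  shows "FE p s t \<longleftrightarrow> step FE p s t \<and> step FE p t s"
proof -
  have "mk {s, t} \<in> U" by simp
  from transitive_superset[OF this] obtain T where T: "T \<in> U" "E (mk {s, t}) \<subseteq> E T" "\<forall>y\<in>E T. E y \<subseteq> E T"
    by blast
  have st': "s \<in> E T" "t \<in> E T" using T(2) st by auto
  have tT: "transitive_set T" using T by (simp add: transitive_set_def)
  obtain R where R: "R \<in> U" "approx T R" using approx_exists[OF tT] by blast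
  have eq: "FE r x y \<longleftrightarrow> pr r (pr x y) \<in> E R" if "r \<in> PP" "x \<in> E T" "y \<in> E T" for r x y
    unfolding FE_def using approx_agree[OF R(2) _ R(1)] that R T(1) by blast
  have dom: "x \<in> E T" if "s \<in> E T" "pr x a \<in> E s" "x \<in> U" "a \<in> PP" for s x a
    using pr_in_transitive[of T s x a] T that by auto
  have "step FE p s t \<longleftrightarrow> step (triples R) p s t" if "s \<in> E T" "t \<in> E T" for s t
    by (rule iffI; erule step_mono) (use eq dom that in blast)+
  then show ?thesis using eq[OF p st'] R(2) p st' unfolding approx_def by blast
qed

lemma FE_le: "FE p s t \<Longrightarrow> le q p \<Longrightarrow> q \<in> PP \<Longrightarrow> p \<in> PP \<Longrightarrow> s \<in> U \<Longrightarrow> t \<in> U \<Longrightarrow> FE q s t"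
  using FE_step step_le by blast

lemma FE_sym: "FE p s t \<Longrightarrow> p \<in> PP \<Longrightarrow> s \<in> U \<Longrightarrow> t \<in> U \<Longrightarrow> FE p t s"
  using FE_step by blast

lemma FE_refl: "s \<in> U \<Longrightarrow> p \<in> PP \<Longrightarrow> FE p s s"
proof -
  assume s: "s \<in> U" and p: "p \<in> PP"
  have "dpred1 S (\<lambda>s. \<forall>p\<in>PP. FE p s s)" unfolding dpred1_def by (intro df) auto
  then have "\<forall>p\<in>PP. FE p s s"
  proof (rule name_induct)
    fix s assume s: "s \<in> U" and IH: "\<And>x a. x \<in> U \<Longrightarrow> a \<in> U \<Longrightarrow> pr x a \<in> E s \<Longrightarrow> \<forall>p\<in>PP. FE p x x"
    have "step FE p s s" if "p \<in> PP" for p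
    proof (rule stepI)
      fix x a q assume *: "x \<in> U" "a \<in> PP" "pr x a \<in> E s" "q \<in> PP" "le q p" "le q a"
      then have "FE q x x" using IH[of x a] by auto
      then show "\<exists>r\<in>PP. le r q \<and> (\<exists>y\<in>U. \<exists>b\<in>PP. pr y b \<in> E s \<and> le r b \<and> FE r x y)"
        using * le_refl by blast
    qed
    then show "\<forall>p\<in>PP. FE p s s" using FE_step s by blast
  qed (rule s)
  then show ?thesis using p by blast
qed

text \<open>A lower name of s is matched in t, and that one again in u, below ever stronger
  conditions. Transitivity for the lower names is a premise, so that each of the two inclusions
  behind an equality can supply it in its own way.\<close>

lemma step_FE_trans:
  assumes st: "step FE p s t" "step FE p t u" and p: "p \<in> PP"
    and tr: "\<And>r x a y z c. r \<in> PP \<Longrightarrow> x \<in> U \<Longrightarrow> a \<in> PP \<Longrightarrow> pr x a \<in> E s \<Longrightarrow> y \<in> U \<Longrightarrow> z \<in> U \<Longrightarrow>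
      c \<in> PP \<Longrightarrow> pr z c \<in> E u \<Longrightarrow> FE r x y \<Longrightarrow> FE r y z \<Longrightarrow> FE r x z"
  shows "step FE p s u"
proof (rule stepI)
  fix x a q assume *: "x \<in> U" "a \<in> PP" "pr x a \<in> E s" "q \<in> PP" "le q p" "le q a"
  obtain r y b where r: "r \<in> PP" "le r q" "y \<in> U" "b \<in> PP" "pr y b \<in> E t" "le r b" "FE r x y"
    using stepD[OF st(1) *] by blast
  have "le r p" using le_trans[OF r(2) *(5)] r * p by blast
  from stepD[OF st(2) r(3,4,5,1) this r(6)] obtain r' z c where
    r': "r' \<in> PP" "le r' r" "z \<in> U" "c \<in> PP" "pr z c \<in> E u" "le r' c" "FE r' y z" by blast
  have "FE r' x y" using FE_le[OF r(7) r'(2)] r r' * by blast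
  then have "FE r' x z" using tr[of r' x a y z c] * r r' by blast
  moreover have "le r' q" using le_trans[OF r'(2) r(2)] r r' * by blast
  ultimately show "\<exists>r\<in>PP. le r q \<and> (\<exists>y\<in>U. \<exists>b\<in>PP. pr y b \<in> E u \<and> le r b \<and> FE r x y)"
    using r' by blast
qed

lemma FE_trans:
  assumes "FE p s t" "FE p t u" "p \<in> PP" "s \<in> U" "t \<in> U" "u \<in> U"
  shows "FE p s u"
proof -
  have "dpred1 S (\<lambda>s. \<forall>p\<in>PP. \<forall>t\<in>U. \<forall>u\<in>U. FE p s t \<and> FE p t u \<longrightarrow> FE p s u)"
    unfolding dpred1_def by (intro df) auto
  then have "\<forall>p\<in>PP. \<forall>t\<in>U. \<forall>u\<in>U. FE p s t \<and> FE p t u \<longrightarrow> FE p s u"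
  proof (rule name_induct)
    fix s assume s: "s \<in> U" and IH: "\<And>x a. x \<in> U \<Longrightarrow> a \<in> U \<Longrightarrow> pr x a \<in> E s \<Longrightarrow>
      \<forall>p\<in>PP. \<forall>t\<in>U. \<forall>u\<in>U. FE p x t \<and> FE p t u \<longrightarrow> FE p x u"
    show "\<forall>p\<in>PP. \<forall>t\<in>U. \<forall>u\<in>U. FE p s t \<and> FE p t u \<longrightarrow> FE p s u"
    proof (intro ballI impI, elim conjE)
      fix p t u assume pt: "p \<in> PP" "t \<in> U" "u \<in> U" and eq: "FE p s t" "FE p t u"
      have st: "step FE p s t" "step FE p t s" "step FE p t u" "step FE p u t"
        using eq FE_step pt s by blast+
      have "step FE p s u"
        by (rule step_FE_trans[OF st(1,3) pt(1)]) (use IH E_in_U in metis)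
      \<comment> \<open>The induction hypothesis concerns names from s, which now stand at the far
        end of the chain; symmetry turns the chain around.\<close>
      moreover have "step FE p u s"
      proof (rule step_FE_trans[OF st(4,2) pt(1)])
        fix r z y x a
        assume *: "r \<in> PP" "z \<in> U" "y \<in> U" "x \<in> U" "a \<in> PP" "pr x a \<in> E s" "FE r z y" "FE r y x"
        then have "FE r x y" "FE r y z" using FE_sym by blast+
        then have "FE r x z" using IH[of x a] * by (metis E_in_U)
        then show "FE r z x" using FE_sym * by blast
      qed
      ultimately show "FE p s u" using FE_step pt s by blast
    qed
  qed (use assms in simp)
  then show ?thesis using assms by blast
qed

definition FM :: "'a \<Rightarrow> 'a \<Rightarrow> 'a \<Rightarrow> bool" where
  "FM p s t \<longleftrightarrow> (\<forall>q\<in>PP. le q p \<longrightarrow>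
     (\<exists>r\<in>PP. le r q \<and> (\<exists>y\<in>U. \<exists>b\<in>PP. pr y b \<in> E t \<and> le r b \<and> FE r s y)))"

lemma forces_mem_iff:
  assumes "s \<in> U" "t \<in> U"
  shows "forces_mem S F p s t \<longleftrightarrow> FM p s t"
  unfolding forces_mem_def FM_def conds_eq le_def[symmetric]
  using assms by (simp add: related_iff forces_eq_iff cong: ball_cong bex_cong)

lemma definable_FM [df]:
  "dterm S a \<Longrightarrow> dterm S b \<Longrightarrow> dterm S c \<Longrightarrow> definable S (\<lambda>e. FM (a e) (b e) (c e))"
proof (rule dpred3D)
  show "dpred3 S FM" unfolding dpred3_def FM_def by (intro df) auto
qed

lemma FM_le: "FM p s t \<Longrightarrow> le q p \<Longrightarrow> q \<in> PP \<Longrightarrow> p \<in> PP \<Longrightarrow> FM q s t"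
  unfolding FM_def using le_trans by blast

text \<open>This makes membership between values independent of the representing names.\<close>

lemma FM_cong:
  assumes "FM p s t" "FE p s s'" "FE p t t'" "p \<in> PP" "s \<in> U" "s' \<in> U" "t \<in> U" "t' \<in> U"
  shows "FM p s' t'"
  unfolding FM_def
proof (intro ballI impI)
  fix q assume q: "q \<in> PP" "le q p"
  obtain r y b where r: "r \<in> PP" "le r q" "y \<in> U" "b \<in> PP" "pr y b \<in> E t" "le r b" "FE r s y"
    using assms(1) q unfolding FM_def by blast
  have rp: "le r p" using le_trans[OF r(2) q(2)] r q assms by blast
  have "step FE p t t'" using FE_step assms by blast
  from stepD[OF this r(3,4,5,1) rp r(6)] obtain r' z c where
    r': "r' \<in> PP" "le r' r" "z \<in> U" "c \<in> PP" "pr z c \<in> E t'" "le r' c" "FE r' y z" by blast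
  have "le r' p" using le_trans[OF r'(2) rp] r r' assms by blast
  then have "FE r' s' s" using FE_le[OF FE_sym[OF assms(2)]] r' assms by blast
  moreover have "FE r' s y" using FE_le[OF r(7) r'(2)] r r' assms by blast
  ultimately have "FE r' s' z" using FE_trans r r' assms by meson
  moreover have "le r' q" using le_trans[OF r'(2) r(2)] r r' q by blast
  ultimately show "\<exists>r\<in>PP. le r q \<and> (\<exists>y\<in>U. \<exists>b\<in>PP. pr y b \<in> E t' \<and> le r b \<and> FE r s' y)"
    using r' by blast
qed

end

section \<open>The generic filter and the quotient by forced equality\<close>

locale generic_zf = forcing_zf +
  fixes G :: "'a set"
  assumes G: "generic S F G"
begin

lemma G_subset: "G \<subseteq> PP" and Top_in_G: "Top F \<in> G"
  and G_up: "p \<in> G \<Longrightarrow> q \<in> PP \<Longrightarrow> le p q \<Longrightarrow> q \<in> G"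
  and G_dir: "p \<in> G \<Longrightarrow> q \<in> G \<Longrightarrow> \<exists>r\<in>G. le r p \<and> le r q"
  using G unfolding generic_def conds_eq le_def by blast+

lemma G_PP [simp]: "p \<in> G \<Longrightarrow> p \<in> PP" using G_subset by blast

text \<open>Genericity speaks of dense sets of the model; a dense definable property yields such a
  set by separation.\<close>

lemma G_meets:
  assumes D: "dpred1 S D" and dense: "\<And>p. p \<in> PP \<Longrightarrow> \<exists>d\<in>PP. le d p \<and> D d"
  shows "\<exists>p\<in>G. D p"
proof -
  let ?D = "{d \<in> PP. D d}"
  have "isset ?D" by (intro isset_Collect_elts D) simp
  then have ED: "E (mk ?D) = ?D" by (rule E_mk)
  have "Defs.dense S F (mk ?D)"
    unfolding Defs.dense_def is_subset_iff conds_eq ED le_def[symmetric]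
    using dense by (auto simp: eps_iff ED) (metis E_in_U)
  then obtain p where "p \<in> G" "p \<epsilon>\<^bsub>S\<^esub> mk ?D" using G unfolding generic_def by (meson mk_in_U)
  moreover have "p \<in> U" using \<open>p \<in> G\<close> G_PP E_in_U by blast
  ultimately have "p \<in> G" "p \<in> ?D" using eps_iff[of p] ED by auto
  then show ?thesis by blast
qed

lemma G_meets_below:
  assumes D: "dpred1 S D" and p: "p \<in> G" and dense: "\<And>q. q \<in> PP \<Longrightarrow> le q p \<Longrightarrow> \<exists>d\<in>PP. le d q \<and> D d"
  shows "\<exists>q\<in>G. le q p \<and> D q"
proof -
  \<comment> \<open>Conditions incompatible with p are added so that density below p becomes density
    everywhere; a filter that contains p contains none of them.\<close>
  have "dpred1 S (\<lambda>q. (le q p \<and> D q) \<or> (\<forall>r\<in>PP. le r q \<longrightarrow> \<not> le r p))"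
    unfolding dpred1_def by (intro df dpred1D[OF D]) (use G_PP[OF p] in auto)
  then have "\<exists>q\<in>G. (le q p \<and> D q) \<or> (\<forall>r\<in>PP. le r q \<longrightarrow> \<not> le r p)"
  proof (rule G_meets)
    fix q assume q: "q \<in> PP"
    show "\<exists>d\<in>PP. le d q \<and> ((le d p \<and> D d) \<or> (\<forall>r\<in>PP. le r d \<longrightarrow> \<not> le r p))"
    proof (cases "\<forall>r\<in>PP. le r q \<longrightarrow> \<not> le r p")
      case False
      then obtain r where r: "r \<in> PP" "le r q" "le r p" by blast
      obtain d where d: "d \<in> PP" "le d r" "D d" using dense[OF r(1,3)] by blast
      have "le d q" "le d p" using le_trans d r q p G_PP by blast+
      then show ?thesis using d by blast
    next
      case True
      then show ?thesis using q le_refl by blast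
    qed
  qed
  then show ?thesis using G_dir p G_PP by blast
qed

text \<open>The equivalence class of t under equality forced by a member of \<open>G\<close>; it
  plays the role of the value of the name t.\<close>

definition val :: "'a \<Rightarrow> 'a set" where "val t = {s \<in> U. \<exists>p\<in>G. FE p s t}"

abbreviation "M \<equiv> generic_extension S F G"

lemma name_value_eq: "t \<in> U \<Longrightarrow> name_value S F G t = val t"
  unfolding name_value_def val_def using forces_eq_iff G_PP E_in_U by blast

lemma Univ_M: "Univ M = val ` U"
  by (auto simp: generic_extension_def name_value_eq)

lemma val_eq_iff:
  assumes "s \<in> U" "t \<in> U"
  shows "val s = val t \<longleftrightarrow> (\<exists>p\<in>G. FE p s t)"
proof
  assume "val s = val t"
  moreover have "s \<in> val s" unfolding val_def using FE_refl Top_in_G assms by auto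
  ultimately show "\<exists>p\<in>G. FE p s t" by (auto simp: val_def)
next
  have *: "u \<in> val t" if eq: "p \<in> G" "FE p s t" "u \<in> val s" "s \<in> U" "t \<in> U" for p s t u
  proof -
    obtain q where q: "q \<in> G" "FE q u s" "u \<in> U" using eq by (auto simp: val_def)
    obtain r where r: "r \<in> G" "le r p" "le r q" using G_dir[OF eq(1) q(1)] by blast
    have "FE r u s" "FE r s t" using FE_le eq q r G_PP by blast+
    then have "FE r u t" using FE_trans q eq r G_PP by blast
    then show ?thesis using r q by (auto simp: val_def)
  qed
  assume "\<exists>p\<in>G. FE p s t"
  then obtain p where p: "p \<in> G" "FE p s t" by blast
  then show "val s = val t" using *[OF p] *[OF p(1) FE_sym[OF p(2)]] assms by auto
qed

lemma Mem_M:
  assumes "s \<in> U" "t \<in> U"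
  shows "val s \<epsilon>\<^bsub>M\<^esub> val t \<longleftrightarrow> (\<exists>p\<in>G. FM p s t)"
proof
  assume "val s \<epsilon>\<^bsub>M\<^esub> val t"
  then obtain s' t' p where *: "s' \<in> val s" "t' \<in> val t" "p \<in> G" "forces_mem S F p s' t'"
    by (auto simp: generic_extension_def)
  obtain q r where q: "s' \<in> U" "t' \<in> U" "q \<in> G" "FE q s' s" "r \<in> G" "FE r t' t"
    using * by (auto simp: val_def)
  have fm: "FM p s' t'" using * q forces_mem_iff by blast
  obtain u where u: "u \<in> G" "le u q" "le u r" using G_dir q by blast
  obtain v where v: "v \<in> G" "le v u" "le v p" using G_dir u * by blast
  have "le v q" "le v r" using le_trans u v q G_PP by blast+
  then have "FM v s' t'" "FE v s' s" "FE v t' t" using FM_le[OF fm] FE_le v q * assms G_PP by blast+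
  then show "\<exists>p\<in>G. FM p s t" using FM_cong v q assms G_PP by blast
next
  assume "\<exists>p\<in>G. FM p s t"
  moreover have "s \<in> val s" "t \<in> val t" unfolding val_def using FE_refl Top_in_G assms by auto
  ultimately show "val s \<epsilon>\<^bsub>M\<^esub> val t"
    using assms forces_mem_iff[OF assms] by (simp add: generic_extension_def) blast
qed

text \<open>This recovers the usual evaluation of names. Genericity turns forced membership into
  forced equality with some y for which \<open>pr y b\<close> is in t and b is above a member of
  \<open>G\<close>, and \<open>G\<close> is closed upwards.\<close>

lemma elts_M:
  assumes t: "t \<in> U"
  shows "elts M (val t) = {val y |y b. y \<in> U \<and> b \<in> G \<and> pr y b \<in> E t}"
proof (intro set_eqI iffI)
  fix X assume "X \<in> elts M (val t)"
  then obtain s where s: "X = val s" "s \<in> U" "val s \<epsilon>\<^bsub>M\<^esub> val t"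
    by (auto simp: elts_def Univ_M simp del: E_in_U)
  obtain p where p: "p \<in> G" "FM p s t" using Mem_M[OF s(2) t] s(3) by blast
  have "dpred1 S (\<lambda>r. \<exists>y\<in>U. \<exists>b\<in>PP. pr y b \<in> E t \<and> le r b \<and> FE r s y)"
    unfolding dpred1_def using s t by (intro df) auto
  from G_meets_below[OF this p(1)] p(2) obtain r y b where
    r: "r \<in> G" "y \<in> U" "b \<in> PP" "pr y b \<in> E t" "le r b" "FE r s y" unfolding FM_def by blast
  have "b \<in> G" using G_up r by blast
  moreover have "X = val y" using s r val_eq_iff by blast
  ultimately show "X \<in> {val y |y b. y \<in> U \<and> b \<in> G \<and> pr y b \<in> E t}" using r by blast
next
  fix X assume "X \<in> {val y |y b. y \<in> U \<and> b \<in> G \<and> pr y b \<in> E t}"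
  then obtain y b where y: "X = val y" "y \<in> U" "b \<in> G" "pr y b \<in> E t" by blast
  have "FM b y t" unfolding FM_def using y FE_refl le_refl G_PP by blast
  then show "X \<in> elts M (val t)" using y Mem_M[of y t] t by (auto simp: elts_def Univ_M simp del: E_in_U)
qed

end

section \<open>Canonical names and the truth lemma\<close>

context forcing_zf
begin

text \<open>The body of \<open>is_check_name\<close> in terms of \<open>app\<close> and
  \<open>E\<close>, so that existence and uniqueness can be argued as for any recursion.\<close>

definition check_fun :: "'a \<Rightarrow> 'a \<Rightarrow> bool" where
  "check_fun T f \<longleftrightarrow> transitive_set T \<and> f \<in> U \<and> (\<forall>y\<in>E T. \<exists>!z. z \<in> U \<and> related S f y z) \<and>
     (\<forall>y\<in>E T. E (app f y) = (\<lambda>u. pr (app f u) (Top F)) ` E y)"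

lemma app_related:
  assumes "\<exists>!z. z \<in> U \<and> related S f y z" "y \<in> U" "z \<in> U"
  shows "related S f y z \<longleftrightarrow> z = app f y"
proof -
  obtain z0 where z0: "z0 \<in> U" "related S f y z0" "\<And>z. z \<in> U \<Longrightarrow> related S f y z \<Longrightarrow> z = z0"
    using assms(1) by blast
  have "app f y = z0"
  proof (rule app_eq[OF z0(1)])
    show "pr y z0 \<in> E f" using z0(2) related_iff[OF assms(2) z0(1)] by simp
    show "z = z0" if "z \<in> U" "pr y z \<in> E f" for z
      by (rule z0(3)[OF that(1)]) (use that related_iff[OF assms(2) that(1)] in simp)
  qed
  then show ?thesis using z0 assms by blast
qed

lemma is_check_name_iff:
  assumes "x \<in> U" "c \<in> U"
  shows "is_check_name S F x c \<longleftrightarrow> (\<exists>T\<in>U. \<exists>f\<in>U. check_fun T f \<and> x \<in> E T \<and> c = app f x)"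
proof -
  have Top: "Top F \<in> U" by (rule E_in_U[OF Top_in_PP])
  have "(is_transitive S T \<and> x \<epsilon>\<^bsub>S\<^esub> T \<and>
     (\<forall>y\<in>Univ S. y \<epsilon>\<^bsub>S\<^esub> T \<longrightarrow> (\<exists>!z. z \<in> Univ S \<and> related S f y z)) \<and>
     (\<forall>y\<in>Univ S. \<forall>z\<in>Univ S. y \<epsilon>\<^bsub>S\<^esub> T \<and> related S f y z \<longrightarrow>
        (\<forall>w\<in>Univ S. w \<epsilon>\<^bsub>S\<^esub> z \<longleftrightarrow>
           (\<exists>u\<in>Univ S. \<exists>v\<in>Univ S. u \<epsilon>\<^bsub>S\<^esub> y \<and> related S f u v \<and> is_pair S v (Top F) w))) \<and>
     related S f x c) \<longleftrightarrow> check_fun T f \<and> x \<in> E T \<and> c = app f x" (is "?L \<longleftrightarrow> ?R")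
    if Tf: "T \<in> U" "f \<in> U" for T f
  proof (cases "transitive_set T \<and> (\<forall>y\<in>E T. \<exists>!z. z \<in> U \<and> related S f y z)")
    case True
    then have tr: "\<And>y u. y \<in> E T \<Longrightarrow> u \<in> E y \<Longrightarrow> u \<in> E T"
      and ex1: "\<And>y. y \<in> E T \<Longrightarrow> \<exists>!z. z \<in> U \<and> related S f y z"
      unfolding transitive_set_def by blast+
    have rel: "related S f y z \<longleftrightarrow> z = app f y" if "y \<in> E T" "z \<in> U" for y z
      using app_related[OF ex1[OF that(1)] _ that(2)] that by simp
    have 1: "(\<exists>u\<in>U. \<exists>v\<in>U. u \<epsilon>\<^bsub>S\<^esub> y \<and> related S f u v \<and> is_pair S v (Top F) w) \<longleftrightarrow>
      w \<in> (\<lambda>u. pr (app f u) (Top F)) ` E y" if "y \<in> E T" "w \<in> U" for y w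
    proof -
      have "(\<exists>u\<in>U. \<exists>v\<in>U. u \<epsilon>\<^bsub>S\<^esub> y \<and> related S f u v \<and> is_pair S v (Top F) w) \<longleftrightarrow>
        (\<exists>u\<in>E y. \<exists>v\<in>U. related S f u v \<and> w = pr v (Top F))"
        using that(2) Top by (auto simp: is_pair_iff elts_def simp del: E_in_U)
      also have "\<dots> \<longleftrightarrow> (\<exists>u\<in>E y. w = pr (app f u) (Top F))"
        using rel tr[OF that(1)] by (metis app_in_U)
      finally show ?thesis by (auto simp: image_iff)
    qed
    have 2: "(\<forall>w\<in>U. w \<epsilon>\<^bsub>S\<^esub> app f y \<longleftrightarrow> (\<exists>u\<in>U. \<exists>v\<in>U. u \<epsilon>\<^bsub>S\<^esub> y \<and> related S f u v \<and> is_pair S v (Top F) w)) \<longleftrightarrow>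
      E (app f y) = (\<lambda>u. pr (app f u) (Top F)) ` E y" if "y \<in> E T" for y
      using 1[OF that] E_subset[of "app f y"] by (auto simp: eps_iff)
    have 3: "(\<forall>y\<in>Univ S. \<forall>z\<in>Univ S. y \<epsilon>\<^bsub>S\<^esub> T \<and> related S f y z \<longrightarrow>
        (\<forall>w\<in>Univ S. w \<epsilon>\<^bsub>S\<^esub> z \<longleftrightarrow>
           (\<exists>u\<in>Univ S. \<exists>v\<in>Univ S. u \<epsilon>\<^bsub>S\<^esub> y \<and> related S f u v \<and> is_pair S v (Top F) w))) \<longleftrightarrow>
      (\<forall>y\<in>E T. E (app f y) = (\<lambda>u. pr (app f u) (Top F)) ` E y)" (is "?A \<longleftrightarrow> ?B")
    proof
      assume A: ?A
      show ?B
      proof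
        fix y assume y: "y \<in> E T"
        then have "y \<in> U" "app f y \<in> U" "y \<epsilon>\<^bsub>S\<^esub> T \<and> related S f y (app f y)"
          using rel[OF y app_in_U] by (simp_all add: eps_iff)
        then show "E (app f y) = (\<lambda>u. pr (app f u) (Top F)) ` E y"
          using A 2[OF y] by blast
      qed
    next
      assume B: ?B
      show ?A
      proof (intro ballI impI, elim conjE)
        fix y z w assume y: "y \<in> U" "z \<in> U" "w \<in> U" "y \<epsilon>\<^bsub>S\<^esub> T" "related S f y z"
        then have yT: "y \<in> E T" by (simp add: eps_iff)
        then have "z = app f y" using rel y by blast
        then show "w \<epsilon>\<^bsub>S\<^esub> z \<longleftrightarrow> (\<exists>u\<in>Univ S. \<exists>v\<in>Univ S. u \<epsilon>\<^bsub>S\<^esub> y \<and> related S f u v \<and> is_pair S v (Top F) w)"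
          using B 2[OF yT] yT y(3) by blast
      qed
    qed
    show ?thesis unfolding 3 check_fun_def
      using True Tf assms rel[of x c] ball_elts_iff[of T "\<lambda>y. \<exists>!z. z \<in> Univ S \<and> related S f y z"]
      by (simp add: is_transitive_iff transitive_set_def eps_iff) blast
  next
    case False
    then show ?thesis
      using Tf ball_elts_iff[of T "\<lambda>y. \<exists>!z. z \<in> Univ S \<and> related S f y z"]
      unfolding check_fun_def is_transitive_iff transitive_set_def by blast
  qed
  then show ?thesis unfolding is_check_name_def by (simp cong: bex_cong)
qed

lemma check_fun_unique:
  assumes "check_fun T f" "check_fun T' f'" "x \<in> E T" "x \<in> E T'"
  shows "app f x = app f' x"
proof (rule ccontr)
  assume neq: "app f x \<noteq> app f' x"
  have U: "T \<in> U" "T' \<in> U" "f \<in> U" "f' \<in> U" using assms by (auto simp: check_fun_def transitive_set_def)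
  let ?B = "{y \<in> E T. y \<in> E T' \<and> app f y \<noteq> app f' y}"
  have "isset ?B" by (rule isset_Collect_elts) (auto simp: U dpred1_def intro!: df)
  from foundation_set[OF this] obtain y where y: "y \<in> ?B" "?B \<inter> E y = {}" using assms neq by blast
  have "E y \<subseteq> E T" "E y \<subseteq> E T'"
    using y(1) assms(1,2) by (simp_all add: check_fun_def transitive_set_def)
  then have "u \<in> E T \<and> u \<in> E T'" if "u \<in> E y" for u
    using that by blast
  then have "app f u = app f' u" if "u \<in> E y" for u using that y(2) by blast
  then have "(\<lambda>u. pr (app f u) (Top F)) ` E y = (\<lambda>u. pr (app f' u) (Top F)) ` E y"
    by (intro image_cong) auto
  then have "E (app f y) = E (app f' y)" using y(1) assms(1,2) unfolding check_fun_def by auto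
  then have "app f y = app f' y" by (intro elts_ext) auto
  then show False using y(1) by simp
qed

lemma check_fun_exists:
  assumes "x \<in> U"
  shows "\<exists>T f. check_fun T f \<and> x \<in> E T"
proof -
  have Top: "Top F \<in> U" by (rule E_in_U[OF Top_in_PP])
  obtain T where T: "T \<in> U" "E (mk {x}) \<subseteq> E T" "\<forall>y\<in>E T. E y \<subseteq> E T"
    using transitive_superset[of "mk {x}"] by auto
  define H where "H z = mk {w \<in> U. \<exists>v\<in>E z. w = pr v (Top F)}" for z
  have dH: "dfun1 S H" unfolding dfun1_def H_def by (intro df Top)
  have EH: "E (H z) = (\<lambda>v. pr v (Top F)) ` E z" if "z \<in> U" for z
  proof -
    have "dfun1 S (\<lambda>v. pr v (Top F))" unfolding dfun1_def by (intro df Top)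
    then have "isset ((\<lambda>v. pr v (Top F)) ` E z)" by (intro isset_image isset_E that)
    moreover have "{w \<in> U. \<exists>v\<in>E z. w = pr v (Top F)} = (\<lambda>v. pr v (Top F)) ` E z" by auto
    ultimately show ?thesis unfolding H_def by (simp add: E_mk)
  qed
  have "dpred2 S (\<lambda>u y. u \<in> E y)" unfolding dpred2_def by (intro df)
  from wf_recursion[OF T(1) this wf_on_mem dH] obtain h where dh: "dfun1 S h"
    and h: "\<And>y. y \<in> E T \<Longrightarrow> h y = H (mk {v \<in> U. \<exists>u\<in>E T. u \<in> E y \<and> v = h u})" by blast
  have Eh: "E (h y) = (\<lambda>u. pr (h u) (Top F)) ` E y" if y: "y \<in> E T" for y
  proof -
    have "{v \<in> U. \<exists>u\<in>E T. u \<in> E y \<and> v = h u} = h ` E y"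
      using T(3) y dfun1_in_Univ[OF dh] by auto
    moreover have "isset (h ` E y)" using y by (intro isset_image dh) auto
    ultimately have "E (mk {v \<in> U. \<exists>u\<in>E T. u \<in> E y \<and> v = h u}) = h ` E y" by (simp add: E_mk)
    then show ?thesis using h[OF y] by (simp add: EH image_image)
  qed
  have app: "app (graph T h) y = h y" if "y \<in> E T" for y by (rule app_graph[OF T(1) dh that])
  have "check_fun T (graph T h)" unfolding check_fun_def
  proof (intro conjI ballI)
    show "transitive_set T" using T by (simp add: transitive_set_def)
    show "graph T h \<in> U" by simp
    show "\<exists>!z. z \<in> U \<and> related S (graph T h) y z" if "y \<in> E T" for y
      by (rule ex1I[of _ "h y"]) (use that T dh in \<open>auto simp: related_iff pr_in_graph dfun1_in_Univ\<close>)
    show "E (app (graph T h) y) = (\<lambda>u. pr (app (graph T h) u) (Top F)) ` E y" if y: "y \<in> E T" for y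
    proof -
      have "app (graph T h) u = h u" if "u \<in> E y" for u using that y T(3) app by blast
      then show ?thesis using app[OF y] Eh[OF y] by (auto intro!: image_cong)
    qed
  qed
  then show ?thesis using T(2) assms by auto
qed

text \<open>The operator \<open>the_in\<close> is used because it is definable;
  \<open>chk_THE\<close> shows that it gives the same name as \<open>THE\<close>.\<close>

definition chk :: "'a \<Rightarrow> 'a" where "chk x = the_in S (\<lambda>c. is_check_name S F x c)"

lemma chk_eq:
  assumes "check_fun T f" "x \<in> E T"
  shows "chk x = app f x" "(THE c. c \<in> U \<and> is_check_name S F x c) = app f x"
proof -
  have U: "T \<in> U" "f \<in> U" using assms by (auto simp: check_fun_def transitive_set_def)
  have 1: "is_check_name S F x (app f x)"
    using is_check_name_iff[of x "app f x"] assms U by auto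
  have 2: "c = app f x" if "c \<in> U" "is_check_name S F x c" for c
    using is_check_name_iff[of x c] that assms check_fun_unique by (metis E_in_U)
  show "chk x = app f x" unfolding chk_def by (rule the_in_eq) (use 1 2 in auto)
  show "(THE c. c \<in> U \<and> is_check_name S F x c) = app f x"
    by (rule the_equality) (use 1 2 in auto)
qed

lemma chk_THE: "x \<in> U \<Longrightarrow> (THE c. c \<in> U \<and> is_check_name S F x c) = chk x"
  using check_fun_exists[of x] chk_eq by metis

lemma chk_in_U [simp]: "chk x \<in> U" by (simp add: chk_def)

lemma E_chk: "x \<in> U \<Longrightarrow> E (chk x) = (\<lambda>u. pr (chk u) (Top F)) ` E x"
proof -
  assume "x \<in> U"
  then obtain T f where Tf: "check_fun T f" "x \<in> E T" using check_fun_exists by blast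
  have "E x \<subseteq> E T" using Tf unfolding check_fun_def transitive_set_def by blast
  then have "chk u = app f u" if "u \<in> E x" for u
    using that by (intro chk_eq(1)[OF Tf(1)]) blast
  then have "(\<lambda>u. pr (chk u) (Top F)) ` E x = (\<lambda>u. pr (app f u) (Top F)) ` E x"
    by (intro image_cong) auto
  then show ?thesis using chk_eq(1)[OF Tf] Tf by (simp add: check_fun_def)
qed

lemma dterm_chk [df]: "dterm S a \<Longrightarrow> dterm S (\<lambda>e. chk (a e))"
proof (rule dfun1D[where h = chk])
  have "dterm S (\<lambda>e. Top F)" by (intro df E_in_U[OF Top_in_PP])
  then have "dpred2 S (is_check_name S F)"
    unfolding is_check_name_def dpred2_def is_transitive_def is_subset_def is_pair_def is_upair_def
    by (intro df E_in_U[OF Top_in_PP])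
  note [df] = dpred2D[OF this]
  show "dfun1 S chk" unfolding dfun1_def chk_def by (intro df)
qed

text \<open>Canonical names contain only pairs with the maximal condition, so forced inclusion
  matches every element of x with one of y, under some condition, and the induction hypothesis
  identifies the two. No condition can therefore confuse two ground model sets.\<close>

lemma FE_chk_imp_eq:
  assumes "FE p (chk x) (chk y)" "p \<in> PP" "x \<in> U" "y \<in> U"
  shows "x = y"
proof -
  have "dpred1 S (\<lambda>x. \<forall>y\<in>U. \<forall>p\<in>PP. FE p (chk x) (chk y) \<longrightarrow> x = y)"
    unfolding dpred1_def by (intro df) auto
  then have "\<forall>y\<in>U. \<forall>p\<in>PP. FE p (chk x) (chk y) \<longrightarrow> x = y"
  proof (rule eps_induct)
    fix x assume x: "x \<in> U" and IH: "\<And>u. u \<in> E x \<Longrightarrow> \<forall>y\<in>U. \<forall>p\<in>PP. FE p (chk u) (chk y) \<longrightarrow> u = y"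
    show "\<forall>y\<in>U. \<forall>p\<in>PP. FE p (chk x) (chk y) \<longrightarrow> x = y"
    proof (intro ballI impI)
      fix y p assume y: "y \<in> U" "p \<in> PP" "FE p (chk x) (chk y)"
      then have st: "step FE p (chk x) (chk y)" "step FE p (chk y) (chk x)"
        using FE_step by auto
      have *: "\<exists>r\<in>PP. \<exists>u'\<in>E t. FE r (chk u) (chk u')"
        if "step FE p (chk s) (chk t)" "u \<in> E s" "s \<in> U" and t: "t \<in> U" for s t u
      proof -
        have "pr (chk u) (Top F) \<in> E (chk s)" using that E_chk by auto
        from stepD[OF that(1) chk_in_U Top_in_PP this y(2) le_refl[OF y(2)] le_Top[OF y(2)]]
        obtain r v b where r: "r \<in> PP" "v \<in> U" "b \<in> PP" "pr v b \<in> E (chk t)" "FE r (chk u) v" by blast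
        obtain u' where "u' \<in> E t" "pr v b = pr (chk u') (Top F)"
          using r(4) unfolding E_chk[OF t] by blast
        moreover from this have "v = chk u'" using r E_in_U[OF Top_in_PP] by (metis E_in_U pr_inject chk_in_U)
        ultimately show ?thesis using r by blast
      qed
      have "u \<in> E y" if "u \<in> E x" for u
        using *[OF st(1) that x y(1)] IH[OF that] E_in_U by blast
      moreover have "u \<in> E x" if u: "u \<in> E y" for u
      proof -
        obtain r u' where r: "r \<in> PP" "u' \<in> E x" "FE r (chk u) (chk u')"
          using *[OF st(2) u y(1) x] by blast
        then have "FE r (chk u') (chk u)" using FE_sym by auto
        then have "u' = u" using IH[OF r(2)] r(1) E_in_U[OF u] by blast
        then show ?thesis using r by simp
      qed
      ultimately have "E x = E y" by blast
      then show "x = y" using x y by (intro elts_ext)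
    qed
  qed (use assms in simp)
  then show ?thesis using assms by blast
qed

end

context generic_zf
begin

section \<open>The ground model inside the extension\<close>

definition j :: "'a \<Rightarrow> 'a set" where "j x = val (chk x)"

lemma ground_embedding_eq: "x \<in> U \<Longrightarrow> ground_embedding S F G x = j x"
  unfolding ground_embedding_def j_def by (simp add: chk_THE name_value_eq)

lemma j_inject [simp]: "x \<in> U \<Longrightarrow> y \<in> U \<Longrightarrow> j x = j y \<longleftrightarrow> x = y"
  using val_eq_iff[of "chk x" "chk y"] FE_chk_imp_eq[of _ x y] G_PP unfolding j_def by auto

lemma elts_j: "x \<in> U \<Longrightarrow> elts M (j x) = j ` E x"
proof -
  assume x: "x \<in> U"
  have "{val y |y b. y \<in> U \<and> b \<in> G \<and> pr y b \<in> E (chk x)} = (\<lambda>u. val (chk u)) ` E x"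
  proof (intro set_eqI iffI)
    fix X assume "X \<in> {val y |y b. y \<in> U \<and> b \<in> G \<and> pr y b \<in> E (chk x)}"
    then obtain y b u where *: "X = val y" "y \<in> U" "b \<in> G" "u \<in> E x" "pr y b = pr (chk u) (Top F)"
      using E_chk[OF x] by auto
    then have "y = chk u" by (metis E_in_U G_PP Top_in_G chk_in_U pr_inject)
    then show "X \<in> (\<lambda>u. val (chk u)) ` E x" using * by blast
  next
    fix X assume "X \<in> (\<lambda>u. val (chk u)) ` E x"
    then show "X \<in> {val y |y b. y \<in> U \<and> b \<in> G \<and> pr y b \<in> E (chk x)}"
      unfolding E_chk[OF x] using Top_in_G chk_in_U by blast
  qed
  then show ?thesis using elts_M[of "chk x"] by (simp add: j_def)
qed

lemma j_in_M [simp]: "j x \<in> Univ M" by (simp add: Univ_M j_def)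

text \<open>
  The witness \<open>\<Phi>\<close> is strong forcing: \<open>p\<close> forces an existential statement only if it forces an
  instance.  This makes the existential step of the truth lemma trivial, without choice of names.
\<close>

definition forceable :: "((nat \<Rightarrow> 'a) \<Rightarrow> bool) \<Rightarrow> bool" where
  "forceable P \<longleftrightarrow> (\<exists>\<Phi>. definable S (\<lambda>e. \<Phi> (vh e) (vt e)) \<and>
     (\<forall>p\<in>PP. \<forall>q\<in>PP. \<forall>e\<in>envs S. le q p \<longrightarrow> \<Phi> p e \<longrightarrow> \<Phi> q e) \<and>
     (\<forall>e\<in>envs S. P e \<longleftrightarrow> (\<exists>p\<in>G. \<Phi> p e)))"

lemma tail_map_comp_vt: "tail_map g \<Longrightarrow> tail_map (\<lambda>e. g (vt e))"
  unfolding tail_map_def vt_def by (metis add_Suc add_Suc_right)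

lemma tail_map_envs: "tail_map g \<Longrightarrow> e \<in> envs S \<Longrightarrow> g e \<in> envs S"
  by (auto simp: tail_map_def envs_def)

lemma forceable_mem:
  assumes "tail_map g" "tail_map h"
  shows "forceable (\<lambda>e. val (vh (g e)) \<epsilon>\<^bsub>M\<^esub> val (vh (h e)))"
  unfolding forceable_def
proof (intro exI[of _ "\<lambda>p e. FM p (vh (g e)) (vh (h e))"] conjI ballI impI)
  show "definable S (\<lambda>e. FM (vh e) (vh (g (vt e))) (vh (h (vt e))))"
    by (intro df tail_map_comp_vt assms)
  show "FM q (vh (g e)) (vh (h e))" if "p \<in> PP" "q \<in> PP" "le q p" "FM p (vh (g e)) (vh (h e))" for p q e
    using that FM_le by blast
  show "val (vh (g e)) \<epsilon>\<^bsub>M\<^esub> val (vh (h e)) \<longleftrightarrow> (\<exists>p\<in>G. FM p (vh (g e)) (vh (h e)))"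
    if "e \<in> envs S" for e
    using that assms tail_map_envs by (intro Mem_M) auto
qed

lemma forceable_eq:
  assumes "tail_map g" "tail_map h"
  shows "forceable (\<lambda>e. val (vh (g e)) = val (vh (h e)))"
  unfolding forceable_def
proof (intro exI[of _ "\<lambda>p e. FE p (vh (g e)) (vh (h e))"] conjI ballI impI)
  show "definable S (\<lambda>e. FE (vh e) (vh (g (vt e))) (vh (h (vt e))))"
    by (intro df tail_map_comp_vt assms)
  show "FE q (vh (g e)) (vh (h e))"
    if "p \<in> PP" "q \<in> PP" "e \<in> envs S" "le q p" "FE p (vh (g e)) (vh (h e))" for p q e
    using that FE_le tail_map_envs[OF assms(1)] tail_map_envs[OF assms(2)] vh_in_Univ by metis
  show "val (vh (g e)) = val (vh (h e)) \<longleftrightarrow> (\<exists>p\<in>G. FE p (vh (g e)) (vh (h e)))"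
    if "e \<in> envs S" for e
    using that assms tail_map_envs by (intro val_eq_iff) auto
qed

lemma forceable_not:
  assumes "forceable P"
  shows "forceable (\<lambda>e. \<not> P e)"
proof -
  obtain \<Phi> where d: "definable S (\<lambda>e. \<Phi> (vh e) (vt e))"
    and mono: "\<And>p q e. p \<in> PP \<Longrightarrow> q \<in> PP \<Longrightarrow> e \<in> envs S \<Longrightarrow> le q p \<Longrightarrow> \<Phi> p e \<Longrightarrow> \<Phi> q e"
    and truth: "\<And>e. e \<in> envs S \<Longrightarrow> P e \<longleftrightarrow> (\<exists>p\<in>G. \<Phi> p e)"
    using assms unfolding forceable_def by blast
  show ?thesis unfolding forceable_def
  proof (intro exI[of _ "\<lambda>p e. \<forall>q\<in>PP. le q p \<longrightarrow> \<not> \<Phi> q e"] conjI)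
    have "definable S (\<lambda>e. \<Phi> (vh e) (vt (vt e)))"
      using definable_inst[OF d, of "\<lambda>n. if n = 0 then Inl 0 else Inl (Suc n)"]
      by (simp add: inst_def params_in_def vh_def vt_def)
    then show "definable S (\<lambda>e. \<forall>q\<in>PP. le q (vh e) \<longrightarrow> \<not> \<Phi> q (vt e))"
      by (intro df) auto
    show "\<forall>p\<in>PP. \<forall>q\<in>PP. \<forall>e\<in>envs S. le q p \<longrightarrow> (\<forall>q\<in>PP. le q p \<longrightarrow> \<not> \<Phi> q e) \<longrightarrow> (\<forall>r\<in>PP. le r q \<longrightarrow> \<not> \<Phi> r e)"
      using le_trans by blast
    show "\<forall>e\<in>envs S. \<not> P e \<longleftrightarrow> (\<exists>p\<in>G. \<forall>q\<in>PP. le q p \<longrightarrow> \<not> \<Phi> q e)"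
    proof
      fix e assume e: "e \<in> envs S"
      \<comment> \<open>The environment is frozen into parameters and only the condition stays a
        variable; thus the conditions that decide the statement form a definable class to which
        genericity applies.\<close>
      have "params_in S (\<lambda>n. case n of 0 \<Rightarrow> Inl 0 | Suc n \<Rightarrow> Inr (e n))"
        using e by (auto simp: params_in_def envs_def split: nat.splits)
      from definable_inst[OF d this] have "definable S (\<lambda>e'. \<Phi> (vh e') e)"
        by (simp add: inst_def vh_def vt_def)
      then have "dpred1 S (\<lambda>p. \<Phi> p e)" by (simp add: dpred1_def)
      note [df] = dpred1D[OF this]
      have "dpred1 S (\<lambda>p. \<Phi> p e \<or> (\<forall>q\<in>PP. le q p \<longrightarrow> \<not> \<Phi> q e))"
        unfolding dpred1_def by (intro df) auto
      then have "\<exists>p\<in>G. \<Phi> p e \<or> (\<forall>q\<in>PP. le q p \<longrightarrow> \<not> \<Phi> q e)"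
        by (rule G_meets) (use le_refl in blast)
      moreover have False if "p \<in> G" "\<Phi> p e" "p' \<in> G" "\<forall>q\<in>PP. le q p' \<longrightarrow> \<not> \<Phi> q e" for p p'
        using G_dir[OF that(1,3)] mono that e G_PP by blast
      ultimately show "\<not> P e \<longleftrightarrow> (\<exists>p\<in>G. \<forall>q\<in>PP. le q p \<longrightarrow> \<not> \<Phi> q e)"
        using truth[OF e] by blast
    qed
  qed
qed

lemma forceable_conj:
  assumes "forceable P" "forceable Q"
  shows "forceable (\<lambda>e. P e \<and> Q e)"
proof -
  obtain \<Phi> where d: "definable S (\<lambda>e. \<Phi> (vh e) (vt e))"
    and mono: "\<And>p q e. p \<in> PP \<Longrightarrow> q \<in> PP \<Longrightarrow> e \<in> envs S \<Longrightarrow> le q p \<Longrightarrow> \<Phi> p e \<Longrightarrow> \<Phi> q e"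
    and truth: "\<And>e. e \<in> envs S \<Longrightarrow> P e \<longleftrightarrow> (\<exists>p\<in>G. \<Phi> p e)"
    using assms(1) unfolding forceable_def by blast
  obtain \<Psi> where d': "definable S (\<lambda>e. \<Psi> (vh e) (vt e))"
    and mono': "\<And>p q e. p \<in> PP \<Longrightarrow> q \<in> PP \<Longrightarrow> e \<in> envs S \<Longrightarrow> le q p \<Longrightarrow> \<Psi> p e \<Longrightarrow> \<Psi> q e"
    and truth': "\<And>e. e \<in> envs S \<Longrightarrow> Q e \<longleftrightarrow> (\<exists>p\<in>G. \<Psi> p e)"
    using assms(2) unfolding forceable_def by blast
  show ?thesis unfolding forceable_def
  proof (intro exI[of _ "\<lambda>p e. \<Phi> p e \<and> \<Psi> p e"] conjI)
    show "definable S (\<lambda>e. \<Phi> (vh e) (vt e) \<and> \<Psi> (vh e) (vt e))" by (intro definable_conj d d')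
    show "\<forall>p\<in>PP. \<forall>q\<in>PP. \<forall>e\<in>envs S. le q p \<longrightarrow> \<Phi> p e \<and> \<Psi> p e \<longrightarrow> \<Phi> q e \<and> \<Psi> q e"
      using mono mono' by blast
    show "\<forall>e\<in>envs S. P e \<and> Q e \<longleftrightarrow> (\<exists>p\<in>G. \<Phi> p e \<and> \<Psi> p e)"
    proof
      fix e assume e: "e \<in> envs S"
      have "\<exists>r\<in>G. \<Phi> r e \<and> \<Psi> r e" if pq: "p \<in> G" "\<Phi> p e" "q \<in> G" "\<Psi> q e" for p q
      proof -
        obtain r where r: "r \<in> G" "le r p" "le r q" using G_dir[OF pq(1,3)] by blast
        then have "\<Phi> r e" "\<Psi> r e" using mono[of p r e] mono'[of q r e] pq e by auto
        then show ?thesis using r by blast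
      qed
      then show "P e \<and> Q e \<longleftrightarrow> (\<exists>p\<in>G. \<Phi> p e \<and> \<Psi> p e)" using truth[OF e] truth'[OF e] by blast
    qed
  qed
qed

lemma forceable_ex:
  assumes "forceable (\<lambda>e. Q (vt e) (val (vh e)))"
  shows "forceable (\<lambda>e. \<exists>X\<in>Univ M. Q e X)"
proof -
  obtain \<Phi> where d: "definable S (\<lambda>e. \<Phi> (vh e) (vt e))"
    and mono: "\<And>p q e. p \<in> PP \<Longrightarrow> q \<in> PP \<Longrightarrow> e \<in> envs S \<Longrightarrow> le q p \<Longrightarrow> \<Phi> p e \<Longrightarrow> \<Phi> q e"
    and truth: "\<And>e. e \<in> envs S \<Longrightarrow> Q (vt e) (val (vh e)) \<longleftrightarrow> (\<exists>p\<in>G. \<Phi> p e)"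
    using assms unfolding forceable_def by blast
  show ?thesis unfolding forceable_def
  proof (intro exI[of _ "\<lambda>p e. \<exists>x\<in>U. \<Phi> p (case_nat x e)"] conjI)
    \<comment> \<open>The witness x arrives in front of the condition, whereas \<open>\<Phi>\<close>
      expects the condition first, so the two front variables are exchanged.\<close>
    let ?t = "\<lambda>n. if n = 0 then Inl 1 else if n = 1 then Inl 0 else Inl n"
    have eq: "vt (inst ?t e) = case_nat (vh e) (vt (vt e))" "vh (inst ?t e) = vh (vt e)" for e :: "nat \<Rightarrow> 'a"
      by (auto simp: inst_def vh_def vt_def fun_eq_iff split: nat.splits)
    have "params_in S ?t" by (auto simp: params_in_def)
    from definable_inst[OF d this] have "definable S (\<lambda>e. \<Phi> (vh (vt e)) (case_nat (vh e) (vt (vt e))))"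
      by (simp only: eq)
    then show "definable S (\<lambda>e. \<exists>x\<in>U. \<Phi> (vh e) (case_nat x (vt e)))" by (intro df)
    show "\<forall>p\<in>PP. \<forall>q\<in>PP. \<forall>e\<in>envs S. le q p \<longrightarrow> (\<exists>x\<in>U. \<Phi> p (case_nat x e)) \<longrightarrow> (\<exists>x\<in>U. \<Phi> q (case_nat x e))"
    proof (intro ballI impI)
      fix p q e assume *: "p \<in> PP" "q \<in> PP" "e \<in> envs S" "le q p" "\<exists>x\<in>U. \<Phi> p (case_nat x e)"
      then obtain x where "x \<in> U" "\<Phi> p (case_nat x e)" by blast
      then show "\<exists>x\<in>U. \<Phi> q (case_nat x e)" using mono[of p q "case_nat x e"] * by auto
    qed
    show "\<forall>e\<in>envs S. (\<exists>X\<in>Univ M. Q e X) \<longleftrightarrow> (\<exists>p\<in>G. \<exists>x\<in>U. \<Phi> p (case_nat x e))"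
    proof
      fix e assume e: "e \<in> envs S"
      have "Q e (val x) \<longleftrightarrow> (\<exists>p\<in>G. \<Phi> p (case_nat x e))" if "x \<in> U" for x
        using truth[of "case_nat x e"] that e by simp
      then show "(\<exists>X\<in>Univ M. Q e X) \<longleftrightarrow> (\<exists>p\<in>G. \<exists>x\<in>U. \<Phi> p (case_nat x e))"
        unfolding Univ_M by blast
    qed
  qed
qed

lemma forceable_cong:
  assumes "forceable P" "\<And>e. P e = Q e"
  shows "forceable Q"
proof -
  have "P = Q" using assms(2) by (simp add: fun_eq_iff)
  then show ?thesis using assms(1) by simp
qed

lemma forceable_all: "forceable (\<lambda>e. Q (vt e) (val (vh e))) \<Longrightarrow> forceable (\<lambda>e. \<forall>X\<in>Univ M. Q e X)"
  using forceable_not[OF forceable_ex[OF forceable_not, of Q]] by simp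

lemma forceable_iff:
  assumes "forceable P" "forceable Q"
  shows "forceable (\<lambda>e. P e \<longleftrightarrow> Q e)"
  by (rule forceable_cong[OF forceable_conj[OF forceable_not[OF forceable_conj[OF assms(1) forceable_not[OF assms(2)]]]
      forceable_not[OF forceable_conj[OF assms(2) forceable_not[OF assms(1)]]]]]) blast

lemma forceable_disj:
  assumes "forceable P" "forceable Q"
  shows "forceable (\<lambda>e. P e \<or> Q e)"
  by (rule forceable_cong[OF forceable_not[OF forceable_conj[OF forceable_not[OF assms(1)] forceable_not[OF assms(2)]]]]) blast

text \<open>The instance of the truth lemma on which the preservation arguments rest. The name of
  the relation is a fixed parameter and both arguments are canonical names, which makes
  \<open>\<Phi>\<close> a predicate of three ground model objects.\<close>

theorem related_forcing:
  assumes t: "t \<in> U"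
  shows "\<exists>\<Phi>. dpred3 S \<Phi> \<and> (\<forall>p\<in>PP. \<forall>q\<in>PP. \<forall>x\<in>U. \<forall>y\<in>U. le q p \<longrightarrow> \<Phi> p x y \<longrightarrow> \<Phi> q x y) \<and>
    (\<forall>x\<in>U. \<forall>y\<in>U. related M (val t) (j x) (j y) \<longleftrightarrow> (\<exists>p\<in>G. \<Phi> p x y))"
proof -
  have "forceable (\<lambda>e. related M (val (vh e)) (val (vh (vt e))) (val (vh (vt (vt e)))))"
    unfolding related_def is_pair_def is_upair_def
    by (intro forceable_ex forceable_all forceable_conj forceable_disj forceable_iff forceable_mem
      forceable_eq vtI)
  then obtain \<Phi> where d: "definable S (\<lambda>e. \<Phi> (vh e) (vt e))"
    and mono: "\<And>p q e. p \<in> PP \<Longrightarrow> q \<in> PP \<Longrightarrow> e \<in> envs S \<Longrightarrow> le q p \<Longrightarrow> \<Phi> p e \<Longrightarrow> \<Phi> q e"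
    and truth: "\<And>e. e \<in> envs S \<Longrightarrow>
      related M (val (vh e)) (val (vh (vt e))) (val (vh (vt (vt e)))) \<longleftrightarrow> (\<exists>p\<in>G. \<Phi> p e)"
    unfolding forceable_def by blast
  \<comment> \<open>The statement has three variables, but an environment is infinite; filling it up
    with \<open>zero\<close> turns it into a function of three objects.\<close>
  define env where "env s a b = case_nat s (case_nat a (case_nat b (\<lambda>_. zero)))" for s a b
  have env: "env s a b \<in> envs S" if "s \<in> U" "a \<in> U" "b \<in> U" for s a b
    using that by (simp add: env_def) (simp add: envs_def)
  let ?t = "\<lambda>n. if n < 4 then Inl n else Inr zero"
  have eq: "vt (inst ?t e) = env (vh (vt e)) (vh (vt (vt e))) (vh (vt (vt (vt e))))"
    "vh (inst ?t e) = vh e" for e :: "nat \<Rightarrow> 'a"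
    by (auto simp: env_def inst_def vh_def vt_def fun_eq_iff less_Suc_eq numeral_eq_Suc split: nat.splits)
  have "params_in S ?t" by (auto simp: params_in_def)
  from definable_inst[OF d this]
  have "definable S (\<lambda>e. \<Phi> (vh e) (env (vh (vt e)) (vh (vt (vt e))) (vh (vt (vt (vt e))))))"
    by (simp only: eq)
  then have "dpred4 S (\<lambda>p s a b. \<Phi> p (env s a b))" by (simp add: dpred4_def)
  note [df] = dpred4D[OF this]
  have "dpred3 S (\<lambda>p x y. \<Phi> p (env t (chk x) (chk y)))"
    unfolding dpred3_def by (intro df t)
  moreover have "related M (val t) (j x) (j y) \<longleftrightarrow> (\<exists>p\<in>G. \<Phi> p (env t (chk x) (chk y)))"
    if "x \<in> U" "y \<in> U" for x y
    using truth[OF env[OF t chk_in_U chk_in_U]] by (simp add: env_def j_def)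
  moreover have "\<forall>p\<in>PP. \<forall>q\<in>PP. \<forall>x\<in>U. \<forall>y\<in>U. le q p \<longrightarrow> \<Phi> p (env t (chk x) (chk y)) \<longrightarrow> \<Phi> q (env t (chk x) (chk y))"
    using mono[OF _ _ env[OF t chk_in_U chk_in_U]] by blast
  ultimately show ?thesis by blast
qed

end

section \<open>Functions in the extension and cofinalities\<close>

lemma is_upair_elts: "x \<in> Univ N \<Longrightarrow> y \<in> Univ N \<Longrightarrow> is_upair N x y z \<longleftrightarrow> elts N z = {x, y}"
  unfolding is_upair_def elts_def by auto

lemma is_ordinal_elts: "is_ordinal N x \<longleftrightarrow> (\<forall>y\<in>elts N x. elts N y \<subseteq> elts N x) \<and>
    (\<forall>y\<in>elts N x. \<forall>z\<in>elts N x. y \<in> elts N z \<or> y = z \<or> z \<in> elts N y)"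
  unfolding is_ordinal_def is_transitive_def is_subset_def elts_def by auto

text \<open>The argument compares extensions \<open>elts\<close>, so it is valid in any structure
  and applies to the generic extension directly.\<close>

lemma is_pair_unique:
  assumes "is_pair N x y z" "is_pair N x' y' z" "x \<in> Univ N" "y \<in> Univ N" "x' \<in> Univ N" "y' \<in> Univ N"
  shows "x = x' \<and> y = y'"
proof -
  obtain u v where uv: "u \<in> Univ N" "v \<in> Univ N" "elts N u = {x}" "elts N v = {x, y}" "elts N z = {u, v}"
    using assms unfolding is_pair_def by (auto simp: is_upair_elts)
  obtain u' v' where uv': "elts N u' = {x'}" "elts N v' = {x', y'}" "elts N z = {u', v'}"
    using assms unfolding is_pair_def by (auto simp: is_upair_elts)
  have "elts N ` {u, v} = elts N ` {u', v'}" using uv uv' by simp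
  then have "{{x}, {x, y}} = {{x'}, {x', y'}}" using uv uv' by simp
  then show ?thesis by (auto simp: doubleton_eq_iff)
qed

lemma related_elts: "related N r x y \<longleftrightarrow> (\<exists>z\<in>elts N r. is_pair N x y z)"
  unfolding related_def elts_def by auto

lemma is_bijection_imp_cofinal: "is_bijection N f a k \<Longrightarrow> is_cofinal_map N f a k"
  unfolding is_bijection_def is_injection_def is_cofinal_map_def by blast

context zf
begin

lemma is_cofinal_map_iff:
  assumes "f \<in> U" "l \<in> U" "d \<in> U"
  shows "is_cofinal_map S f l d \<longleftrightarrow> is_function S f l d \<and> (\<forall>y\<in>E d. \<exists>x\<in>E l. y \<in> E (app f x) \<or> y = app f x)"
proof -
  have "(\<exists>x\<in>U. \<exists>z\<in>U. related S f x z \<and> (y \<epsilon>\<^bsub>S\<^esub> z \<or> y = z)) \<longleftrightarrow> (\<exists>x\<in>E l. y \<in> E (app f x) \<or> y = app f x)"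
    if "is_function S f l d" "y \<in> U" for y
    unfolding eps_iff[OF that(2)] using is_function_app(1)[OF assms that(1)]
    by (metis E_in_U app_in_U)
  then show ?thesis unfolding is_cofinal_map_def ball_elts_iff by (auto simp del: bex_simps)
qed

lemma cofinal_map_graph:
  assumes "l \<in> U" "d \<in> U" "dfun1 S h" "h ` E l \<subseteq> E d" "\<And>y. y \<in> E d \<Longrightarrow> \<exists>x\<in>E l. y \<in> E (h x) \<or> y = h x"
  shows "is_cofinal_map S (graph l h) l d"
  using assms by (subst is_cofinal_map_iff) (auto simp: is_function_graph app_graph cong: bex_cong)

lemma is_cofinality_noE:
  assumes "is_cofinality S d l" "m \<in> E l" "f \<in> U" "is_cofinal_map S f m d"
  shows False
  using assms E_in_U[OF assms(2)] eps_iff[of m l] unfolding is_cofinality_def by blast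

end

context generic_zf
begin

section \<open>Absoluteness between the ground model and the extension\<close>

lemma j_in_elts_iff [simp]: "b \<in> U \<Longrightarrow> c \<in> U \<Longrightarrow> j b \<in> elts M (j c) \<longleftrightarrow> b \<in> E c"
  by (auto simp: elts_j image_iff)

text \<open>The elements of \<open>j a\<close> are the images of the elements of a, so a notion with
  bounded quantifiers transfers.\<close>

lemma is_ordinal_j: "Ord a \<Longrightarrow> is_ordinal M (j a)"
proof -
  assume a: "Ord a"
  show ?thesis unfolding is_ordinal_elts
  proof (intro conjI ballI)
    fix y assume "y \<in> elts M (j a)"
    then obtain b where b: "b \<in> E a" "y = j b" using a by (auto simp: elts_j)
    then show "elts M y \<subseteq> elts M (j a)" using a Ord_trans[OF a b(1)] by (auto simp: elts_j)
    fix z assume "z \<in> elts M (j a)"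
    then obtain c where c: "c \<in> E a" "z = j c" using a by (auto simp: elts_j)
    have "b \<in> E c \<or> b = c \<or> c \<in> E b" using Ord_linear Ord_elt a b c by blast
    then show "y \<in> elts M z \<or> y = z \<or> z \<in> elts M y" using b c by auto
  qed
qed

lemma bex_elts: "(\<exists>y\<in>Univ N. y \<epsilon>\<^bsub>N\<^esub> x \<and> P y) \<longleftrightarrow> (\<exists>y\<in>elts N x. P y)"
  and ball_elts: "(\<forall>y\<in>Univ N. y \<epsilon>\<^bsub>N\<^esub> x \<longrightarrow> P y) \<longleftrightarrow> (\<forall>y\<in>elts N x. P y)"
  for N :: "'b set_structure"
  by (auto simp: elts_def)

lemma eps_M_iff: "X \<in> Univ M \<Longrightarrow> X \<epsilon>\<^bsub>M\<^esub> Y \<longleftrightarrow> X \<in> elts M Y"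
  by (simp add: elts_def)

lemma is_limit_j: "Ord a \<Longrightarrow> is_limit M (j a) \<longleftrightarrow> Lim a"
proof -
  assume a: "Ord a"
  have "(\<exists>y\<in>Univ M. y \<epsilon>\<^bsub>M\<^esub> j a) \<longleftrightarrow> E a \<noteq> {}"
    using bex_elts[of M "j a" "\<lambda>_. True"] a by (auto simp: elts_j)
  moreover have "(\<forall>y\<in>Univ M. y \<epsilon>\<^bsub>M\<^esub> j a \<longrightarrow> (\<exists>z\<in>Univ M. z \<epsilon>\<^bsub>M\<^esub> j a \<and> y \<epsilon>\<^bsub>M\<^esub> z)) \<longleftrightarrow>
    (\<forall>y\<in>E a. \<exists>z\<in>E a. y \<in> E z)"
    unfolding ball_elts bex_elts using a
    by (simp add: elts_j eps_M_iff cong: ball_cong bex_cong) (auto simp: elts_j[symmetric])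
  ultimately show ?thesis unfolding is_limit_def Lim_def using a is_ordinal_j by simp
qed

lemma is_omega_j: "is_omega M (j om)"
proof -
  have "\<not> is_limit M x" if "x \<in> elts M (j om)" for x
    using that by (auto simp: elts_j E_om is_limit_j Nat_def simp del: Nat_Ord)
  then show ?thesis unfolding is_omega_def using is_limit_j[of om]
    by (simp add: ball_elts)
qed

lemma is_pair_j: "x \<in> U \<Longrightarrow> y \<in> U \<Longrightarrow> is_pair M (j x) (j y) (j (pr x y))"
  unfolding is_pair_def
  by (intro bexI[of _ "j (mk {x})"] bexI[of _ "j (mk {x, y})"] conjI)
    (auto simp: is_upair_elts elts_j E_pr)

text \<open>Coming back from the extension, the member of \<open>j f\<close> that is a pair there
  must stem from a pair of the ground model before its components can be compared; this is what the
  last premise provides.\<close>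

lemma related_j:
  assumes "f \<in> U" "x \<in> U" "y \<in> U" "\<And>z. z \<in> E f \<Longrightarrow> \<exists>x\<in>U. \<exists>y\<in>U. z = pr x y"
  shows "related M (j f) (j x) (j y) \<longleftrightarrow> related S f x y"
proof
  assume "related M (j f) (j x) (j y)"
  then obtain z where z: "z \<in> E f" "is_pair M (j x) (j y) (j z)"
    using assms(1) by (auto simp: related_elts elts_j)
  then obtain x' y' where xy: "x' \<in> U" "y' \<in> U" "z = pr x' y'" using assms(4) by blast
  have "j x = j x' \<and> j y = j y'"
    by (rule is_pair_unique[OF z(2)]) (use xy is_pair_j in auto)
  then show "related S f x y" using z xy assms by (simp add: related_iff)
next
  assume "related S f x y"
  then have "pr x y \<in> E f" using assms by (simp add: related_iff)
  then show "related M (j f) (j x) (j y)"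
    unfolding related_elts using assms is_pair_j by (intro bexI[of _ "j (pr x y)"]) auto
qed

text \<open>A function between ground model sets has its arguments and values in the range of
  \<open>j\<close>; this confines later reasoning to ground model elements.\<close>

lemma related_jE:
  assumes "is_function M f (j a) (j b)" "related M f X Y" "a \<in> U" "b \<in> U" "X \<in> Univ M" "Y \<in> Univ M"
  shows "\<exists>x\<in>E a. \<exists>y\<in>E b. X = j x \<and> Y = j y"
proof -
  obtain z where z: "z \<in> elts M f" "is_pair M X Y z" using assms(2) by (auto simp: related_elts)
  then obtain X' Y' where XY: "X' \<in> elts M (j a)" "Y' \<in> elts M (j b)" "is_pair M X' Y' z"
    using assms(1) unfolding is_function_def ball_elts by (auto simp: eps_M_iff)
  then obtain x y where xy: "x \<in> E a" "y \<in> E b" "is_pair M (j x) (j y) z"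
    using assms(3,4) by (auto simp: elts_j)
  have "X = j x \<and> Y = j y" by (rule is_pair_unique[OF z(2) xy(3)]) (use assms in auto)
  then show ?thesis using xy by blast
qed

lemma is_function_j:
  assumes f: "f \<in> U" "a \<in> U" "b \<in> U" "is_function S f a b"
  shows "is_function M (j f) (j a) (j b)"
proof -
  have 1: "\<exists>x\<in>E a. \<exists>y\<in>E b. z = pr x y" if "z \<in> E f" for z
    using that f(4) is_function_iff[OF f(1-3)] by blast
  have rel: "related M (j f) (j x) (j y) \<longleftrightarrow> x \<in> E a \<and> y = app f x" if "x \<in> U" "y \<in> U" for x y
  proof -
    have "related M (j f) (j x) (j y) \<longleftrightarrow> related S f x y"
      by (rule related_j[OF f(1) that]) (use 1 E_in_U in meson)
    then show ?thesis using is_function_app(1)[OF f that] by simp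
  qed
  have "\<exists>x\<in>Univ M. \<exists>y\<in>Univ M. x \<epsilon>\<^bsub>M\<^esub> j a \<and> y \<epsilon>\<^bsub>M\<^esub> j b \<and> is_pair M x y Z" if "Z \<in> elts M (j f)" for Z
  proof -
    have "Z \<in> j ` E f" using that f(1) by (simp add: elts_j)
    then obtain z where z: "z \<in> E f" "Z = j z" by blast
    then obtain x y where "x \<in> E a" "y \<in> E b" "z = pr x y" using 1 by blast
    then show ?thesis using z f is_pair_j[of x y]
      by (intro bexI[of _ "j x"] bexI[of _ "j y"]) (auto simp: eps_M_iff)
  qed
  moreover have "\<exists>!Y. Y \<in> Univ M \<and> related M (j f) X Y" if X: "X \<in> elts M (j a)" for X
  proof -
    obtain x where x: "x \<in> E a" "X = j x" using X f by (auto simp: elts_j)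
    show ?thesis
    proof (rule ex1I[of _ "j (app f x)"])
      show "j (app f x) \<in> Univ M \<and> related M (j f) X (j (app f x))" using x rel by auto
      fix Y assume Y: "Y \<in> Univ M \<and> related M (j f) X Y"
      then obtain Z where Z: "Z \<in> elts M (j f)" "is_pair M X Y Z" by (auto simp: related_elts)
      then obtain z where z: "z \<in> E f" "Z = j z" using f by (auto simp: elts_j)
      then obtain x' y' where xy: "x' \<in> E a" "y' \<in> E b" "z = pr x' y'" using 1 by blast
      have "X = j x' \<and> Y = j y'"
        by (rule is_pair_unique[OF Z(2)]) (use xy x z Y is_pair_j in auto)
      moreover from this have "x = x'" using x xy by simp
      moreover have "y' = app f x'"
        using is_function_app(1)[OF f, of x' y'] xy z by (auto simp: related_iff)
      ultimately show "Y = j (app f x)" by simp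
    qed
  qed
  ultimately show ?thesis unfolding is_function_def ball_elts by blast
qed

lemma is_cofinal_map_j:
  assumes f: "f \<in> U" "l \<in> U" "d \<in> U" "is_cofinal_map S f l d"
  shows "is_cofinal_map M (j f) (j l) (j d)"
proof -
  have fn: "is_function S f l d" and cof: "\<And>y. y \<in> E d \<Longrightarrow> \<exists>x\<in>E l. y \<in> E (app f x) \<or> y = app f x"
    using f is_cofinal_map_iff by blast+
  have 1: "\<exists>x\<in>U. \<exists>y\<in>U. z = pr x y" if "z \<in> E f" for z
    using that fn is_function_iff[OF f(1-3)] E_in_U by meson
  have "\<exists>X\<in>Univ M. \<exists>Z\<in>Univ M. related M (j f) X Z \<and> (Y \<epsilon>\<^bsub>M\<^esub> Z \<or> Y = Z)" if "Y \<in> elts M (j d)" for Y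
  proof -
    have "Y \<in> j ` E d" using that f(3) by (simp add: elts_j)
    then obtain y where y: "y \<in> E d" "Y = j y" by blast
    obtain x where x: "x \<in> E l" "y \<in> E (app f x) \<or> y = app f x" using cof[OF y(1)] by blast
    have "related S f x (app f x)" using is_function_app(1)[OF f(1-3) fn, of x "app f x"] x by auto
    then have "related M (j f) (j x) (j (app f x))"
      using related_j[OF f(1) _ _ 1, of x "app f x"] x by auto
    then show ?thesis using x y by (intro bexI[of _ "j x"] bexI[of _ "j (app f x)"]) (auto simp: eps_M_iff)
  qed
  then show ?thesis using is_function_j[OF f(1-3) fn] unfolding is_cofinal_map_def ball_elts by blast
qed

text \<open>Totality and uniqueness of values are facts of this particular extension. They are not
  attached to any condition yet; each application finds a suitable member of \<open>G\<close> by
  density.\<close>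

lemma function_decided:
  assumes f: "f \<in> Univ M" and a: "a \<in> U" and b: "b \<in> U" and fn: "is_function M f (j a) (j b)"
  shows "\<exists>\<Phi>. dpred3 S \<Phi> \<and>
    (\<forall>p\<in>PP. \<forall>q\<in>PP. \<forall>x\<in>U. \<forall>y\<in>U. le q p \<longrightarrow> \<Phi> p x y \<longrightarrow> \<Phi> q x y) \<and>
    (\<forall>x\<in>U. \<forall>y\<in>U. related M f (j x) (j y) \<longleftrightarrow> (\<exists>p\<in>G. \<Phi> p x y)) \<and>
    (\<forall>x\<in>E a. \<exists>y\<in>E b. related M f (j x) (j y)) \<and>
    (\<forall>x\<in>E a. \<forall>y\<in>U. \<forall>y'\<in>U. related M f (j x) (j y) \<and> related M f (j x) (j y') \<longrightarrow> y = y')"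
proof -
  obtain t where t: "t \<in> U" "f = val t" using f by (auto simp: Univ_M)
  obtain \<Phi> where \<Phi>: "dpred3 S \<Phi>" "\<forall>p\<in>PP. \<forall>q\<in>PP. \<forall>x\<in>U. \<forall>y\<in>U. le q p \<longrightarrow> \<Phi> p x y \<longrightarrow> \<Phi> q x y"
    "\<forall>x\<in>U. \<forall>y\<in>U. related M f (j x) (j y) \<longleftrightarrow> (\<exists>p\<in>G. \<Phi> p x y)"
    using related_forcing[OF t(1)] unfolding t(2) by blast
  have ex1: "\<exists>!Y. Y \<in> Univ M \<and> related M f (j x) Y" if "x \<in> E a" for x
  proof -
    have "j x \<in> elts M (j a)" using that a by simp
    then show ?thesis using fn unfolding is_function_def ball_elts by blast
  qed
  have "\<exists>y\<in>E b. related M f (j x) (j y)" if x: "x \<in> E a" for x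
  proof -
    obtain Y where Y: "Y \<in> Univ M" "related M f (j x) Y" using ex1[OF x] by blast
    from related_jE[OF fn Y(2) a b j_in_M Y(1)] show ?thesis using Y by blast
  qed
  moreover have "y = y'" if "x \<in> E a" "y \<in> U" "y' \<in> U" "related M f (j x) (j y)" "related M f (j x) (j y')" for x y y'
  proof -
    have "j y = j y'" using ex1[OF that(1)] that(4,5) j_in_M by blast
    then show ?thesis using that by simp
  qed
  ultimately show ?thesis using \<Phi> by blast
qed

text \<open>
  By induction on \<open>k\<close>, densely many conditions either decide the values at all arguments below \<open>k\<close>
  or leave the value at one of them undecidable; the latter is impossible for members of \<open>G\<close>.
\<close>

lemma finite_function_bounded:
  assumes f: "f \<in> Univ M" and m: "Nat m" and d: "Lim d" and fn: "is_function M f (j m) (j d)"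
  shows "\<exists>b\<in>E d. \<forall>x\<in>E m. \<forall>y\<in>E d. related M f (j x) (j y) \<longrightarrow> y \<in> E b"
proof -
  have U: "m \<in> U" "d \<in> U" using m d by simp_all
  obtain \<Phi> where \<Phi>: "dpred3 S \<Phi>"
    and mono: "\<And>p q x y. p \<in> PP \<Longrightarrow> q \<in> PP \<Longrightarrow> x \<in> U \<Longrightarrow> y \<in> U \<Longrightarrow> le q p \<Longrightarrow> \<Phi> p x y \<Longrightarrow> \<Phi> q x y"
    and truth: "\<And>x y. x \<in> U \<Longrightarrow> y \<in> U \<Longrightarrow> related M f (j x) (j y) \<longleftrightarrow> (\<exists>p\<in>G. \<Phi> p x y)"
    and total: "\<And>x. x \<in> E m \<Longrightarrow> \<exists>y\<in>E d. related M f (j x) (j y)"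
    and single: "\<And>x y y'. x \<in> E m \<Longrightarrow> y \<in> U \<Longrightarrow> y' \<in> U \<Longrightarrow> related M f (j x) (j y) \<Longrightarrow>
      related M f (j x) (j y') \<Longrightarrow> y = y'"
    using function_decided[OF f U fn] by auto
  note [df] = dpred3D[OF \<Phi>]
  \<comment> \<open>Bad: some argument below k never receives a value in d, however q is extended.
    Good: all arguments below k have received values under a common bound.\<close>
  define bad where "bad k q \<longleftrightarrow> (\<exists>i\<in>E k. \<forall>r\<in>PP. le r q \<longrightarrow> (\<forall>y\<in>E d. \<not> \<Phi> r i y))" for k q
  define good where "good k q \<longleftrightarrow> (\<exists>b\<in>E d. \<forall>i\<in>E k. \<exists>y\<in>E b. \<Phi> q i y)" for k q
  have d2: "dpred2 S bad" "dpred2 S good"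
    unfolding dpred2_def bad_def good_def by (intro df; simp add: U)+
  note [df] = d2[THEN dpred2D]
  define P where "P k \<longleftrightarrow> (\<forall>p\<in>PP. \<exists>q\<in>PP. le q p \<and> (bad k q \<or> good k q))" for k
  have "P m"
  proof (rule Nat_induct_dpred[OF _ _ _ m])
    show "dpred1 S P" unfolding dpred1_def P_def by (intro df; simp)
    obtain b where "b \<in> E d" using d unfolding Lim_def by blast
    then have "good zero p" for p unfolding good_def by auto
    then show "P zero" unfolding P_def using le_refl by blast
    fix k assume k: "Nat k" and IH: "P k"
    have kU: "k \<in> U" using k by simp
    show "P (succ k)" unfolding P_def
    proof
      fix p assume p: "p \<in> PP"
      obtain q where q: "q \<in> PP" "le q p" "bad k q \<or> good k q" using IH p unfolding P_def by blast
      show "\<exists>q\<in>PP. le q p \<and> (bad (succ k) q \<or> good (succ k) q)"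
      proof (cases "bad k q")
        case True
        then have "bad (succ k) q" unfolding bad_def using kU by auto
        then show ?thesis using q by blast
      next
        case False
        then obtain b where b: "b \<in> E d" "\<forall>i\<in>E k. \<exists>y\<in>E b. \<Phi> q i y" using q unfolding good_def by blast
        show ?thesis
        proof (cases "\<exists>r\<in>PP. le r q \<and> (\<exists>y\<in>E d. \<Phi> r k y)")
          case True
          then obtain r y where r: "r \<in> PP" "le r q" "y \<in> E d" "\<Phi> r k y" by blast
          have Oby: "Ord b" "Ord y" using b r d Ord_elt Lim_Ord by blast+
          \<comment> \<open>Either the old bound b already exceeds the new value y, or
            \<open>succ y\<close> bounds all values; it is in d because d is a limit.\<close>
          obtain b' where b': "b' \<in> E d" "E b \<subseteq> E b'" "y \<in> E b'"
          proof (cases "y \<in> E b")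
            case False
            then have "E b \<subseteq> E y" using Ord_not_in_iff Oby by blast
            then have "E b \<subseteq> E (succ y)" "y \<in> E (succ y)" using Oby by auto
            then show thesis using Lim_succ[OF d r(3)] that by blast
          qed (use b that in blast)
          have "\<exists>y\<in>E b'. \<Phi> r i y" if "i \<in> E (succ k)" for i
          proof (cases "i = k")
            case False
            then have "i \<in> E k" using that kU by auto
            then obtain y where "y \<in> E b" "\<Phi> q i y" using b by blast
            then show ?thesis using mono[OF q(1) r(1) _ _ r(2)] that b'(2) E_in_U by blast
          qed (use r b' in blast)
          then have "good (succ k) r" using b' unfolding good_def by blast
          moreover have "le r p" using le_trans r q p by blast
          ultimately show ?thesis using r by blast
        next
          case False
          then have "bad (succ k) q" unfolding bad_def using kU by auto
          then show ?thesis using q by blast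
        qed
      qed
    qed
  qed
  have "dpred1 S (\<lambda>q. bad m q \<or> good m q)" unfolding dpred1_def by (intro df U)
  then have "\<exists>p\<in>G. bad m p \<or> good m p"
    by (rule G_meets) (use \<open>P m\<close> P_def in blast)
  then obtain p where p: "p \<in> G" "bad m p \<or> good m p" by blast
  \<comment> \<open>\<open>f\<close> does take a value at i, and a member of \<open>G\<close>
    forcing it has a common extension with p.\<close>
  have "\<not> bad m p"
  proof
    assume "bad m p"
    then obtain i where i: "i \<in> E m" "\<And>r y. r \<in> PP \<Longrightarrow> le r p \<Longrightarrow> y \<in> E d \<Longrightarrow> \<not> \<Phi> r i y"
      unfolding bad_def by blast
    obtain y where y: "y \<in> E d" "related M f (j i) (j y)" using total[OF i(1)] by blast
    have iU: "i \<in> U" "y \<in> U" using E_in_U[OF i(1)] E_in_U[OF y(1)] by blast+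
    then obtain p' where p': "p' \<in> G" "\<Phi> p' i y" using truth y by blast
    obtain r where r: "r \<in> G" "le r p" "le r p'" using G_dir[OF p(1) p'(1)] by blast
    have "\<Phi> r i y" using mono[of p' r i y] p' r iU G_PP by blast
    then show False using i(2) r y G_PP by blast
  qed
  then obtain b where b: "b \<in> E d" "\<And>i. i \<in> E m \<Longrightarrow> \<exists>y\<in>E b. \<Phi> p i y" using p unfolding good_def by blast
  have "y \<in> E b" if xy: "x \<in> E m" "y \<in> E d" "related M f (j x) (j y)" for x y
  proof -
    obtain y' where y': "y' \<in> E b" "\<Phi> p x y'" using b(2)[OF xy(1)] by blast
    then have "related M f (j x) (j y')" using truth[of x y'] p(1) xy by auto
    then have "y' = y" using single[OF xy(1), of y' y] xy y' by auto
    then show ?thesis using y' by simp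
  qed
  then show ?thesis using b by blast
qed

end

locale ccc_zf = generic_zf +
  assumes ccc: "CCC3 S F"
begin

lemma predense_iff: "predense S F D \<longleftrightarrow> E D \<subseteq> PP \<and> (\<forall>p\<in>PP. \<exists>d\<in>E D. \<exists>r\<in>PP. le r p \<and> le r d)"
  unfolding predense_def compatible_def is_subset_iff conds_eq le_def[symmetric] by (simp add: bex_elts)

theorem countable_values:
  assumes f: "f \<in> Univ M" and a: "a \<in> U" and b: "b \<in> U" and fn: "is_function M f (j a) (j b)"
  shows "\<exists>X. dpred2 S X \<and> (\<forall>x\<in>E a. \<forall>y\<in>E b. related M f (j x) (j y) \<longrightarrow> X x y) \<and>
    (\<forall>x\<in>E a. \<exists>h. dfun1 S h \<and> (\<forall>y\<in>E b. X x y \<longrightarrow> y \<in> h ` E om))"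
proof -
  obtain \<Phi> where \<Phi>: "dpred3 S \<Phi>"
    and mono: "\<And>p q x y. p \<in> PP \<Longrightarrow> q \<in> PP \<Longrightarrow> x \<in> U \<Longrightarrow> y \<in> U \<Longrightarrow> le q p \<Longrightarrow> \<Phi> p x y \<Longrightarrow> \<Phi> q x y"
    and truth: "\<And>x y. x \<in> U \<Longrightarrow> y \<in> U \<Longrightarrow> related M f (j x) (j y) \<longleftrightarrow> (\<exists>p\<in>G. \<Phi> p x y)"
    and single: "\<And>x y y'. x \<in> E a \<Longrightarrow> y \<in> U \<Longrightarrow> y' \<in> U \<Longrightarrow> related M f (j x) (j y) \<Longrightarrow>
      related M f (j x) (j y') \<Longrightarrow> y = y'"
    using function_decided[OF f a b fn] by auto
  note [df] = dpred3D[OF \<Phi>]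
  \<comment> \<open>\<open>bad q\<close> says that q decides two different values at one argument.
    As \<open>f\<close> is a function, no member of \<open>G\<close> is bad, so genericity yields a
    \<open>p0\<close> in \<open>G\<close> without bad extensions; it does the work of a condition
    forcing \<open>f\<close> to be single valued.\<close>
  define bad where "bad q \<longleftrightarrow> (\<exists>x\<in>E a. \<exists>y\<in>E b. \<exists>y'\<in>E b. y \<noteq> y' \<and> \<Phi> q x y \<and> \<Phi> q x y')" for q
  have "dpred1 S bad" unfolding dpred1_def bad_def by (intro df; simp add: a b)
  note [df] = dpred1D[OF this]
  have "dpred1 S (\<lambda>q. bad q \<or> (\<forall>r\<in>PP. le r q \<longrightarrow> \<not> bad r))" unfolding dpred1_def by (intro df; simp)
  then have "\<exists>p\<in>G. bad p \<or> (\<forall>r\<in>PP. le r p \<longrightarrow> \<not> bad r)" by (rule G_meets) (use le_refl in blast)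
  then obtain p0 where p0: "p0 \<in> G" "bad p0 \<or> (\<forall>r\<in>PP. le r p0 \<longrightarrow> \<not> bad r)" by blast
  have "\<not> bad p0"
  proof
    assume "bad p0"
    then obtain x y y' where "x \<in> E a" "y \<in> E b" "y' \<in> E b" "y \<noteq> y'" "\<Phi> p0 x y" "\<Phi> p0 x y'"
      unfolding bad_def by blast
    moreover from this have "related M f (j x) (j y)" "related M f (j x) (j y')"
      using truth p0(1) E_in_U by blast+
    ultimately show False using single E_in_U by blast
  qed
  then have unique: "y = y'"
    if "r \<in> PP" "le r p0" "x \<in> E a" "y \<in> E b" "y' \<in> E b" "\<Phi> r x y" "\<Phi> r x y'" for r x y y'
    using p0(2) that unfolding bad_def by blast
  have p0P: "p0 \<in> PP" using p0 by simp
  define X where "X x y \<longleftrightarrow> (\<exists>q\<in>PP. le q p0 \<and> \<Phi> q x y)" for x y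
  have dX: "dpred2 S X" unfolding dpred2_def X_def by (intro df; use p0P in simp)
  have "X x y" if xyR: "x \<in> E a" "y \<in> E b" "related M f (j x) (j y)" for x y
  proof -
    have xy: "x \<in> U" "y \<in> U" using xyR by auto
    obtain p where p: "p \<in> G" "\<Phi> p x y" using truth[OF xy] xyR(3) by blast
    obtain r where r: "r \<in> G" "le r p" "le r p0" using G_dir p p0 by blast
    have "\<Phi> r x y" using mono[of p r x y] p r xy G_PP by blast
    then show ?thesis unfolding X_def using r G_PP by blast
  qed
  moreover have "\<exists>h. dfun1 S h \<and> (\<forall>y\<in>E b. X x y \<longrightarrow> y \<in> h ` E om)" if x: "x \<in> E a" for x
  proof -
    have xU: "x \<in> U" using x by auto
    define dec where "dec q \<longleftrightarrow> le q p0 \<and> (\<exists>y\<in>E b. \<Phi> q x y)" for q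
    have "dpred1 S dec" unfolding dpred1_def dec_def by (intro df; use p0P b xU in simp)
    note [df] = dpred1D[OF this]
    let ?D = "{q \<in> PP. dec q \<or> (\<forall>r\<in>PP. le r q \<longrightarrow> \<not> dec r)}"
    have "isset ?D" by (rule isset_Collect_elts, simp, unfold dpred1_def, intro df, simp)
    then have ED: "E (mk ?D) = ?D" by (rule E_mk)
    have "predense S F (mk ?D)" unfolding predense_iff ED using le_refl by blast
    from ccc[unfolded CCC3_def is_subset_iff, rule_format, OF mk_in_U this]
    obtain C where C: "C \<in> U" "E C \<subseteq> ?D" "is_countable S C" "predense S F C"
      unfolding ED by blast
    then obtain i where i: "i \<in> U" "is_injection S i C om"
      unfolding is_countable_def using is_omega_iff by blast
    then have ifn: "is_function S i C om" by (simp add: is_injection_def)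
    note iapp = is_function_app[OF i(1) C(1) om_in_U ifn]
    have inj: "q = q'" if "q \<in> E C" "q' \<in> E C" "app i q = app i q'" for q q'
    proof -
      have "related S i q (app i q)" "related S i q' (app i q)" using iapp that by simp_all
      then show ?thesis using i(2) that unfolding is_injection_def by (meson E_in_U app_in_U)
    qed
    \<comment> \<open>By injectivity of \<open>i\<close> an index belongs to at most one member of
      \<open>C\<close>, and such a member below \<open>p0\<close> decides at most one value at x.
      Where it decides none, the default of \<open>the_in\<close> does no harm, since only a
      superset of the possible values is wanted.\<close>
    define h where "h n = the_in S (\<lambda>y. y \<in> E b \<and> (\<exists>q\<in>E C. app i q = n \<and> le q p0 \<and> \<Phi> q x y))" for n
    have "dfun1 S h" unfolding dfun1_def h_def by (intro df; use p0P b xU C i in simp)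
    moreover have "y \<in> h ` E om" if y: "y \<in> E b" "X x y" for y
    proof -
      have yU: "y \<in> U" using y by auto
      obtain q where q: "q \<in> PP" "le q p0" "\<Phi> q x y" using y(2) unfolding X_def by blast
      obtain c r where c: "c \<in> E C" "r \<in> PP" "le r q" "le r c"
        using C(4) q(1) unfolding predense_iff by blast
      have cP: "c \<in> PP" using c C by blast
      have r: "\<Phi> r x y" "le r p0" using mono[of q r x y] le_trans[of r q p0] c q xU yU p0P by auto
      \<comment> \<open>The common extension r decides the value at x, so c cannot be of the
        undecided kind. The value that c decides is inherited by r and must therefore equal
        y.\<close>
      then have "dec r" using y(1) unfolding dec_def by blast
      then have "dec c" using C(2) c by blast
      then obtain y' where y': "le c p0" "y' \<in> E b" "\<Phi> c x y'" unfolding dec_def by blast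
      have "\<Phi> r x y'" using mono[of c r x y'] y' c xU cP E_in_U by blast
      then have "y' = y" using unique r c x y' y by blast
      then have cy: "\<Phi> c x y" using y' by simp
      have "h (app i c) = y" unfolding h_def
      proof (rule the_in_eq)
        show "y \<in> E b \<and> (\<exists>q\<in>E C. app i q = app i c \<and> le q p0 \<and> \<Phi> q x y)" using y c y' cy by blast
        fix z assume "z \<in> E b \<and> (\<exists>q\<in>E C. app i q = app i c \<and> le q p0 \<and> \<Phi> q x z)"
        then have "z \<in> E b" "\<Phi> c x z" using inj c(1) by blast+
        then show "z = y" using unique[OF cP y'(1) x] y cy by blast
      qed (use yU in simp)
      moreover have "app i c \<in> E om" using iapp(2)[of c c] c by auto
      ultimately show ?thesis by blast
    qed
    ultimately show ?thesis by blast
  qed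
  ultimately show ?thesis using dX by blast
qed

theorem no_new_cofinal_map:
  assumes d: "Lim d" and cf: "is_cofinality S d l" and l: "Ord l" and m: "m \<in> E l" and f: "f \<in> Univ M"
  shows "\<not> is_cofinal_map M f (j m) (j d)"
proof
  assume cof: "is_cofinal_map M f (j m) (j d)"
  then have fn: "is_function M f (j m) (j d)" by (simp add: is_cofinal_map_def)
  have U: "m \<in> U" "d \<in> U" using m d by auto
  have Od: "Ord d" using d by simp
  have cofd: "\<exists>x\<in>E m. \<exists>z\<in>E d. related M f (j x) (j z) \<and> (y \<in> E z \<or> y = z)" if y: "y \<in> E d" for y
  proof -
    have "j y \<in> elts M (j d)" using y U by simp
    then obtain X Z where XZ: "X \<in> Univ M" "Z \<in> Univ M" "related M f X Z" "j y \<epsilon>\<^bsub>M\<^esub> Z \<or> j y = Z"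
      using cof unfolding is_cofinal_map_def ball_elts by blast
    from related_jE[OF fn XZ(3) U XZ(1,2)] obtain x z where "x \<in> E m" "z \<in> E d" "X = j x" "Z = j z" by blast
    moreover from this have "y \<in> E z \<or> y = z" using XZ(4) y by (auto simp: eps_M_iff)
    ultimately show ?thesis using XZ(3) by blast
  qed
  show False
  proof (cases "Nat m")
    case True
    from finite_function_bounded[OF f True d fn] obtain b where
      b: "b \<in> E d" "\<And>x y. x \<in> E m \<Longrightarrow> y \<in> E d \<Longrightarrow> related M f (j x) (j y) \<Longrightarrow> y \<in> E b" by blast
    then show False using cofd[OF b(1)] mem_asym mem_irrefl by blast
  next
    case False
    have Om: "Ord m" using l m Ord_elt by blast
    have "om = m \<or> om \<in> E m" using Ord_linear[OF Ord_om Om] False E_om by blast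
    \<comment> \<open>With m infinite, omega lies strictly below the cofinality of d, which is what
      excludes a countable cofinal set.\<close>
    then have oml: "om \<in> E l" using Ord_trans[OF l m] m by blast
    obtain X where X: "dpred2 S X"
      and RX: "\<And>x y. x \<in> E m \<Longrightarrow> y \<in> E d \<Longrightarrow> related M f (j x) (j y) \<Longrightarrow> X x y"
      and Xc: "\<And>x. x \<in> E m \<Longrightarrow> \<exists>h. dfun1 S h \<and> (\<forall>y\<in>E d. X x y \<longrightarrow> y \<in> h ` E om)"
      using countable_values[OF f U fn] by blast
    note [df] = dpred2D[OF X]
    define bound where "bound x b \<longleftrightarrow> b \<in> E d \<and> (\<forall>y\<in>E d. X x y \<longrightarrow> y \<in> E b)" for x b
    have "dpred2 S bound" unfolding dpred2_def bound_def by (intro df; simp add: U)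
    note [df] = dpred2D[OF this]
    have bounded: "\<exists>b. bound x b" if x: "x \<in> E m" for x
    proof (rule ccontr)
      assume nb: "\<nexists>b. bound x b"
      obtain h where h: "dfun1 S h" "\<And>y. y \<in> E d \<Longrightarrow> X x y \<Longrightarrow> y \<in> h ` E om" using Xc[OF x] by blast
      obtain d0 where d0: "d0 \<in> E d" using d unfolding Lim_def by blast
      \<comment> \<open>\<open>h\<close> covers the possible values but may also leave d, so stray
        values are replaced by a default element of d. Without a bound for the values at x, this
        would be a cofinal map of length omega.\<close>
      define g where "g n = (if h n \<in> E d then h n else d0)" for n
      have dg: "dfun1 S g" unfolding dfun1_def g_def
        by (intro df dfun1D[OF h(1)]; use U d0 in simp)
      have "is_cofinal_map S (graph om g) om d"
      proof (rule cofinal_map_graph[OF om_in_U U(2) dg])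
        show "g ` E om \<subseteq> E d" using d0 by (auto simp: g_def)
        fix y assume y: "y \<in> E d"
        then have "\<not> bound x y" using nb by blast
        then obtain z where z: "z \<in> E d" "X x z" "z \<notin> E y" using y unfolding bound_def by blast
        have "y \<in> E z \<or> y = z" using Ord_linear[of y z] z y Ord_elt[OF Od] by blast
        moreover obtain n where "n \<in> E om" "h n = z" using h(2) z by blast
        moreover from this have "g n = z" using z by (simp add: g_def)
        ultimately show "\<exists>n\<in>E om. y \<in> E (g n) \<or> y = g n" by metis
      qed
      then show False using is_cofinality_noE[OF cf oml graph_in_U] by blast
    qed
    \<comment> \<open>The least bound spares a choice of bounds and makes the map definable in the
      ground model.\<close>
    define \<nu> where "\<nu> x = the_in S (\<lambda>b. bound x b \<and> (\<forall>c\<in>E b. \<not> bound x c))" for x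
    have d\<nu>: "dfun1 S \<nu>" unfolding dfun1_def \<nu>_def by (intro df)
    have \<nu>: "bound x (\<nu> x)" if x: "x \<in> E m" for x
    proof -
      have xU: "x \<in> U" using x by auto
      obtain b where b: "bound x b" using bounded[OF x] by blast
      then have "Ord b" using Ord_elt[OF Od] by (auto simp: bound_def)
      have "dpred1 S (bound x)" unfolding dpred1_def by (intro df xU)
      from Ord_least[OF this \<open>Ord b\<close> b] obtain c where
        c: "Ord c" "bound x c" "\<forall>y\<in>E c. \<not> bound x y" by blast
      have "\<nu> x = c" unfolding \<nu>_def
      proof (rule the_in_eq)
        fix y assume y: "bound x y \<and> (\<forall>c\<in>E y. \<not> bound x c)"
        then have "Ord y" using Ord_elt[OF Od] by (auto simp: bound_def)
        then show "y = c" using Ord_linear[OF _ c(1)] y c by blast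
      qed (use c in auto)
      then show ?thesis using c by simp
    qed
    have "is_cofinal_map S (graph m \<nu>) m d"
    proof (rule cofinal_map_graph[OF U d\<nu>])
      show "\<nu> ` E m \<subseteq> E d" using \<nu> by (auto simp: bound_def)
      fix y assume y: "y \<in> E d"
      obtain x z where xz: "x \<in> E m" "z \<in> E d" "related M f (j x) (j z)" "y \<in> E z \<or> y = z"
        using cofd[OF y] by blast
      have "z \<in> E (\<nu> x)" using \<nu>[OF xz(1)] RX[OF xz(1-3)] xz(2) by (auto simp: bound_def)
      moreover have "Ord (\<nu> x)" using \<nu>[OF xz(1)] Ord_elt[OF Od] by (auto simp: bound_def)
      ultimately have "y \<in> E (\<nu> x)" using xz(4) Ord_trans by blast
      then show "\<exists>x\<in>E m. y \<in> E (\<nu> x) \<or> y = \<nu> x" using xz(1) by blast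
    qed
    then show False using is_cofinality_noE[OF cf m graph_in_U] by blast
  qed
qed

theorem cofinality_preserved:
  assumes d: "d \<in> U" "is_limit S d" and l: "l \<in> U" and cf: "is_cofinality S d l"
  shows "is_cofinality M (j d) (j l)"
proof -
  have Ld: "Lim d" using d is_limit_iff by simp
  have Ol: "Ord l" using cf l is_ordinal_iff unfolding is_cofinality_def by blast
  obtain f where f: "f \<in> U" "is_cofinal_map S f l d" using cf unfolding is_cofinality_def by blast
  have "\<exists>g\<in>Univ M. is_cofinal_map M g (j l) (j d)"
    using is_cofinal_map_j[OF f(1) l d(1) f(2)] j_in_M by (rule bexI)
  moreover have "\<not> is_cofinal_map M g X (j d)" if "X \<in> elts M (j l)" "g \<in> Univ M" for X g
    using that no_new_cofinal_map[OF Ld cf Ol] l by (auto simp: elts_j)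
  then have "\<not> (\<exists>X\<in>Univ M. \<exists>g\<in>Univ M. X \<epsilon>\<^bsub>M\<^esub> j l \<and> is_cofinal_map M g X (j d))"
    by (auto simp: eps_M_iff)
  ultimately show ?thesis unfolding is_cofinality_def using is_ordinal_j[OF Ol] by blast
qed

text \<open>Being an ordinal and reaching omega are absolute. Only the absence of bijections could
  fail in the extension, and every element of \<open>j k\<close> is some \<open>j m\<close>.\<close>

lemma is_aleph_j:
  assumes "Ord k" "om = k \<or> om \<in> E k"
    and no: "\<And>m f. m \<in> E k \<Longrightarrow> f \<in> Univ M \<Longrightarrow> \<not> is_bijection M f (j m) (j k)"
  shows "is_aleph M (j k)"
proof -
  have "\<exists>w\<in>Univ M. is_omega M w \<and> (w = j k \<or> w \<epsilon>\<^bsub>M\<^esub> j k)"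
    using assms(1,2) is_omega_j by (intro bexI[of _ "j om"]) (auto simp: eps_M_iff)
  moreover have "\<not> is_bijection M f X (j k)" if "X \<in> elts M (j k)" "f \<in> Univ M" for X f
    using that assms(1) no by (auto simp: elts_j)
  then have "\<not> (\<exists>X\<in>Univ M. \<exists>f\<in>Univ M. X \<epsilon>\<^bsub>M\<^esub> j k \<and> is_bijection M f X (j k))"
    by (auto simp: eps_M_iff)
  ultimately show ?thesis unfolding is_aleph_def using is_ordinal_j[OF assms(1)] by blast
qed

text \<open>A function with finite domain is bounded in omega, so it misses its own bound.\<close>

lemma is_aleph_j_om: "is_aleph M (j om)"
proof (rule is_aleph_j)
  fix m f assume m: "m \<in> E om" and f: "f \<in> Univ M"
  show "\<not> is_bijection M f (j m) (j om)"
  proof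
    assume bij: "is_bijection M f (j m) (j om)"
    then have fn: "is_function M f (j m) (j om)" by (simp add: is_bijection_def is_injection_def)
    have m': "Nat m" using m by (simp add: E_om)
    from finite_function_bounded[OF f m' Lim_om fn] obtain b where
      b: "b \<in> E om" "\<And>x y. x \<in> E m \<Longrightarrow> y \<in> E om \<Longrightarrow> related M f (j x) (j y) \<Longrightarrow> y \<in> E b" by blast
    have "j b \<in> elts M (j om)" using b by simp
    then obtain X where X: "X \<in> Univ M" "related M f X (j b)"
      using bij unfolding is_bijection_def ball_elts by blast
    from related_jE[OF fn X(2) _ _ X(1)] m obtain x where "x \<in> E m" "X = j x" by auto
    then show False using b X mem_irrefl by blast
  qed
qed auto

text \<open>A bijection from a smaller ordinal is a cofinal map, which is excluded once the ground
  model cofinality of k is k itself.\<close>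

lemma is_aleph_j_regular:
  assumes "Lim k" "om = k \<or> om \<in> E k" "is_cofinality S k k"
  shows "is_aleph M (j k)"
proof (rule is_aleph_j[OF _ assms(2)])
  show "\<not> is_bijection M f (j m) (j k)" if "m \<in> E k" "f \<in> Univ M" for m f
    using no_new_cofinal_map[OF assms(1,3) Lim_Ord[OF assms(1)] that]
      is_bijection_imp_cofinal[of M f "j m" "j k"] by blast
qed (use assms in simp)

end

section \<open>Cardinal arithmetic inside a model\<close>

context zf
begin

text \<open>A canonical selection among ordinals that takes the place of choice and is definable
  along with \<open>P\<close>.\<close>

definition least_ord :: "('a \<Rightarrow> bool) \<Rightarrow> 'a" where
  "least_ord P = the_in S (\<lambda>b. Ord b \<and> P b \<and> (\<forall>c\<in>E b. \<not> P c))"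

lemma least_ord:
  assumes "dpred1 S P" "Ord a" "P a"
  shows "Ord (least_ord P)" "P (least_ord P)"
proof -
  obtain m where m: "Ord m" "P m" "\<forall>c\<in>E m. \<not> P c" using Ord_least[OF assms] by blast
  have "least_ord P = m" unfolding least_ord_def
  proof (rule the_in_eq)
    fix y assume "Ord y \<and> P y \<and> (\<forall>c\<in>E y. \<not> P c)"
    then show "y = m" using Ord_linear[of y m] m by blast
  qed (use m in auto)
  then show "Ord (least_ord P)" "P (least_ord P)" using m by auto
qed

lemma dterm_least_ord [df]:
  assumes "definable S (\<lambda>e. P (vt e) (vh e))"
  shows "dterm S (\<lambda>e. least_ord (P e))"
proof -
  have P: "definable S (\<lambda>e. P (vt (vt e)) (vh e))"
    using definable_inst[OF assms, of "\<lambda>n. if n = 0 then Inl 0 else Inl (Suc n)"]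
    by (simp add: inst_def params_in_def vh_def vt_def)
  show ?thesis unfolding least_ord_def by (intro df assms P)
qed

definition inv_in :: "'a \<Rightarrow> ('a \<Rightarrow> 'a) \<Rightarrow> 'a \<Rightarrow> 'a" where
  "inv_in a h v = the_in S (\<lambda>x. x \<in> E a \<and> h x = v)"

lemma inv_in_eq: "inj_on h (E a) \<Longrightarrow> x \<in> E a \<Longrightarrow> inv_in a h (h x) = x"
  unfolding inv_in_def by (rule the_in_eq) (auto dest: inj_onD)

lemma dfun_inv_in: "a \<in> U \<Longrightarrow> dfun1 S h \<Longrightarrow> dfun1 S (inv_in a h)"
  unfolding dfun1_def inv_in_def by (intro df dfun1D[of S h]) (auto simp: dfun1_def)

definition pfst :: "'a \<Rightarrow> 'a" where "pfst z = the_in S (\<lambda>x. \<exists>y\<in>U. z = pr x y)"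
definition psnd :: "'a \<Rightarrow> 'a" where "psnd z = the_in S (\<lambda>y. \<exists>x\<in>U. z = pr x y)"

lemma pfst_pr [simp]: "x \<in> U \<Longrightarrow> y \<in> U \<Longrightarrow> pfst (pr x y) = x"
  and psnd_pr [simp]: "x \<in> U \<Longrightarrow> y \<in> U \<Longrightarrow> psnd (pr x y) = y"
  unfolding pfst_def psnd_def by (rule the_in_eq; auto)+

lemma dterm_pfst [df]: "dterm S a \<Longrightarrow> dterm S (\<lambda>e. pfst (a e))"
  by (rule dfun1D[where h = pfst]) (unfold dfun1_def pfst_def, intro df)

lemma dterm_psnd [df]: "dterm S a \<Longrightarrow> dterm S (\<lambda>e. psnd (a e))"
  by (rule dfun1D[where h = psnd]) (unfold dfun1_def psnd_def, intro df)

lemma in_cartE: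
  assumes "z \<in> E (cart a b)" "a \<in> U" "b \<in> U"
  shows "pfst z \<in> E a" "psnd z \<in> E b" "z = pr (pfst z) (psnd z)"
proof -
  obtain x y where "x \<in> E a" "y \<in> E b" "z = pr x y" using assms by (auto simp: E_cart)
  moreover from this have "x \<in> U" "y \<in> U" by auto
  ultimately show "pfst z \<in> E a" "psnd z \<in> E b" "z = pr (pfst z) (psnd z)" by simp_all
qed

text \<open>Working with definable HOL functions keeps compositions simple; by
  \<open>emb_iff_injection\<close> they amount to injections of the model.\<close>

definition emb :: "'a \<Rightarrow> 'a \<Rightarrow> bool" where
  "emb a b \<longleftrightarrow> (\<exists>h. dfun1 S h \<and> h ` E a \<subseteq> E b \<and> inj_on h (E a))"

lemma embI: "dfun1 S h \<Longrightarrow> (\<And>x. x \<in> E a \<Longrightarrow> h x \<in> E b) \<Longrightarrow>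
    (\<And>x y. x \<in> E a \<Longrightarrow> y \<in> E a \<Longrightarrow> h x = h y \<Longrightarrow> x = y) \<Longrightarrow> emb a b"
  unfolding emb_def inj_on_def by blast

lemma emb_trans: "emb a b \<Longrightarrow> emb b c \<Longrightarrow> emb a c"
proof -
  assume "emb a b" "emb b c"
  then obtain g h where g: "dfun1 S g" "g ` E a \<subseteq> E b" "inj_on g (E a)"
    and h: "dfun1 S h" "h ` E b \<subseteq> E c" "inj_on h (E b)" unfolding emb_def by blast
  show ?thesis
  proof (rule embI)
    show "dfun1 S (\<lambda>x. h (g x))"
      unfolding dfun1_def by (intro df dfun1D[OF g(1)] dfun1D[OF h(1)])
    show "h (g x) \<in> E c" if "x \<in> E a" for x using that g h by blast
    show "x = y" if "x \<in> E a" "y \<in> E a" "h (g x) = h (g y)" for x y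
    proof -
      have "g x = g y" by (rule inj_onD[OF h(3) that(3)]) (use that g(2) in blast)+
      then show ?thesis using inj_onD[OF g(3)] that by blast
    qed
  qed
qed

lemma emb_subset: "E a \<subseteq> E b \<Longrightarrow> emb a b"
  by (rule embI[where h = "\<lambda>x. x"]) (auto simp: dfun1_def intro!: df)

lemma emb_iff_injection:
  assumes "a \<in> U" "b \<in> U"
  shows "emb a b \<longleftrightarrow> (\<exists>f\<in>U. is_injection S f a b)"
proof
  assume "emb a b"
  then obtain h where h: "dfun1 S h" "h ` E a \<subseteq> E b" "inj_on h (E a)" unfolding emb_def by blast
  have "is_function S (graph a h) a b" by (intro is_function_graph assms h)
  moreover have "x = x'" if "related S (graph a h) x y" "related S (graph a h) x' y" "x \<in> U" "x' \<in> U" "y \<in> U" for x x' y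
    using that inj_onD[OF h(3)] by (simp add: related_iff pr_in_graph assms h)
  ultimately have "is_injection S (graph a h) a b" unfolding is_injection_def by blast
  then show "\<exists>f\<in>U. is_injection S f a b" using graph_in_U by blast
next
  assume "\<exists>f\<in>U. is_injection S f a b"
  then obtain f where f: "f \<in> U" "is_injection S f a b" by blast
  then have fn: "is_function S f a b" by (simp add: is_injection_def)
  note fapp = is_function_app[OF f(1) assms fn]
  show "emb a b"
  proof (rule embI)
    show "dfun1 S (app f)" unfolding dfun1_def by (intro df f)
    show "app f x \<in> E b" if "x \<in> E a" for x using fapp(2)[of x x] that by auto
    show "x = y" if "x \<in> E a" "y \<in> E a" "app f x = app f y" for x y
    proof -
      have "related S f x (app f x)" "related S f y (app f x)" using fapp(1) that by auto
      then show ?thesis using f(2) that unfolding is_injection_def by (meson E_in_U app_in_U)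
    qed
  qed
qed

text \<open>A quantifier over HOL functions is not first-order; it is first exchanged for one over
  the sets that are injections.\<close>

lemma definable_emb [df]:
  assumes "dterm S a" "dterm S b"
  shows "definable S (\<lambda>e. emb (a e) (b e))"
proof -
  have "dpred3 S (is_injection S)"
    unfolding dpred3_def is_injection_def is_function_def is_pair_def is_upair_def by (intro df)
  note [df] = dpred3D[OF this]
  have "dpred2 S (\<lambda>a b. \<exists>f\<in>U. is_injection S f a b)" unfolding dpred2_def by (intro df)
  from dpred2D[OF this assms] have "definable S (\<lambda>e. \<exists>f\<in>U. is_injection S f (a e) (b e))" .
  then show ?thesis
    by (rule definable_cong) (simp add: emb_iff_injection dterm_in_Univ assms)
qed

lemma emb_cart:
  assumes "emb a b" "a \<in> U" "b \<in> U"
  shows "emb (cart a a) (cart b b)"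
proof -
  obtain h where h: "dfun1 S h" "h ` E a \<subseteq> E b" "inj_on h (E a)" using assms(1) unfolding emb_def by blast
  show ?thesis
  proof (rule embI)
    show "dfun1 S (\<lambda>z. pr (h (pfst z)) (h (psnd z)))"
      unfolding dfun1_def by (intro df dfun1D[OF h(1)])
    show "pr (h (pfst z)) (h (psnd z)) \<in> E (cart b b)" if "z \<in> E (cart a a)" for z
      using in_cartE[OF that assms(2,2)] h(2) assms(3) E_in_U by (subst pr_in_cart) blast+
    show "z = w" if zw: "z \<in> E (cart a a)" "w \<in> E (cart a a)"
      "pr (h (pfst z)) (h (psnd z)) = pr (h (pfst w)) (h (psnd w))" for z w
    proof -
      note z = in_cartE[OF zw(1) assms(2,2)] and w = in_cartE[OF zw(2) assms(2,2)]
      have "h (pfst z) = h (pfst w) \<and> h (psnd z) = h (psnd w)"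
        using zw(3) z w E_in_U dfun1_in_Univ[OF h(1)] by simp
      then have "pfst z = pfst w" "psnd z = psnd w" using inj_onD[OF h(3)] z w by blast+
      then show ?thesis using z(3) w(3) by simp
    qed
  qed
qed

definition Card :: "'a \<Rightarrow> bool" where
  "Card k \<longleftrightarrow> Ord k \<and> (om = k \<or> om \<in> E k) \<and> (\<forall>a\<in>E k. \<not> (\<exists>f\<in>U. is_bijection S f a k))"

lemma is_aleph_iff: "k \<in> U \<Longrightarrow> is_aleph S k \<longleftrightarrow> Card k"
proof -
  assume k: "k \<in> U"
  have "(\<exists>w\<in>U. is_omega S w \<and> (w = k \<or> w \<epsilon>\<^bsub>S\<^esub> k)) \<longleftrightarrow> om = k \<or> om \<in> E k"
    using is_omega_iff eps_iff[OF om_in_U] om_in_U by blast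
  moreover have "\<not> (\<exists>a\<in>U. \<exists>f\<in>U. a \<epsilon>\<^bsub>S\<^esub> k \<and> is_bijection S f a k) \<longleftrightarrow>
    (\<forall>a\<in>E k. \<not> (\<exists>f\<in>U. is_bijection S f a k))"
    using eps_iff[of _ k] E_in_U by blast
  ultimately show ?thesis unfolding is_aleph_def Card_def using is_ordinal_iff[OF k] by simp
qed

lemma Card_Ord [simp]: "Card k \<Longrightarrow> Ord k" by (simp add: Card_def)

lemma Card_om_subset: "Card k \<Longrightarrow> E om \<subseteq> E k"
  unfolding Card_def using Ord_subset_iff[OF Ord_om] by blast

lemma dpred_Card: "dpred1 S Card"
proof -
  have "dpred3 S (is_bijection S)"
    unfolding dpred3_def is_bijection_def is_injection_def is_function_def is_pair_def is_upair_def
    by (intro df)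
  note [df] = dpred3D[OF this]
  show ?thesis unfolding dpred1_def Card_def by (intro df; simp)
qed

lemmas definable_Card [df] = dpred1D[OF dpred_Card]

text \<open>The orientation is reversed because \<open>Card\<close> excludes bijections from a
  smaller ordinal onto k, whereas a collapse maps k to the smaller ordinal.\<close>

lemma bijection_exists:
  assumes "a \<in> U" "b \<in> U" "dfun1 S h" "bij_betw h (E a) (E b)"
  shows "\<exists>f\<in>U. is_bijection S f b a"
proof -
  let ?g = "inv_in a h"
  have inj: "inj_on h (E a)" and im: "h ` E a = E b" using assms(4) by (auto simp: bij_betw_def)
  have dg: "dfun1 S ?g" by (rule dfun_inv_in[OF assms(1,3)])
  have g: "?g (h x) = x" if "x \<in> E a" for x by (rule inv_in_eq[OF inj that])
  have gb: "?g y \<in> E a \<and> h (?g y) = y" if "y \<in> E b" for y using that g im by force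
  have fn: "is_function S (graph b ?g) b a"
    using gb by (intro is_function_graph assms(1,2) dg) auto
  have rel: "related S (graph b ?g) y x \<longleftrightarrow> y \<in> E b \<and> x = ?g y" if "x \<in> U" "y \<in> U" for x y
    using that by (simp add: related_iff pr_in_graph assms(2) dg)
  have "y = y'" if "related S (graph b ?g) y x" "related S (graph b ?g) y' x" "x \<in> U" "y \<in> U" "y' \<in> U" for x y y'
    using that rel gb by metis
  moreover have "\<exists>y\<in>U. related S (graph b ?g) y x" if "x \<in> E a" for x
  proof -
    have "h x \<in> E b" using that im by blast
    then have "related S (graph b ?g) (h x) x" using rel[of x "h x"] g[OF that] that by auto
    then show ?thesis using \<open>h x \<in> E b\<close> E_in_U by blast
  qed
  ultimately have "is_bijection S (graph b ?g) b a"
    unfolding is_bijection_def is_injection_def ball_elts_iff using fn by blast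
  then show ?thesis using graph_in_U by blast
qed

text \<open>\<open>Card\<close> forbids only bijections, so an injection h of k into m is
  straightened. Collapsing k along the order that h induces gives a bijection onto an ordinal t, and
  since the collapse never exceeds h, t is at most m.\<close>

lemma Card_not_emb:
  assumes k: "Card k" and m: "m \<in> E k"
  shows "\<not> emb k m"
proof
  assume "emb k m"
  then obtain h where h: "dfun1 S h" "h ` E k \<subseteq> E m" "inj_on h (E k)" unfolding emb_def by blast
  have Ok: "Ord k" "k \<in> U" using k by simp_all
  have Om: "Ord m" "m \<in> U" using Ord_elt[OF Ok(1) m] by simp_all
  have Oh: "Ord (h x)" if "x \<in> E k" for x using Ord_elt[OF Om(1)] h(2) that by blast
  let ?L = "\<lambda>x y. h x \<in> E (h y)"
  have L: "dpred2 S ?L" unfolding dpred2_def by (intro df dfun1D[OF h(1)])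
  have wf: "wf_on (E k) ?L" unfolding wf_on_def
  proof (intro allI impI, elim conjE)
    fix B assume B: "isset B" "B \<subseteq> E k" "B \<noteq> {}"
    from foundation_set[OF isset_image[OF B(1) h(1)]] B(3) show "\<exists>y\<in>B. \<forall>u\<in>B. h u \<notin> E (h y)" by blast
  qed
  have tr: "transp_on (E k) ?L"
    by (rule transp_onI) (use Ord_trans Oh in blast)
  obtain \<pi> where \<pi>: "dfun1 S \<pi>" "\<And>y. y \<in> E k \<Longrightarrow> Ord (\<pi> y)"
    "\<And>y. y \<in> E k \<Longrightarrow> E (\<pi> y) = \<pi> ` {u \<in> E k. h u \<in> E (h y)}"
    using collapse[OF Ok(2) L wf tr] by blast
  have inj: "inj_on \<pi> (E k)"
  proof (rule inj_onI, rule ccontr)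
    fix x y assume xy: "x \<in> E k" "y \<in> E k" "\<pi> x = \<pi> y" "x \<noteq> y"
    then have "h x \<noteq> h y" using inj_onD[OF h(3)] by blast
    then have "h x \<in> E (h y) \<or> h y \<in> E (h x)" using Ord_linear Oh xy by blast
    then have "\<pi> x \<in> E (\<pi> y) \<or> \<pi> y \<in> E (\<pi> x)" using \<pi>(3) xy by blast
    then show False using xy(3) mem_irrefl by simp
  qed
  have below: "E (\<pi> x) \<subseteq> E (h x)" if x: "x \<in> E k" for x
  proof (rule ccontr)
    assume n: "\<not> E (\<pi> x) \<subseteq> E (h x)"
    have "dpred1 S (\<lambda>x. \<not> E (\<pi> x) \<subseteq> E (h x))"
      unfolding dpred1_def by (intro df dfun1D[OF h(1)] dfun1D[OF \<pi>(1)])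
    from wf_on_least[OF wf Ok(2) this x n] obtain y where y: "y \<in> E k" "\<not> E (\<pi> y) \<subseteq> E (h y)"
      "\<And>u. u \<in> E k \<Longrightarrow> h u \<in> E (h y) \<Longrightarrow> E (\<pi> u) \<subseteq> E (h u)" by blast
    have "\<pi> u \<in> E (h y)" if "u \<in> E k" "h u \<in> E (h y)" for u
      using y(3)[OF that] Ord_subset_iff[OF \<pi>(2) Oh, of u u] that Ord_trans[OF Oh[OF y(1)] that(2)] by auto
    then show False using y(1,2) \<pi>(3) by auto
  qed
  define t where "t = mk (\<pi> ` E k)"
  have Et: "E t = \<pi> ` E k" unfolding t_def by (intro E_mk isset_image isset_E Ok \<pi>)
  have tm: "E t \<subseteq> E m"
  proof
    fix v assume "v \<in> E t"
    then obtain x where x: "x \<in> E k" "v = \<pi> x" using Et by blast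
    have "v = h x \<or> v \<in> E (h x)" using below[OF x(1)] Ord_subset_iff[OF \<pi>(2) Oh] x by blast
    then show "v \<in> E m" using h(2) x(1) Ord_trans[OF Om(1), of "h x"] by blast
  qed
  have "E v \<subseteq> E t" if "v \<in> E t" for v using that \<pi>(3) unfolding Et by blast
  moreover have "v \<in> E w \<or> v = w \<or> w \<in> E v" if "v \<in> E t" "w \<in> E t" for v w
    using that \<pi>(2) Ord_linear unfolding Et by blast
  ultimately have Ot: "Ord t" unfolding Ord_def using mk_in_U by (auto simp: t_def)
  have "t = m \<or> t \<in> E m" using tm Ord_subset_iff[OF Ot Om(1)] by blast
  then have tk: "t \<in> E k" using m Ord_trans[OF Ok(1) m] by blast
  have "\<exists>f\<in>U. is_bijection S f t k"
    by (rule bijection_exists[OF Ok(2) _ \<pi>(1)]) (use inj Et tk in \<open>auto simp: bij_betw_def\<close>)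
  then show False using k tk unfolding Card_def by blast
qed

lemma bijection_emb:
  assumes "f \<in> U" "a \<in> U" "b \<in> U" "is_bijection S f a b"
  shows "emb b a"
proof (rule embI)
  have fn: "is_function S f a b" using assms(4) by (simp add: is_bijection_def is_injection_def)
  note fapp = is_function_app[OF assms(1-3) fn]
  let ?g = "inv_in a (app f)"
  have da: "dfun1 S (app f)" unfolding dfun1_def by (intro df assms)
  have inj: "inj_on (app f) (E a)"
  proof (rule inj_onI)
    fix x y assume xy: "x \<in> E a" "y \<in> E a" "app f x = app f y"
    then have "related S f x (app f x)" "related S f y (app f x)" using fapp(1) by auto
    then show "x = y" using assms(4) xy unfolding is_bijection_def is_injection_def by (meson E_in_U app_in_U)
  qed
  have g: "?g y \<in> E a \<and> app f (?g y) = y" if y: "y \<in> E b" for y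
  proof -
    obtain x where x: "x \<in> U" "related S f x y"
      using assms(4) y unfolding is_bijection_def ball_elts_iff by blast
    then have "x \<in> E a" "y = app f x" using fapp(1)[of x y] y by auto
    then show ?thesis using inv_in_eq[OF inj] by auto
  qed
  show "dfun1 S ?g" by (rule dfun_inv_in[OF assms(2) da])
  show "?g x \<in> E a" if "x \<in> E b" for x using g[OF that] by blast
  show "x = y" if "x \<in> E b" "y \<in> E b" "?g x = ?g y" for x y using g that by metis
qed

lemma not_Card_emb:
  assumes "Ord a" "om = a \<or> om \<in> E a" "\<not> Card a"
  shows "\<exists>b\<in>E a. emb a b"
proof -
  obtain b f where "b \<in> E a" "f \<in> U" "is_bijection S f b a" using assms unfolding Card_def by blast
  then show ?thesis using bijection_emb[of f b a] assms(1) E_in_U by auto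
qed

lemma succ_inject: "x \<in> U \<Longrightarrow> y \<in> U \<Longrightarrow> succ x = succ y \<Longrightarrow> x = y"
proof -
  assume xy: "x \<in> U" "y \<in> U" "succ x = succ y"
  have "x \<in> E (succ x)" "y \<in> E (succ y)" using xy(1,2) by simp_all
  then have "x \<in> E (succ y)" "y \<in> E (succ x)" by (simp_all only: xy(3))
  then show "x = y" using xy(1,2) mem_asym[of x y] by auto
qed

lemma Card_Lim:
  assumes k: "Card k"
  shows "Lim k"
proof (rule ccontr)
  assume nL: "\<not> Lim k"
  have "zero \<in> E om" by (simp add: E_om)
  then have "k \<noteq> zero" using Card_om_subset[OF k] by auto
  then obtain b where b: "b \<in> E k" "Ord b" "k = succ b" using Ord_cases[of k] nL k by auto
  have "om \<noteq> k" using nL by auto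
  then have omb: "E om \<subseteq> E b" using k b Ord_subset_iff[OF Ord_om b(2)] unfolding Card_def by auto
  \<comment> \<open>Hilbert's hotel: the top element b goes to zero, the natural numbers move up by
    one, and everything else stays.\<close>
  define h where "h x = (if x = b then zero else if x \<in> E om then succ x else x)" for x
  have om_succ: "succ x \<in> E om" if "x \<in> E om" for x using that Nat_succ by (simp add: E_om)
  have bo: "b \<notin> E om" using omb mem_irrefl by blast
  have "emb k b"
  proof (rule embI)
    show "dfun1 S h" unfolding dfun1_def h_def by (intro df; use b in simp)
    show "h x \<in> E b" if "x \<in> E k" for x
      using that b omb om_succ Nat_zero E_om unfolding h_def by auto
    have ne: "zero \<noteq> succ x" if "x \<in> U" for x
    proof -
      have "x \<in> E (succ x)" using that by simp
      then show ?thesis by (metis E_zero empty_iff)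
    qed
    show "x = y" if xy: "x \<in> E k" "y \<in> E k" "h x = h y" for x y
    proof -
      have U: "x \<in> U" "y \<in> U" using xy by auto
      have zo: "zero \<in> E om" by (simp add: E_om)
      show ?thesis using xy(3) ne[OF U(1)] ne[OF U(2)] U succ_inject[OF U] om_succ zo bo unfolding h_def
        by (auto split: if_splits)
    qed
  qed
  then show False using Card_not_emb[OF k b(1)] by blast
qed

text \<open>Infinitude of a set of natural numbers, in a first-order form that avoids
  counting.\<close>

definition unb :: "'a \<Rightarrow> bool" where
  "unb a \<longleftrightarrow> E a \<subseteq> E om \<and> (\<forall>m\<in>E om. \<exists>x\<in>E a. m \<in> E x)"

lemma definable_unb [df]: "dterm S a \<Longrightarrow> definable S (\<lambda>e. unb (a e))"
  by (rule dpred1D[where P = unb]) (unfold dpred1_def unb_def, intro df; simp)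

lemma E_mk_fibre:
  assumes "a \<in> U" "dfun1 S h" "v \<in> U"
  shows "E (mk {x \<in> U. x \<in> E a \<and> h x = v}) = {x \<in> E a. h x = v}"
proof -
  have "isset {x \<in> E a. h x = v}"
    by (rule isset_Collect_elts[OF assms(1)]) (unfold dpred1_def, intro df dfun1D[OF assms(2)] assms(3))
  moreover have "{x \<in> U. x \<in> E a \<and> h x = v} = {x \<in> E a. h x = v}" by auto
  ultimately show ?thesis by (simp add: E_mk)
qed

lemma pigeonhole:
  assumes n: "Nat n" and a: "a \<in> U" "unb a" and h: "dfun1 S h" "h ` E a \<subseteq> E n"
  shows "\<exists>v\<in>E n. unb (mk {x \<in> U. x \<in> E a \<and> h x = v})"
proof -
  \<comment> \<open>The maps are quantified as sets \<open>f\<close>, because the induction needs a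
    definable predicate; \<open>h\<close> enters at the end through its graph.\<close>
  define P where "P n \<longleftrightarrow> (\<forall>a\<in>U. \<forall>f\<in>U. unb a \<and> (\<forall>x\<in>E a. app f x \<in> E n) \<longrightarrow>
    (\<exists>v\<in>E n. unb (mk {x \<in> U. x \<in> E a \<and> app f x = v})))" for n
  have "P n"
  proof (rule Nat_induct_dpred[OF _ _ _ n])
    show "dpred1 S P" unfolding dpred1_def P_def by (intro df)
    show "P zero" unfolding P_def unb_def using Nat_zero E_om by fastforce
    fix n assume n: "Nat n" and IH: "P n"
    have nU: "n \<in> U" using n by simp
    show "P (succ n)" unfolding P_def
    proof (intro ballI impI, elim conjE)
      fix a f assume a: "a \<in> U" "f \<in> U" "unb a" "\<forall>x\<in>E a. app f x \<in> E (succ n)"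
      have df': "dfun1 S (app f)" unfolding dfun1_def by (intro df a)
      note fib = E_mk_fibre[OF _ df']
      show "\<exists>v\<in>E (succ n). unb (mk {x \<in> U. x \<in> E a \<and> app f x = v})"
      proof (cases "unb (mk {x \<in> U. x \<in> E a \<and> app f x = n})")
        case False
        then obtain m0 where m0: "m0 \<in> E om" "\<And>x. x \<in> E a \<Longrightarrow> app f x = n \<Longrightarrow> m0 \<notin> E x"
          using a(3) unfolding unb_def fib[OF a(1) nU] by blast
        \<comment> \<open>If the fibre over n is bounded by m0, the part of a beyond m0 is still
          unbounded and avoids the value n, so the induction hypothesis applies to it.\<close>
        define a' where "a' = mk {x \<in> E a. m0 \<in> E x}"
        have "isset {x \<in> E a. m0 \<in> E x}"
          by (rule isset_Collect_elts[OF a(1)]) (unfold dpred1_def, intro df E_in_U[OF m0(1)])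
        then have Ea': "E a' = {x \<in> E a. m0 \<in> E x}" "a' \<in> U" unfolding a'_def by (auto simp: E_mk)
        have "\<exists>x\<in>E a'. m \<in> E x" if m: "m \<in> E om" for m
        proof (cases "m \<in> E m0")
          case True
          obtain x where x: "x \<in> E a" "m0 \<in> E x" using a(3) m0(1) unfolding unb_def by blast
          then have "Ord x" using a(3) Ord_elt[OF Ord_om] unfolding unb_def by blast
          then show ?thesis using x True Ord_trans unfolding Ea' by blast
        next
          case F: False
          obtain x where x: "x \<in> E a" "m \<in> E x" using a(3) m unfolding unb_def by blast
          then have Ox: "Ord x" using a(3) Ord_elt[OF Ord_om] unfolding unb_def by blast
          have "m0 = m \<or> m0 \<in> E m" using Ord_linear[of m m0] F m m0(1) Ord_elt[OF Ord_om] by blast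
          then have "m0 \<in> E x" using x Ord_trans[OF Ox] by blast
          then show ?thesis using x unfolding Ea' by blast
        qed
        then have ua': "unb a'" using a(3) unfolding unb_def Ea' by blast
        have "\<forall>x\<in>E a'. app f x \<in> E n" using a(4) m0(2) nU unfolding Ea' by auto
        then obtain v where v: "v \<in> E n" "unb (mk {x \<in> U. x \<in> E a' \<and> app f x = v})"
          using IH ua' a(2) Ea'(2) unfolding P_def by blast
        then have "unb (mk {x \<in> U. x \<in> E a \<and> app f x = v})"
          using a(3) unfolding unb_def fib[OF a(1) E_in_U[OF v(1)]] fib[OF Ea'(2) E_in_U[OF v(1)]]
          unfolding Ea' by blast
        then show ?thesis using v(1) nU by auto
      qed (use nU in auto)
    qed
  qed
  moreover have "\<forall>x\<in>E a. app (graph a h) x \<in> E n" using app_graph[OF a(1) h(1)] h(2) by auto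
  ultimately have "\<exists>v\<in>E n. unb (mk {x \<in> U. x \<in> E a \<and> app (graph a h) x = v})"
    unfolding P_def using a graph_in_U by blast
  moreover have "{x \<in> U. x \<in> E a \<and> app (graph a h) x = v} = {x \<in> U. x \<in> E a \<and> h x = v}" for v
    using app_graph[OF a(1) h(1)] by auto
  ultimately show ?thesis by simp
qed

text \<open>The pigeonhole principle for the first coordinate and then for the second leaves
  unboundedly many numbers with the same image.\<close>

lemma om_not_emb_finite_square:
  assumes n: "Nat n"
  shows "\<not> emb om (cart n n)"
proof
  assume "emb om (cart n n)"
  then obtain h where h: "dfun1 S h" "h ` E om \<subseteq> E (cart n n)" "inj_on h (E om)" unfolding emb_def by blast
  have nU: "n \<in> U" using n by simp
  have h': "pfst (h x) \<in> E n" "psnd (h x) \<in> E n" "h x = pr (pfst (h x)) (psnd (h x))" if "x \<in> E om" for x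
    using in_cartE[of "h x" n n] h(2) that nU by blast+
  have "unb om" using Lim_om unfolding unb_def Lim_def by blast
  have d1: "dfun1 S (\<lambda>x. pfst (h x))" and d2: "dfun1 S (\<lambda>x. psnd (h x))"
    unfolding dfun1_def by (intro df dfun1D[OF h(1)])+
  obtain v where v: "v \<in> E n" "unb (mk {x \<in> U. x \<in> E om \<and> pfst (h x) = v})"
    using pigeonhole[OF n om_in_U \<open>unb om\<close> d1] h' by blast
  define a where "a = mk {x \<in> U. x \<in> E om \<and> pfst (h x) = v}"
  have Ea: "E a = {x \<in> E om. pfst (h x) = v}" "a \<in> U" "unb a"
    unfolding a_def using E_mk_fibre[OF om_in_U d1] v by auto
  have "(\<lambda>x. psnd (h x)) ` E a \<subseteq> E n" using h' unfolding Ea by blast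
  from pigeonhole[OF n Ea(2,3) d2 this] obtain w where
    w: "w \<in> E n" "unb (mk {x \<in> U. x \<in> E a \<and> psnd (h x) = w})" by blast
  then have Eb: "E (mk {x \<in> U. x \<in> E a \<and> psnd (h x) = w}) = {x \<in> E om. pfst (h x) = v \<and> psnd (h x) = w}"
    using E_mk_fibre[OF Ea(2) d2 E_in_U[OF w(1)]] Ea by auto
  have "zero \<in> E om" by (simp add: E_om)
  then obtain x where x: "x \<in> E om" "pfst (h x) = v" "psnd (h x) = w"
    using w(2) unfolding unb_def Eb by blast
  then obtain y where y: "y \<in> E om" "pfst (h y) = v" "psnd (h y) = w" "x \<in> E y"
    using w(2) unfolding unb_def Eb by blast
  have "h x = h y" using h'(3)[OF x(1)] h'(3)[OF y(1)] x y by simp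
  then show False using inj_onD[OF h(3)] x y mem_irrefl by blast
qed

text \<open>
  For the least counterexample \<open>\<mu>\<close>, order \<open>\<kappa>\<close> by the maximum of the two components of the image in
  \<open>\<mu> \<times> \<mu>\<close>, then by membership.  A proper initial segment embeds into the square of an ordinal below
  \<open>\<mu>\<close>, so by minimality its order type is below \<open>\<mu>\<close>; hence \<open>\<kappa>\<close> embeds into \<open>\<mu>\<close>.
\<close>

theorem Card_not_emb_square:
  assumes "Card k" "m \<in> E k"
  shows "\<not> emb k (cart m m)"
proof
  assume emb: "emb k (cart m m)"
  \<comment> \<open>The least m is taken over all cardinals k at once, so that minimality can also
    be applied with \<mu> in the role of k.\<close>
  define P where "P m \<longleftrightarrow> (\<exists>k\<in>U. Card k \<and> m \<in> E k \<and> emb k (cart m m))" for m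
  have "dpred1 S P" unfolding dpred1_def P_def by (intro df)
  moreover have "Ord m" using Ord_elt[OF Card_Ord] assms by blast
  moreover have "P m" unfolding P_def using assms emb by auto
  ultimately obtain \<mu> where \<mu>: "Ord \<mu>" "P \<mu>" "\<And>x. x \<in> E \<mu> \<Longrightarrow> \<not> P x" using Ord_least by blast
  obtain \<kappa> where \<kappa>: "\<kappa> \<in> U" "Card \<kappa>" "\<mu> \<in> E \<kappa>" "emb \<kappa> (cart \<mu> \<mu>)" using \<mu>(2) unfolding P_def by blast
  have O\<kappa>: "Ord \<kappa>" using \<kappa> by simp
  have \<mu>U: "\<mu> \<in> U" using \<mu> by simp
  show False
  proof (cases "Nat \<mu>")
    case True
    then show False using om_not_emb_finite_square emb_trans[OF emb_subset[OF Card_om_subset[OF \<kappa>(2)]] \<kappa>(4)] by blast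
  next
    case False
    have om\<mu>: "om = \<mu> \<or> om \<in> E \<mu>" using Ord_linear[OF Ord_om \<mu>(1)] False E_om by blast
    \<comment> \<open>An embedding of \<mu> into a smaller ordinal b would carry \<kappa> into the
      square of b, against minimality.\<close>
    have Card\<mu>: "Card \<mu>"
    proof (rule ccontr)
      assume "\<not> Card \<mu>"
      then obtain b where b: "b \<in> E \<mu>" "emb \<mu> b" using not_Card_emb[OF \<mu>(1) om\<mu>] by blast
      have "emb \<kappa> (cart b b)" using emb_trans[OF \<kappa>(4) emb_cart[OF b(2) \<mu>U]] b E_in_U by blast
      moreover have "b \<in> E \<kappa>" using Ord_trans[OF O\<kappa> \<kappa>(3) b(1)] .
      ultimately show False using \<mu>(3)[OF b(1)] \<kappa> unfolding P_def by blast
    qed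
    obtain g where g: "dfun1 S g" "g ` E \<kappa> \<subseteq> E (cart \<mu> \<mu>)" "inj_on g (E \<kappa>)"
      using \<kappa>(4) unfolding emb_def by blast
    have g': "pfst (g x) \<in> E \<mu>" "psnd (g x) \<in> E \<mu>" "g x = pr (pfst (g x)) (psnd (g x))" if "x \<in> E \<kappa>" for x
      using in_cartE[of "g x" \<mu> \<mu>] g(2) that \<mu>U by blast+
    define mx where "mx x = (if pfst (g x) \<in> E (psnd (g x)) then psnd (g x) else pfst (g x))" for x
    have dmx: "dfun1 S mx" unfolding dfun1_def mx_def by (intro df dfun1D[OF g(1)])
    have mx: "mx x \<in> E \<mu>" "pfst (g x) \<in> E (succ (mx x))" "psnd (g x) \<in> E (succ (mx x))" "Ord (mx x)"
      if x: "x \<in> E \<kappa>" for x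
    proof -
      note gx = g'(1,2)[OF x]
      have O: "Ord (pfst (g x))" "Ord (psnd (g x))" using gx Ord_elt[OF \<mu>(1)] by blast+
      show "mx x \<in> E \<mu>" using gx by (simp add: mx_def)
      show "Ord (mx x)" using O by (simp add: mx_def)
      show "pfst (g x) \<in> E (succ (mx x))" "psnd (g x) \<in> E (succ (mx x))"
        using Ord_linear[OF O] O unfolding mx_def by auto
    qed
    define L where "L x y \<longleftrightarrow> mx x \<in> E (mx y) \<or> (mx x = mx y \<and> x \<in> E y)" for x y
    have dL: "dpred2 S L" unfolding dpred2_def L_def by (intro df dfun1D[OF dmx])
    have wf: "wf_on (E \<kappa>) L" unfolding wf_on_def
    proof (intro allI impI, elim conjE)
      fix B assume B: "isset B" "B \<subseteq> E \<kappa>" "B \<noteq> {}"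
      from foundation_set[OF isset_image[OF B(1) dmx]] B(3) obtain x where
        x: "x \<in> B" "mx ` B \<inter> E (mx x) = {}" by blast
      have "isset {y \<in> B. mx y = mx x}"
        by (rule isset_sep[OF B(1)]) (unfold dpred1_def, intro df dfun1D[OF dmx] dfun1_in_Univ[OF dmx], use x B in auto)
      from foundation_set[OF this] x obtain y where
        y: "y \<in> B" "mx y = mx x" "{y \<in> B. mx y = mx x} \<inter> E y = {}" by blast
      have "\<not> L u y" if "u \<in> B" for u using that x(2) y unfolding L_def by force
      then show "\<exists>y\<in>B. \<forall>u\<in>B. \<not> L u y" using y(1) by blast
    qed
    have "L x z" if "x \<in> E \<kappa>" "y \<in> E \<kappa>" "z \<in> E \<kappa>" "L x y" "L y z" for x y z
      using that(4,5) Ord_trans[OF mx(4)[OF that(3)]] Ord_trans[OF Ord_elt[OF O\<kappa> that(3)]]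
      unfolding L_def by metis
    then have tr: "transp_on (E \<kappa>) L" by (rule transp_onI)
    have tri: "L x y \<or> x = y \<or> L y x" if "x \<in> E \<kappa>" "y \<in> E \<kappa>" for x y
      using Ord_linear[OF mx(4)[OF that(1)] mx(4)[OF that(2)]]
        Ord_linear[OF Ord_elt[OF O\<kappa> that(1)] Ord_elt[OF O\<kappa> that(2)]] unfolding L_def by auto
    obtain \<pi> where \<pi>: "dfun1 S \<pi>" "\<And>y. y \<in> E \<kappa> \<Longrightarrow> Ord (\<pi> y)"
      "\<And>y. y \<in> E \<kappa> \<Longrightarrow> E (\<pi> y) = \<pi> ` {u \<in> E \<kappa>. L u y}"
      using collapse[OF \<kappa>(1) dL wf tr] by blast
    have inj: "inj_on \<pi> (E \<kappa>)"
    proof (rule inj_onI, rule ccontr)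
      fix x y assume xy: "x \<in> E \<kappa>" "y \<in> E \<kappa>" "\<pi> x = \<pi> y" "x \<noteq> y"
      then have "\<pi> x \<in> E (\<pi> y) \<or> \<pi> y \<in> E (\<pi> x)" using tri[OF xy(1,2)] \<pi>(3) by blast
      then show False using xy(3) mem_irrefl by simp
    qed
    have "\<pi> y \<in> E \<mu>" if y: "y \<in> E \<kappa>" for y
    proof (rule ccontr)
      assume "\<pi> y \<notin> E \<mu>"
      then have sub: "E \<mu> \<subseteq> E (\<pi> y)" using Ord_not_in_iff[OF \<pi>(2)[OF y] \<mu>(1)] by blast
      \<comment> \<open>Every u preceding y has both components at most \<open>mx y\<close>, hence
        below its successor, which stays below the limit \<mu>. If the order type reached \<mu>,
        reading \<open>\<pi>\<close> backwards would embed \<mu> into the square of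
        \<open>?m\<close>.\<close>
      let ?m = "succ (mx y)"
      have m\<mu>: "?m \<in> E \<mu>" using Lim_succ[OF Card_Lim[OF Card\<mu>] mx(1)[OF y]] .
      let ?q = "inv_in \<kappa> \<pi>"
      have q: "?q v \<in> E \<kappa> \<and> L (?q v) y \<and> \<pi> (?q v) = v" if v: "v \<in> E \<mu>" for v
      proof -
        obtain u where u: "u \<in> E \<kappa>" "L u y" "v = \<pi> u" using sub v \<pi>(3)[OF y] by blast
        have "?q v = u" unfolding u(3) by (rule inv_in_eq[OF inj u(1)])
        then show ?thesis using u by simp
      qed
      have "emb \<mu> (cart ?m ?m)"
      proof (rule embI)
        show "dfun1 S (\<lambda>v. g (?q v))"
          unfolding dfun1_def by (intro df dfun1D[OF g(1)] dfun1D[OF dfun_inv_in[OF \<kappa>(1) \<pi>(1)]])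
        show "g (?q v) \<in> E (cart ?m ?m)" if v: "v \<in> E \<mu>" for v
        proof -
          let ?u = "?q v"
          have u: "?u \<in> E \<kappa>" "L ?u y" using q[OF v] by auto
          have "E (succ (mx ?u)) \<subseteq> E ?m"
            using u(2) Ord_trans[OF mx(4)[OF y], of "mx ?u"] mx(4)[OF u(1)] mx(4)[OF y] unfolding L_def by auto
          then have "pfst (g ?u) \<in> E ?m" "psnd (g ?u) \<in> E ?m" using mx[OF u(1)] by blast+
          moreover from this have "pfst (g ?u) \<in> U" "psnd (g ?u) \<in> U" by auto
          ultimately have "pr (pfst (g ?u)) (psnd (g ?u)) \<in> E (cart ?m ?m)" by (subst pr_in_cart) simp_all
          then show ?thesis using g'(3)[OF u(1)] by simp
        qed
        show "v = w" if "v \<in> E \<mu>" "w \<in> E \<mu>" "g (?q v) = g (?q w)" for v w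
          using q[OF that(1)] q[OF that(2)] inj_onD[OF g(3) that(3)] by metis
      qed
      then have "P ?m" unfolding P_def using Card\<mu> m\<mu> \<mu>U by blast
      then show False using \<mu>(3)[OF m\<mu>] by blast
    qed
    then have "emb \<kappa> \<mu>" using \<pi>(1) inj unfolding emb_def by blast
    then show False using Card_not_emb[OF \<kappa>(2,3)] by blast
  qed
qed

text \<open>
  The collapse of the set of pairs \<open>(x, y)\<close> with \<open>X x y\<close>, ordered by the second component for equal
  first components, gives the order types of all sets \<open>X x\<close> at once, without choosing enumerations.
\<close>

theorem no_small_countable_cover:
  assumes k: "Card k" and w: "Card w" "om \<in> E w" "w \<in> E k" and m: "m \<in> E k" and X: "dpred2 S X"
    and count: "\<And>x. x \<in> E m \<Longrightarrow> \<exists>h. dfun1 S h \<and> (\<forall>y\<in>E k. X x y \<longrightarrow> y \<in> h ` E om)"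
    and cover: "\<And>y. y \<in> E k \<Longrightarrow> \<exists>x\<in>E m. X x y"
  shows False
proof -
  note [df] = dpred2D[OF X]
  have Ok: "Ord k" "k \<in> U" using k by simp_all
  have Om: "Ord m" "m \<in> U" using Ord_elt[OF Ok(1) m] by simp_all
  have Ow: "Ord w" "w \<in> U" using w by simp_all
  let ?A = "{z \<in> E (cart m k). X (pfst z) (psnd z)}"
  define A where "A = mk ?A"
  have "isset ?A" by (rule isset_Collect_elts, simp, unfold dpred1_def, intro df)
  then have EA: "E A = ?A" "A \<in> U" unfolding A_def by (auto simp: E_mk)
  have A: "pfst z \<in> E m" "psnd z \<in> E k" "z = pr (pfst z) (psnd z)" "X (pfst z) (psnd z)" "Ord (psnd z)"
    if "z \<in> E A" for z
    using that in_cartE[of z m k] Om Ok Ord_elt[OF Ok(1)] unfolding EA by auto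
  have A_intro: "pr x y \<in> E A" if "x \<in> E m" "y \<in> E k" "X x y" for x y
  proof -
    have "x \<in> U" "y \<in> U" using that by auto
    then show ?thesis using that Om Ok unfolding EA by simp
  qed
  define L where "L u z \<longleftrightarrow> pfst u = pfst z \<and> psnd u \<in> E (psnd z)" for u z
  have dL: "dpred2 S L" unfolding dpred2_def L_def by (intro df)
  have ds: "dfun1 S psnd" unfolding dfun1_def by (intro df)
  have wf: "wf_on (E A) L" unfolding wf_on_def
  proof (intro allI impI, elim conjE)
    fix B assume B: "isset B" "B \<subseteq> E A" "B \<noteq> {}"
    then obtain z where z: "z \<in> B" by blast
    let ?B = "{u \<in> B. pfst u = pfst z}"
    have "z \<in> E A" using z B(2) by blast
    then have "pfst z \<in> U" by (rule E_in_U[OF A(1)])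
    then have "isset ?B" by (intro isset_sep[OF B(1)], unfold dpred1_def, intro df)
    from foundation_set[OF isset_image[OF this ds]] z obtain y where
      y: "y \<in> ?B" "psnd ` ?B \<inter> E (psnd y) = {}" by blast
    have "\<not> L u y" if "u \<in> B" for u using that y unfolding L_def by auto
    then show "\<exists>y\<in>B. \<forall>u\<in>B. \<not> L u y" using y(1) by blast
  qed
  have "L x z" if "x \<in> E A" "y \<in> E A" "z \<in> E A" "L x y" "L y z" for x y z
    using that(4,5) Ord_trans[OF A(5)[OF that(3)]] unfolding L_def by auto
  then have tr: "transp_on (E A) L" by (rule transp_onI)
  obtain \<pi> where \<pi>: "dfun1 S \<pi>" "\<And>y. y \<in> E A \<Longrightarrow> Ord (\<pi> y)"
    "\<And>y. y \<in> E A \<Longrightarrow> E (\<pi> y) = \<pi> ` {u \<in> E A. L u y}"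
    using collapse[OF EA(2) dL wf tr] by blast
  have inj: "z = z'" if zz: "z \<in> E A" "z' \<in> E A" "pfst z = pfst z'" "\<pi> z = \<pi> z'" for z z'
  proof (rule ccontr)
    assume "z \<noteq> z'"
    then have "psnd z \<noteq> psnd z'" using A(3)[OF zz(1)] A(3)[OF zz(2)] zz(3) by auto
    then have "L z z' \<or> L z' z" using Ord_linear[OF A(5)[OF zz(1)] A(5)[OF zz(2)]] zz(3) unfolding L_def by auto
    then have "\<pi> z \<in> E (\<pi> z') \<or> \<pi> z' \<in> E (\<pi> z)" using \<pi>(3) zz by blast
    then show False using zz(4) mem_irrefl by simp
  qed
  \<comment> \<open>\<open>w\<close> stands for omega_1. An order type that reaches w would turn the
    enumeration of the fibre into an embedding of w into omega.\<close>
  have \<pi>w: "\<pi> z \<in> E w" if z: "z \<in> E A" for z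
  proof (rule ccontr)
    assume "\<pi> z \<notin> E w"
    then have sub: "E w \<subseteq> E (\<pi> z)" using Ord_not_in_iff[OF \<pi>(2)[OF z] Ow(1)] by blast
    obtain h where h: "dfun1 S h" "\<And>y. y \<in> E k \<Longrightarrow> X (pfst z) y \<Longrightarrow> y \<in> h ` E om"
      using count[OF A(1)[OF z]] by blast
    have zU: "pfst z \<in> U" "z \<in> U" using A(1)[OF z] z by auto
    \<comment> \<open>\<open>\<pi>\<close> may repeat values for different first components, so its
      inverse is taken within the fibre of z.\<close>
    define q where "q v = the_in S (\<lambda>u. u \<in> E A \<and> L u z \<and> \<pi> u = v)" for v
    have dq: "dfun1 S q" unfolding dfun1_def q_def
      by (intro df dpred2D[OF dL] dfun1D[OF \<pi>(1)] EA zU)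
    have q: "q v \<in> E A \<and> L (q v) z \<and> \<pi> (q v) = v" if v: "v \<in> E w" for v
    proof -
      obtain u where u: "u \<in> E A" "L u z" "v = \<pi> u" using sub v \<pi>(3)[OF z] by blast
      have "q v = u" unfolding q_def
      proof (rule the_in_eq)
        fix y assume "y \<in> E A \<and> L y z \<and> \<pi> y = v"
        then show "y = u" using inj[of y u] u unfolding L_def by simp
      qed (use u in auto)
      then show ?thesis using u by simp
    qed
    \<comment> \<open>The enumeration may repeat elements; the least index gives an injection
      without choice.\<close>
    define n where "n v = least_ord (\<lambda>i. i \<in> E om \<and> h i = psnd (q v))" for v
    have dn: "dfun1 S n" unfolding dfun1_def n_def
      by (intro df dfun1D[OF h(1)] dfun1D[OF dq] om_in_U)
    have n: "n v \<in> E om \<and> h (n v) = psnd (q v)" if v: "v \<in> E w" for v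
    proof -
      note qv = q[OF v]
      have Xq: "X (pfst z) (psnd (q v))" using A(4)[of "q v"] qv unfolding L_def by simp
      have kq: "psnd (q v) \<in> E k" using A(2) qv by blast
      obtain i where i: "i \<in> E om" "h i = psnd (q v)" using h(2)[OF kq Xq] by (metis imageE)
      have "psnd (q v) \<in> U" using kq by (rule E_in_U)
      then have "dpred1 S (\<lambda>i. i \<in> E om \<and> h i = psnd (q v))"
        unfolding dpred1_def by (intro df dfun1D[OF h(1)] om_in_U)
      from least_ord(2)[OF this, of i] i Ord_elt[OF Ord_om] show ?thesis unfolding n_def by blast
    qed
    have "emb w om"
    proof (rule embI[OF dn])
      show "n v \<in> E om" if "v \<in> E w" for v using n[OF that] by blast
      show "v = v'" if vv: "v \<in> E w" "v' \<in> E w" "n v = n v'" for v v'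
      proof -
        have "psnd (q v) = psnd (q v')" using n[OF vv(1)] n[OF vv(2)] vv(3) by simp
        moreover have "pfst (q v) = pfst (q v')" using q[OF vv(1)] q[OF vv(2)] unfolding L_def by simp
        ultimately have "q v = q v'" using A(3)[of "q v"] A(3)[of "q v'"] q[OF vv(1)] q[OF vv(2)] by metis
        then show ?thesis using q[OF vv(1)] q[OF vv(2)] by metis
      qed
    qed
    then show False using Card_not_emb[OF w(1,2)] by blast
  qed
  \<comment> \<open>The larger of m and w contains both coordinates, so the embedding lands in a
    square.\<close>
  define \<nu> where "\<nu> = (if m \<in> E w then w else m)"
  have \<nu>: "\<nu> \<in> E k" "E m \<subseteq> E \<nu>" "E w \<subseteq> E \<nu>"
  proof -
    show "\<nu> \<in> E k" using m w by (simp add: \<nu>_def)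
    show "E m \<subseteq> E \<nu>" using Ord_trans[OF Ow(1), of m] by (auto simp: \<nu>_def)
    show "E w \<subseteq> E \<nu>" using Ord_not_in_iff[OF Om(1) Ow(1)] by (auto simp: \<nu>_def)
  qed
  have \<nu>U: "\<nu> \<in> U" using \<nu> by auto
  define a where "a y = least_ord (\<lambda>x. x \<in> E m \<and> X x y)" for y
  have da: "dfun1 S a" unfolding dfun1_def a_def by (intro df Om)
  have a: "a y \<in> E m \<and> X (a y) y" if y: "y \<in> E k" for y
  proof -
    obtain x where x: "x \<in> E m" "X x y" using cover[OF y] by blast
    have "dpred1 S (\<lambda>x. x \<in> E m \<and> X x y)" unfolding dpred1_def by (intro df Om E_in_U[OF y])
    from least_ord(2)[OF this, of x] x Ord_elt[OF Om(1)] show ?thesis unfolding a_def by blast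
  qed
  \<comment> \<open>The first coordinate selects a set \<open>X x\<close> that contains y and the
    second locates y in it by its order type; together they determine y.\<close>
  define g where "g y = pr (a y) (\<pi> (pr (a y) y))" for y
  have "emb k (cart \<nu> \<nu>)"
  proof (rule embI)
    show "dfun1 S g" unfolding dfun1_def g_def by (intro df dfun1D[OF da] dfun1D[OF \<pi>(1)])
    show "g y \<in> E (cart \<nu> \<nu>)" if y: "y \<in> E k" for y
    proof -
      have "pr (a y) y \<in> E A" using A_intro a[OF y] y by blast
      then have "\<pi> (pr (a y) y) \<in> E \<nu>" "a y \<in> E \<nu>" using \<pi>w \<nu> a[OF y] by blast+
      moreover from this have "\<pi> (pr (a y) y) \<in> U" "a y \<in> U" by auto
      ultimately show ?thesis unfolding g_def using \<nu>U by (subst pr_in_cart) simp_all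
    qed
    show "y = y'" if yy: "y \<in> E k" "y' \<in> E k" "g y = g y'" for y y'
    proof -
      have U: "a y \<in> U" "a y' \<in> U" "y \<in> U" "y' \<in> U" using a[OF yy(1)] a[OF yy(2)] yy by auto
      have eq: "a y = a y' \<and> \<pi> (pr (a y) y) = \<pi> (pr (a y') y')"
        by (rule iffD1[OF pr_inject])
          (rule U dfun1_in_Univ[OF \<pi>(1) pr_in_U] yy(3)[unfolded g_def])+
      have "pr (a y) y \<in> E A" "pr (a y') y' \<in> E A" using A_intro a yy by blast+
      then have "pr (a y) y = pr (a y') y'" by (rule inj) (use eq U in simp, use eq in blast)
      then show ?thesis using U by simp
    qed
  qed
  then show False using Card_not_emb_square[OF k \<nu>(1)] by blast
qed

end

section \<open>Preservation of cardinals\<close>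

context ccc_zf
begin

theorem Card_above_preserved:
  assumes k: "Card k" and w: "Card w" "om \<in> E w" "w \<in> E k"
  shows "is_aleph M (j k)"
proof (rule is_aleph_j)
  show "Ord k" "om = k \<or> om \<in> E k" using k by (auto simp: Card_def simp del: Card_Ord)
  fix m f assume m: "m \<in> E k" and f: "f \<in> Univ M"
  have U: "m \<in> U" "k \<in> U" using m k by auto
  show "\<not> is_bijection M f (j m) (j k)"
  proof
    assume bij: "is_bijection M f (j m) (j k)"
    then have fn: "is_function M f (j m) (j k)" by (simp add: is_bijection_def is_injection_def)
    obtain X where X: "dpred2 S X"
      and RX: "\<And>x y. x \<in> E m \<Longrightarrow> y \<in> E k \<Longrightarrow> related M f (j x) (j y) \<Longrightarrow> X x y"
      and Xc: "\<And>x. x \<in> E m \<Longrightarrow> \<exists>h. dfun1 S h \<and> (\<forall>y\<in>E k. X x y \<longrightarrow> y \<in> h ` E om)"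
      using countable_values[OF f U fn] by blast
    \<comment> \<open>The bijection takes the value y at some argument, so y is among the possible
      values there.\<close>
    have "\<exists>x\<in>E m. X x y" if y: "y \<in> E k" for y
    proof -
      have "j y \<in> elts M (j k)" using y U by simp
      then obtain Z where Z: "Z \<in> Univ M" "related M f Z (j y)"
        using bij unfolding is_bijection_def ball_elts by blast
      from related_jE[OF fn Z(2) U Z(1) j_in_M] obtain x y' where
        x: "x \<in> E m" "y' \<in> E k" "Z = j x" "j y = j y'" by blast
      then have "y = y'" using y by auto
      then show ?thesis using RX[OF x(1) y] x Z by blast
    qed
    from no_small_countable_cover[OF k w m X Xc this] show False .
  qed
qed

end

theorem corollary5p5:
  fixes S :: "'a set_structure" and F :: "'a forcing"
  assumes "ZF_model S"
    and "notion_of_forcing S F"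
    and "CCC3 S F"
  shows "(\<not> changes_cofinalities S F \<and>
          (\<forall>\<omega>\<^sub>1\<in>Univ S. \<forall>\<kappa>\<in>Univ S. is_omega1 S \<omega>\<^sub>1 \<and> \<omega>\<^sub>1 \<epsilon>\<^bsub>S\<^esub> \<kappa> \<longrightarrow> \<not> collapses S F \<kappa>)) \<and>
         ((\<exists>\<omega>\<^sub>1\<in>Univ S. is_omega1 S \<omega>\<^sub>1 \<and> is_regular S \<omega>\<^sub>1) \<longrightarrow>
          \<not> changes_cofinalities S F \<and> (\<forall>\<kappa>\<in>Univ S. \<not> collapses S F \<kappa>))"
proof -
  interpret forcing_zf S F by unfold_locales (use assms in auto)
  have ccc: "ccc_zf S F G" if "generic S F G" for G
    by unfold_locales (use assms that in auto)
  have omega1: "Card w \<and> om \<in> E w \<and> (\<forall>a\<in>E w. Card a \<longrightarrow> a = om)" if "w \<in> U" "is_omega1 S w" for w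
  proof -
    from that(2) obtain v where v: "v \<in> U" "is_omega S v" "v \<epsilon>\<^bsub>S\<^esub> w" "\<forall>a\<in>U. a \<epsilon>\<^bsub>S\<^esub> w \<and> is_aleph S a \<longrightarrow> a = v"
      unfolding is_omega1_def by blast
    moreover have "v = om" using v is_omega_iff by blast
    ultimately show ?thesis
      using that is_aleph_iff eps_iff[of _ w] E_in_U unfolding is_omega1_def by metis
  qed
  have cof: "\<not> changes_cofinalities S F"
  proof
    assume "changes_cofinalities S F"
    then obtain G d l where G: "generic S F G" and dl: "d \<in> U" "l \<in> U" "is_limit S d" "is_cofinality S d l"
      "\<not> is_cofinality (generic_extension S F G) (ground_embedding S F G d) (ground_embedding S F G l)"
      unfolding changes_cofinalities_def by blast
    interpret ccc_zf S F G by (rule ccc[OF G])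
    show False using cofinality_preserved[OF dl(1,3,2,4)] dl(5) ground_embedding_eq dl(1,2) by simp
  qed
  have above: "\<not> collapses S F k" if w: "w \<in> U" "is_omega1 S w" "w \<in> E k" and k: "k \<in> U" for w k
  proof
    assume "collapses S F k"
    then obtain G where G: "generic S F G" and coll: "is_aleph S k"
      "\<not> is_aleph (generic_extension S F G) (ground_embedding S F G k)" unfolding collapses_def by blast
    interpret ccc_zf S F G by (rule ccc[OF G])
    have "is_aleph M (j k)"
      using Card_above_preserved[of k w] omega1[OF w(1,2)] is_aleph_iff[OF k] coll(1) w(3) by blast
    then show False using coll(2) ground_embedding_eq[OF k] by simp
  qed
  have all: "\<not> collapses S F k"
    if w: "w \<in> U" "is_omega1 S w" "is_regular S w" and k: "k \<in> U" for w k
  proof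
    assume c: "collapses S F k"
    then obtain G where G: "generic S F G" and coll: "is_aleph S k"
      "\<not> is_aleph (generic_extension S F G) (ground_embedding S F G k)" unfolding collapses_def by blast
    interpret ccc_zf S F G by (rule ccc[OF G])
    have Ck: "Card k" using coll(1) is_aleph_iff[OF k] by blast
    note w1 = omega1[OF w(1,2)]
    have "w \<in> E k \<or> w = k \<or> k \<in> E w" using Ord_linear w1 Ck by auto
    \<comment> \<open>No aleph lies strictly between omega and omega_1, so these cases are
      exhaustive. They rest on different reasons: the countable cover, regularity, and the bound for
      functions on finite domains.\<close>
    then consider "w \<in> E k" | "k = w" | "k = om" using w1 Ck by blast
    then have "is_aleph M (j k)"
    proof cases
      case 1
      then show ?thesis using above[OF w(1,2) 1 k] c by blast
    next
      case 2
      have "is_cofinality S w w" using w(3) by (simp add: is_regular_def)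
      then show ?thesis unfolding 2 using w1 Card_Lim by (intro is_aleph_j_regular) auto
    next
      case 3
      then show ?thesis using is_aleph_j_om by simp
    qed
    then show False using coll(2) ground_embedding_eq[OF k] by simp
  qed
  show ?thesis using cof above all eps_iff by blast
qed

end
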